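(* Let $M$ be a homogeneous space of a Lie group $G$ with isotropy group $H$ at the origin. The affine space of connections and the set of reductive structures are in affine bijection with the affine space $\mathcal L_H(\mathfrak g/\mathfrak h\leftarrow\mathfrak g)$ of $H$-equivariant linear sections of the projection $\mathfrak g\to\mathfrak g/\mathfrak h$. The underlying linear space is $\mathcal L_H(\mathfrak g/\mathfrak h,\mathfrak h)$.
   Context: $G$ is a Lie group (treated as a matrix group) with Lie algebra $\mathfrak g$, acting smoothly and transitively on a smooth manifold $M$ ($g\cdot x$ denotes the action, $\xi\cdot x\in T_xM$ the infinitesimal action of $\xi\in\mathfrak g$). A point $o\in M$ (the origin) is fixed; $H=\{g\in G: g\cdot o=o\}$ is the isotropy group, with Lie algebra $\mathfrak h$; $T_oM$ is identified with $\mathfrak g/\mathfrak h$. $G$ acts on $\mathfrak g$ by $g\cdot\xi=g\xi g^{-1}$; $H$ acts on $\mathfrak g$, $\mathfrak h$ and $\mathfrak g/\mathfrak h$ accordingly. $Tg$ denotes the tangent map of $x\mapsto g\cdot x$. An isotropy form is a $\mathfrak g$-valued one-form $\omega\in\Omega^1(M,\mathfrak g)$ such that $\langle\omega,f\rangle_x\cdot x=f$ for all $x\in M$, $f\in T_xM$. A connection is an isotropy form that is equivariant: $\langle\omega,Tg\, f\rangle_{g\cdot x}=g\cdot\langle\omega,f\rangle_x$ for all $g\in G$, $x\in M$, $f\in T_xM$. A reductive structure (reductive decomposition) is a subspace $\mathfrak m\subset\mathfrak g$ such that $\mathfrak g=\mathfrak h\oplus\mathfrak m$ and $H\cdot\mathfrak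 m\subset\mathfrak m$. A complement $\mathfrak m$ of $\mathfrak h$ is identified with the linear section $\mu\colon\mathfrak g/\mathfrak h\to\mathfrak g$ (i.e. $\mu(x)+\mathfrak h=x$) having image $\mathfrak m$; the set of reductive structures gets its affine structure from this identification. $\mathcal L_H(V,W)$ denotes the space of $H$-equivariant linear maps $V\to W$. $\mathcal L_H(\mathfrak g/\mathfrak h\leftarrow\mathfrak g)=\{\mu\in\mathcal L_H(\mathfrak g/\mathfrak h,\mathfrak g): \mu(f)+\mathfrak h=f\ \ \forall f\in\mathfrak g/\mathfrak h\}$. Affine spaces may be empty. *)

theory Defs
  imports "HOL-Analysis.Analysis" "HOL-Algebra.Group_Action" "HOL-Library.Function_Algebras"
begin

section \<open>Function spaces\<close>

text \<open>Function types carry the pointwise vector space structure, so that the library notions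
  \<^const>\<open>affine\<close> and \<^const>\<open>subspace\<close> apply to sets of maps. Maps that live on a proper
  subset of a type are required to vanish outside of it.\<close>

instantiation "fun" :: (type, real_vector) real_vector
begin

definition "scaleR r f = (\<lambda>x. r *\<^sub>R f x)"

instance
  by standard (auto simp: scaleR_fun_def fun_eq_iff scaleR_add_right scaleR_add_left)

end

definition linear_on :: "'a::real_vector set \<Rightarrow> ('a \<Rightarrow> 'b::real_vector) \<Rightarrow> bool"
  where "linear_on V f \<longleftrightarrow>
    (\<forall>v\<in>V. \<forall>w\<in>V. f (v + w) = f v + f w) \<and> (\<forall>r. \<forall>v\<in>V. f (r *\<^sub>R v) = r *\<^sub>R f v)"

definition affine_comb :: "real \<Rightarrow> 'a::real_vector \<Rightarrow> 'a \<Rightarrow> 'a"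
  where "affine_comb t x y = (1 - t) *\<^sub>R x + t *\<^sub>R y"

text \<open>The operations \<open>C\<close> and \<open>D\<close> send \<open>t\<close>, \<open>x\<close>, \<open>y\<close> to the point
  \<open>(1 - t) x + t y\<close> of the affine space \<open>S\<close> and \<open>T\<close>, respectively. Affine spaces may be empty.\<close>

definition affine_bijection ::
    "(real \<Rightarrow> 'a \<Rightarrow> 'a \<Rightarrow> 'a) \<Rightarrow> 'a set \<Rightarrow> (real \<Rightarrow> 'b \<Rightarrow> 'b \<Rightarrow> 'b) \<Rightarrow> 'b set \<Rightarrow> ('a \<Rightarrow> 'b) \<Rightarrow> bool"
  where "affine_bijection C S D T F \<longleftrightarrow> bij_betw F S T \<and>
    (\<forall>t. \<forall>x\<in>S. \<forall>y\<in>S. C t x y \<in> S \<and> F (C t x y) = D t (F x) (F y))"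

section \<open>Smooth manifolds\<close>

text \<open>A manifold is modelled on a linear subspace \<open>V\<close> of a Euclidean space; \<open>V = UNIV\<close> is the usual
  case, and \<open>V = {0}\<close> gives the zero-dimensional manifolds, which are not available otherwise since
  a type of class \<^class>\<open>euclidean_space\<close> has positive dimension. For a relatively open subset \<open>S\<close> of
  \<open>V\<close> all derivatives are taken at \<open>x within V\<close>; they are uniquely determined on vectors of \<open>V\<close>
  and are only ever applied to such vectors.\<close>

primrec Ck_on ::
    "nat \<Rightarrow> 'e::real_normed_vector set \<Rightarrow> 'e set \<Rightarrow> ('e \<Rightarrow> 'f::real_normed_vector) \<Rightarrow> bool"
  where
    "Ck_on 0 V S f \<longleftrightarrow> continuous_on S f"
  | "Ck_on (Suc k) V S f \<longleftrightarrow> (\<forall>x\<in>S. f differentiable (at x within V)) \<and>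
      (\<forall>v\<in>V. Ck_on k V S (\<lambda>x. frechet_derivative f (at x within V) v))"

definition smooth_on ::
    "'e::real_normed_vector set \<Rightarrow> 'e set \<Rightarrow> ('e \<Rightarrow> 'f::real_normed_vector) \<Rightarrow> bool"
  where "smooth_on V S f \<longleftrightarrow> (\<forall>k. Ck_on k V S f)"

type_synonym ('a, 'e) chart = "'a set \<times> ('a \<Rightarrow> 'e)"

abbreviation chart_dom :: "('a, 'e) chart \<Rightarrow> 'a set"
  where "chart_dom c \<equiv> fst c"

abbreviation chart_map :: "('a, 'e) chart \<Rightarrow> 'a \<Rightarrow> 'e"
  where "chart_map c \<equiv> snd c"

definition chart_img :: "('a, 'e) chart \<Rightarrow> 'e set"
  where "chart_img c = chart_map c ` chart_dom c"

definition chart_inv :: "('a, 'e) chart \<Rightarrow> 'e \<Rightarrow> 'a"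
  where "chart_inv c = inv_into (chart_dom c) (chart_map c)"

definition is_chart :: "'e::euclidean_space set \<Rightarrow> ('a::topological_space, 'e) chart \<Rightarrow> bool"
  where "is_chart V c \<longleftrightarrow> open (chart_dom c) \<and> openin (top_of_set V) (chart_img c) \<and>
    homeomorphism (chart_dom c) (chart_img c) (chart_map c) (chart_inv c)"

record ('a, 'e) mfd =
  model :: "'e set"
  atlas :: "('a, 'e) chart set"

text \<open>The underlying topological space is the whole type \<open>'a\<close>, which is Hausdorff and second
  countable. The atlas need not be maximal.\<close>

definition smooth_manifold ::
    "('a::{t2_space, second_countable_topology}, 'e::euclidean_space) mfd \<Rightarrow> bool"
  where "smooth_manifold X \<longleftrightarrow> subspace (model X) \<and>
    (\<forall>c\<in>atlas X. is_chart (model X) c) \<and> (\<Union>c\<in>atlas X. chart_dom c) = UNIV \<and>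
    (\<forall>c\<in>atlas X. \<forall>d\<in>atlas X.
      smooth_on (model X) (chart_map c ` (chart_dom c \<inter> chart_dom d)) (chart_map d \<circ> chart_inv c))"

definition smooth_map ::
    "('a::topological_space, 'e::euclidean_space) mfd \<Rightarrow>
     ('b::topological_space, 'f::euclidean_space) mfd \<Rightarrow> ('a \<Rightarrow> 'b) \<Rightarrow> bool"
  where "smooth_map X Y F \<longleftrightarrow> continuous_on UNIV F \<and>
    (\<forall>c\<in>atlas X. \<forall>d\<in>atlas Y.
      smooth_on (model X) (chart_map c ` (chart_dom c \<inter> F -` chart_dom d))
        (chart_map d \<circ> F \<circ> chart_inv c))"

definition prod_mfd :: "('a, 'e) mfd \<Rightarrow> ('b, 'f) mfd \<Rightarrow> ('a \<times> 'b, 'e \<times> 'f) mfd"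
  where "prod_mfd X Y = \<lparr>model = model X \<times> model Y,
    atlas = {(chart_dom c \<times> chart_dom d, map_prod (chart_map c) (chart_map d)) | c d.
      c \<in> atlas X \<and> d \<in> atlas Y}\<rparr>"

definition real_mfd :: "(real, real) mfd"
  where "real_mfd = \<lparr>model = UNIV, atlas = {(UNIV, id)}\<rparr>"

text \<open>For each point \<open>x\<close> one chart around \<open>x\<close> is selected. Tangent vectors at \<open>x\<close> are represented
  by their coordinates in this chart, so every tangent space of \<open>X\<close> is the vector space
  \<open>model X\<close>. The choice of charts is arbitrary, in particular it is not continuous in \<open>x\<close>;
  smoothness of objects on the tangent bundle is therefore always expressed in the coordinates of
  a fixed chart.\<close>

definition chart_at :: "('a, 'e) mfd \<Rightarrow> 'a \<Rightarrow> ('a, 'e) chart"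
  where "chart_at X x = (SOME c. c \<in> atlas X \<and> x \<in> chart_dom c)"

definition tangent_map ::
    "('a, 'e::euclidean_space) mfd \<Rightarrow> ('b, 'f::euclidean_space) mfd \<Rightarrow> ('a \<Rightarrow> 'b) \<Rightarrow> 'a \<Rightarrow> 'e \<Rightarrow> 'f"
  where "tangent_map X Y F x = frechet_derivative
    (chart_map (chart_at Y (F x)) \<circ> F \<circ> chart_inv (chart_at X x))
    (at (chart_map (chart_at X x) x) within model X)"

text \<open>The tangent vector at the point with coordinates \<open>y\<close> in the chart \<open>c\<close> whose coordinates
  in the chart \<open>c\<close> are \<open>w\<close>.\<close>

definition coord_vector ::
    "('a, 'e::euclidean_space) mfd \<Rightarrow> ('a, 'e) chart \<Rightarrow> 'e \<Rightarrow> 'e \<Rightarrow> 'e"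
  where "coord_vector X c w y = frechet_derivative
    (chart_map (chart_at X (chart_inv c y)) \<circ> chart_inv c) (at y within model X) w"

text \<open>Smooth one-forms on \<open>X\<close> with values in the vector space \<open>W\<close>; smoothness means that the
  coefficients of the form in every chart are smooth.\<close>

definition one_forms ::
    "('a, 'e::euclidean_space) mfd \<Rightarrow> 'f::euclidean_space set \<Rightarrow> ('a \<Rightarrow> 'e \<Rightarrow> 'f) set"
  where "one_forms X W = {\<omega>.
    (\<forall>x. linear_on (model X) (\<omega> x) \<and> \<omega> x ` model X \<subseteq> W \<and> (\<forall>v. v \<notin> model X \<longrightarrow> \<omega> x v = 0)) \<and>
    (\<forall>c\<in>atlas X. \<forall>w\<in>model X.
      smooth_on (model X) (chart_img c) (\<lambda>y. \<omega> (chart_inv c y) (coord_vector X c w y)))}"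

section \<open>Lie groups and homogeneous spaces\<close>

definition lie_group ::
    "('g::{t2_space, second_countable_topology}, 'e::euclidean_space) mfd \<Rightarrow> 'g monoid \<Rightarrow> bool"
  where "lie_group X G \<longleftrightarrow> smooth_manifold X \<and> group G \<and> carrier G = UNIV \<and>
    smooth_map (prod_mfd X X) X (\<lambda>(g, k). g \<otimes>\<^bsub>G\<^esub> k) \<and> smooth_map X X (\<lambda>g. inv\<^bsub>G\<^esub> g)"

definition homogeneous_space ::
    "('g::{t2_space, second_countable_topology}, 'e::euclidean_space) mfd \<Rightarrow> 'g monoid \<Rightarrow>
     ('m::{t2_space, second_countable_topology}, 'f::euclidean_space) mfd \<Rightarrow>
     ('g \<Rightarrow> 'm \<Rightarrow> 'm) \<Rightarrow> bool"
  where "homogeneous_space X G M act \<longleftrightarrow> smooth_manifold M \<and>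
    transitive_action G UNIV act \<and> smooth_map (prod_mfd X M) M (\<lambda>(g, x). act g x)"

text \<open>The tangent space at the identity, that is, the Lie algebra of the group as a vector space.\<close>

abbreviation lie_algebra :: "('g, 'e) mfd \<Rightarrow> 'e set"
  where "lie_algebra X \<equiv> model X"

text \<open>The tangent space at the identity of a closed subgroup \<open>H\<close>: the velocities of the smooth
  curves of the ambient group that run in \<open>H\<close>.\<close>

definition subgroup_lie_algebra ::
    "('g::topological_space, 'e::euclidean_space) mfd \<Rightarrow> 'g monoid \<Rightarrow> 'g set \<Rightarrow> 'e set"
  where "subgroup_lie_algebra X G H = {tangent_map real_mfd X \<gamma> 0 1 | \<gamma>.
    smooth_map real_mfd X \<gamma> \<and> \<gamma> 0 = \<one>\<^bsub>G\<^esub> \<and> range \<gamma> \<subseteq> H}"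

text \<open>For a matrix group this is \<open>\<xi> \<mapsto> g \<xi> g\<inverse>\<close>.\<close>

definition Ad :: "('g, 'e::euclidean_space) mfd \<Rightarrow> 'g monoid \<Rightarrow> 'g \<Rightarrow> 'e \<Rightarrow> 'e"
  where "Ad X G g = tangent_map X X (\<lambda>k. g \<otimes>\<^bsub>G\<^esub> k \<otimes>\<^bsub>G\<^esub> inv\<^bsub>G\<^esub> g) \<one>\<^bsub>G\<^esub>"

definition inf_action ::
    "('g, 'e::euclidean_space) mfd \<Rightarrow> 'g monoid \<Rightarrow> ('m, 'f::euclidean_space) mfd \<Rightarrow>
     ('g \<Rightarrow> 'm \<Rightarrow> 'm) \<Rightarrow> 'e \<Rightarrow> 'm \<Rightarrow> 'f"
  where "inf_action X G M act \<xi> x = tangent_map X M (\<lambda>g. act g x) \<one>\<^bsub>G\<^esub> \<xi>"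

definition isotropy_forms ::
    "('g, 'e::euclidean_space) mfd \<Rightarrow> 'g monoid \<Rightarrow> ('m, 'f::euclidean_space) mfd \<Rightarrow>
     ('g \<Rightarrow> 'm \<Rightarrow> 'm) \<Rightarrow> ('m \<Rightarrow> 'f \<Rightarrow> 'e) set"
  where "isotropy_forms X G M act = {\<omega> \<in> one_forms M (lie_algebra X).
    \<forall>x. \<forall>f\<in>model M. inf_action X G M act (\<omega> x f) x = f}"

definition connections ::
    "('g, 'e::euclidean_space) mfd \<Rightarrow> 'g monoid \<Rightarrow> ('m, 'f::euclidean_space) mfd \<Rightarrow>
     ('g \<Rightarrow> 'm \<Rightarrow> 'm) \<Rightarrow> ('m \<Rightarrow> 'f \<Rightarrow> 'e) set"
  where "connections X G M act = {\<omega> \<in> isotropy_forms X G M act.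
    \<forall>g. \<forall>x. \<forall>f\<in>model M. \<omega> (act g x) (tangent_map M M (act g) x f) = Ad X G g (\<omega> x f)}"

section \<open>The quotient by a subspace, sections and complements\<close>

definition coset :: "'e::real_vector set \<Rightarrow> 'e \<Rightarrow> 'e set"
  where "coset \<hh> \<xi> = {\<xi> + \<eta> | \<eta>. \<eta> \<in> \<hh>}"

definition quotient_space :: "'e::real_vector set \<Rightarrow> 'e set \<Rightarrow> 'e set set"
  where "quotient_space \<gg> \<hh> = coset \<hh> ` \<gg>"

text \<open>Linear maps from \<open>\<gg>/\<hh>\<close> to \<open>W\<close>. The sum of the cosets of \<open>\<xi>\<close> and \<open>\<eta>\<close> is the coset
  of \<open>\<xi> + \<eta>\<close>, and similarly for multiples, so linearity on the quotient means linearity in the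
  representatives.\<close>

definition quotient_linear_maps ::
    "'e::real_vector set \<Rightarrow> 'e set \<Rightarrow> 'e set \<Rightarrow> ('e set \<Rightarrow> 'e) set"
  where "quotient_linear_maps \<gg> \<hh> W = {\<mu>. linear_on \<gg> (\<lambda>\<xi>. \<mu> (coset \<hh> \<xi>)) \<and>
    \<mu> ` quotient_space \<gg> \<hh> \<subseteq> W \<and> (\<forall>A. A \<notin> quotient_space \<gg> \<hh> \<longrightarrow> \<mu> A = 0)}"

definition linear_sections :: "'e::real_vector set \<Rightarrow> 'e set \<Rightarrow> ('e set \<Rightarrow> 'e) set"
  where "linear_sections \<gg> \<hh> = {\<mu> \<in> quotient_linear_maps \<gg> \<hh> \<gg>.
    \<forall>A\<in>quotient_space \<gg> \<hh>. coset \<hh> (\<mu> A) = A}"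

definition complements :: "'e::real_vector set \<Rightarrow> 'e set \<Rightarrow> 'e set set"
  where "complements \<gg> \<hh> = {\<mm>. subspace \<mm> \<and> \<gg> = {\<eta> + \<xi> | \<eta> \<xi>. \<eta> \<in> \<hh> \<and> \<xi> \<in> \<mm>} \<and> \<hh> \<inter> \<mm> = {0}}"

definition section_of :: "'e::real_vector set \<Rightarrow> 'e set \<Rightarrow> 'e set \<Rightarrow> ('e set \<Rightarrow> 'e)"
  where "section_of \<gg> \<hh> \<mm> = (THE \<mu>. \<mu> \<in> linear_sections \<gg> \<hh> \<and> \<mu> ` quotient_space \<gg> \<hh> = \<mm>)"

text \<open>The affine structure on complements obtained by identifying a complement with the linear
  section of which it is the image.\<close>

definition complement_comb ::
    "'e::real_vector set \<Rightarrow> 'e set \<Rightarrow> real \<Rightarrow> 'e set \<Rightarrow> 'e set \<Rightarrow> 'e set"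
  where "complement_comb \<gg> \<hh> t \<mm> \<mm>' =
    affine_comb t (section_of \<gg> \<hh> \<mm>) (section_of \<gg> \<hh> \<mm>') ` quotient_space \<gg> \<hh>"

definition reductive_structures ::
    "('g, 'e::euclidean_space) mfd \<Rightarrow> 'g monoid \<Rightarrow> 'g set \<Rightarrow> 'e set \<Rightarrow> 'e set set"
  where "reductive_structures X G H \<hh> = {\<mm> \<in> complements (lie_algebra X) \<hh>.
    \<forall>k\<in>H. Ad X G k ` \<mm> \<subseteq> \<mm>}"

text \<open>The element \<open>k\<close> of \<open>H\<close> sends the coset of \<open>\<xi>\<close> to the coset of \<open>Ad k \<xi>\<close>.\<close>

definition equivariant_maps ::
    "('g, 'e::euclidean_space) mfd \<Rightarrow> 'g monoid \<Rightarrow> 'g set \<Rightarrow> 'e set \<Rightarrow> 'e set \<Rightarrow> ('e set \<Rightarrow> 'e) set"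
  where "equivariant_maps X G H \<hh> W = {\<mu> \<in> quotient_linear_maps (lie_algebra X) \<hh> W.
    \<forall>k\<in>H. \<forall>\<xi>\<in>lie_algebra X. \<mu> (coset \<hh> (Ad X G k \<xi>)) = Ad X G k (\<mu> (coset \<hh> \<xi>))}"

definition equivariant_sections ::
    "('g, 'e::euclidean_space) mfd \<Rightarrow> 'g monoid \<Rightarrow> 'g set \<Rightarrow> 'e set \<Rightarrow> ('e set \<Rightarrow> 'e) set"
  where "equivariant_sections X G H \<hh> = {\<mu> \<in> equivariant_maps X G H \<hh> (lie_algebra X).
    \<forall>A\<in>quotient_space (lie_algebra X) \<hh>. coset \<hh> (\<mu> A) = A}"

end

theory Submission
  imports Defs
begin

text \<open>A connection \<open>\<omega>\<close> is determined by its value at the origin, and \<open>\<xi> \<mapsto> \<omega>\<^sub>o(\<xi> \<cdot> o)\<close> descends to an equivariant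
  section of \<open>\<gg> \<rightarrow> \<gg>/\<hh>\<close>. Conversely, a section \<open>\<mu>\<close> gives \<open>\<theta>(\<xi> \<cdot> o) = \<mu>(\<xi> + \<hh>)\<close> and the form
  \<open>\<omega>\<^sub>x(f) = g \<cdot> \<theta>(g\<inverse> f)\<close> for any \<open>g\<close> with \<open>g \<cdot> o = x\<close>. This rests on two facts about the orbit map
  \<open>g \<mapsto> g \<cdot> o\<close>: its derivative \<open>\<xi> \<mapsto> \<xi> \<cdot> o\<close> at the unit is onto, and has kernel \<open>\<hh>\<close>. The orbit map has constant
  rank by equivariance; were it not a submersion, small pieces of the orbit would have empty interior, contradicting
  Baire's theorem. The inverse function theorem then yields smooth curves in the isotropy group with any velocity
  in the kernel, and smooth local sections of the orbit map, from which smoothness of \<open>\<omega>\<close> follows.\<close>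

section \<open>Smooth maps on relatively open subsets of a subspace\<close>

text \<open>Transitivity speaks of points only, so surjectivity of the derivative of the orbit map
  has to be extracted from topology. The constant rank theorem enters in a form without coordinates
  adapted to the image: for a generalised inverse \<open>L\<close> of the derivative
  \<open>A0\<close>, a change of coordinates in the group alone makes
  \<open>A0 \<circ> L \<circ> f0\<close> affine, and equality of kernels makes \<open>f0\<close>,
  read in these coordinates, constant along the kernel of \<open>A0\<close>. That is enough for the
  Baire argument; once \<open>A0\<close> is known to be onto, the same coordinates make
  \<open>f0\<close> affine. Two features of the encoding shape the rest. Models are subspaces of
  Euclidean spaces, so a derivative is determined only on vectors of the model; identities between
  derivatives are asserted there, and linear projections onto the model stand in for bases of it.
  Tangent vectors are coordinates in charts selected point by point without continuity, so
  smoothness is moved to local representatives in fixed charts, and the maps to be differentiated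
  are arranged to end at the origin or at the unit, where the selected chart stays the same.\<close>

definition relopen :: "'e::real_normed_vector set \<Rightarrow> 'e set \<Rightarrow> bool"
  where "relopen V S \<longleftrightarrow> subspace V \<and> openin (top_of_set V) S"

lemma relopenD: "relopen V S \<Longrightarrow> subspace V" "relopen V S \<Longrightarrow> openin (top_of_set V) S"
  "relopen V S \<Longrightarrow> x \<in> S \<Longrightarrow> x \<in> V"
  using openin_imp_subset by (auto simp: relopen_def)

text \<open>A point of \<open>S\<close> has an ambient neighbourhood in which \<open>S\<close> and
  \<open>V\<close> coincide. Derivatives can thus be taken within the fixed subspace
  \<open>V\<close> and still be computed on \<open>S\<close>.\<close>

lemma at_within_relopen:
  assumes "relopen V S" "x \<in> S" shows "at x within S = at x within V"
proof -
  obtain T where "open T" "S = V \<inter> T"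
    using assms by (auto simp: relopen_def openin_open)
  then show ?thesis using assms(2) by (intro at_within_nhd[of x T]) auto
qed

lemma has_derivative_cong_relopen:
  assumes "relopen V S" "x \<in> S" "\<And>y. y \<in> S \<Longrightarrow> f y = g y" "(f has_derivative D) (at x within V)"
  shows "(g has_derivative D) (at x within V)"
  using has_derivative_transform[of x S g f D] assms at_within_relopen[OF assms(1,2)] by auto

text \<open>The line through \<open>x\<close> with direction \<open>v\<close> stays in
  \<open>V\<close>, so both derivatives compose with it to derivatives of one curve on the real
  line, where uniqueness holds. Directions outside \<open>V\<close> are beyond this argument, as a
  derivative within \<open>V\<close> is not constrained there.\<close>

lemma has_derivative_subspace_unique:
  assumes "subspace V" "x \<in> V" "v \<in> V"
    and "(f has_derivative D) (at x within V)" "(f has_derivative E) (at x within V)"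
  shows "D v = E v"
proof -
  have "(f \<circ> (\<lambda>t. x + t *\<^sub>R v) has_derivative (F \<circ> (\<lambda>t. t *\<^sub>R v))) (at 0)"
    if "(f has_derivative F) (at x within V)" for F
  proof -
    have "range (\<lambda>t. x + t *\<^sub>R v) \<subseteq> V"
      using assms(1-3) by (auto intro: subspace_add subspace_scale)
    then have "(f has_derivative F) (at (x + 0 *\<^sub>R v) within range (\<lambda>t. x + t *\<^sub>R v))"
      using has_derivative_subset[OF that] by simp
    moreover have "((\<lambda>t. x + t *\<^sub>R v) has_derivative (\<lambda>t. t *\<^sub>R v)) (at (0::real))"
      by (auto intro!: derivative_eq_intros)
    ultimately show ?thesis using diff_chain_within[of "\<lambda>t. x + t *\<^sub>R v" _ 0 UNIV f F] by simp
  qed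
  from has_derivative_unique[OF this[OF assms(4)] this[OF assms(5)]]
  have "(D \<circ> (\<lambda>t. t *\<^sub>R v)) 1 = (E \<circ> (\<lambda>t. t *\<^sub>R v)) 1" by (rule fun_cong)
  then show ?thesis by simp
qed

lemma frechet_derivative_subspace:
  assumes "subspace V" "x \<in> V" "v \<in> V" "(f has_derivative D) (at x within V)"
  shows "frechet_derivative f (at x within V) v = D v"
  using has_derivative_subspace_unique[OF assms(1-3) _ assms(4)] differentiableI[OF assms(4)]
    frechet_derivative_works by blast

lemma has_derivative_chain_subspace:
  assumes S: "relopen V S" and T: "relopen W T" and "x \<in> S" and fT: "f ` S \<subseteq> T"
    and f: "(f has_derivative D) (at x within V)" and g: "(g has_derivative E) (at (f x) within W)"
  shows "((\<lambda>x. g (f x)) has_derivative (\<lambda>v. E (D v))) (at x within V)"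
proof -
  have "(f has_derivative D) (at x within S)" using f at_within_relopen[OF S \<open>x \<in> S\<close>] by simp
  moreover have "(g has_derivative E) (at (f x) within f ` S)"
    using g fT openin_imp_subset[OF relopenD(2)[OF T]] by (meson has_derivative_subset order_trans)
  ultimately have "(g \<circ> f has_derivative E \<circ> D) (at x within S)" by (rule diff_chain_within)
  then show ?thesis using at_within_relopen[OF S \<open>x \<in> S\<close>] by (simp add: o_def)
qed

text \<open>The projection serves two purposes: the vectors \<open>P b\<close> with \<open>b\<close>
  in \<open>Basis\<close> replace a basis of \<open>V\<close>, and composition with \<open>P\<close>
  extends maps from \<open>V\<close> to the whole space.\<close>

lemma subspace_projection_exists:
  fixes V :: "'a::euclidean_space set"
  assumes "subspace V"
  obtains P where "bounded_linear P" "range P \<subseteq> V" "\<And>v. v \<in> V \<Longrightarrow> P v = v"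
proof -
  have "linear (\<lambda>x::'a. x)" by (rule linear_ident)
  \<comment> \<open>A right inverse of the identity on \<open>V\<close> with values in
    \<open>V\<close> is a projection onto \<open>V\<close>.\<close>
  then obtain P where "range P \<subseteq> V" "linear P" "\<forall>v\<in>(\<lambda>x. x) ` V. (\<lambda>x. x) (P v) = v"
    using linear_exists_right_inverse_on[OF _ assms, of "\<lambda>x. x"] by blast
  then show thesis using that[of P] by (auto simp: linear_conv_bounded_linear)
qed

text \<open>With a projection \<open>P\<close> onto \<open>W\<close>, the map
  \<open>f - P \<circ> f\<close> vanishes on \<open>S\<close>, so its derivative kills
  \<open>v\<close> and \<open>D v = P (D v)\<close>.\<close>

lemma has_derivative_in_subspace:
  fixes f :: "'a::real_normed_vector \<Rightarrow> 'b::euclidean_space"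
  assumes S: "relopen V S" "x \<in> S" and W: "subspace W" "f ` S \<subseteq> W"
    and f: "(f has_derivative D) (at x within V)" and v: "v \<in> V"
  shows "D v \<in> W"
proof -
  obtain P where P: "bounded_linear P" "range P \<subseteq> W" "\<And>w. w \<in> W \<Longrightarrow> P w = w"
    using subspace_projection_exists[OF W(1)] by metis
  have "((\<lambda>y. f y - P (f y)) has_derivative (\<lambda>v. D v - P (D v))) (at x within V)"
    by (intro has_derivative_diff f bounded_linear.has_derivative[OF P(1)])
  moreover have "f y - P (f y) = 0" if "y \<in> S" for y using W P that by auto
  ultimately have "((\<lambda>y. 0) has_derivative (\<lambda>v. D v - P (D v))) (at x within V)"
    using has_derivative_cong_relopen[OF S, of "\<lambda>y. f y - P (f y)" "\<lambda>y. 0"] by blast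
  then have "D v - P (D v) = 0"
    using has_derivative_subspace_unique[OF relopenD(1)[OF S(1)] relopenD(3)[OF S] v _ has_derivative_const]
    by blast
  then show ?thesis using P(2) by (metis eq_iff_diff_eq_0 range_subsetD)
qed

section \<open>Maps of class C^k relative to a subspace\<close>

lemma Ck_on_mono: "Ck_on k V S f \<Longrightarrow> T \<subseteq> S \<Longrightarrow> Ck_on k V T f"
  by (induction k arbitrary: f) (auto intro: continuous_on_subset)

text \<open>\<open>frechet_derivative\<close> within \<open>V\<close> selects one of possibly many
  derivatives, and the selections for \<open>f\<close> and \<open>g\<close> may differ off
  \<open>V\<close>. \<open>Ck_on\<close> evaluates them on \<open>V\<close> only, where they
  agree.\<close>

lemma Ck_on_cong:
  assumes "relopen V S" "\<And>x. x \<in> S \<Longrightarrow> f x = g x" "Ck_on k V S f"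
  shows "Ck_on k V S g"
  using assms(2,3)
proof (induction k arbitrary: f g)
  case 0 then show ?case using continuous_on_cong by fastforce
next
  case (Suc k)
  have d: "(g has_derivative frechet_derivative f (at x within V)) (at x within V)" if "x \<in> S" for x
    using Suc.prems(2) that has_derivative_cong_relopen[OF assms(1) that, of f g] Suc.prems(1)
    by (simp add: frechet_derivative_works)
  have "frechet_derivative f (at x within V) v = frechet_derivative g (at x within V) v"
    if "x \<in> S" "v \<in> V" for x v
    using frechet_derivative_subspace[OF relopenD(1)[OF assms(1)] relopenD(3)[OF assms(1) that(1)] that(2) d[OF that(1)]]
    by simp
  note fd = this
  show ?case unfolding Ck_on.simps
  proof (intro conjI ballI)
    fix x assume "x \<in> S" then show "g differentiable at x within V" using d differentiableI by blast
  next
    fix v assume "v \<in> V"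
    then show "Ck_on k V S (\<lambda>x. frechet_derivative g (at x within V) v)"
      by (intro Suc.IH[OF fd bspec[OF conjunct2[OF Suc.prems(2)[unfolded Ck_on.simps]]]])
  qed
qed

text \<open>Frees later arguments from the selected \<open>frechet_derivative\<close>: any family of
  derivatives will do, in particular one with an explicit formula.\<close>

lemma Ck_on_SucI:
  assumes "relopen V S" "\<And>x. x \<in> S \<Longrightarrow> (f has_derivative D x) (at x within V)"
    "\<And>v. v \<in> V \<Longrightarrow> Ck_on k V S (\<lambda>x. D x v)"
  shows "Ck_on (Suc k) V S f"
proof -
  have "Ck_on k V S (\<lambda>x. frechet_derivative f (at x within V) v)" if v: "v \<in> V" for v
  proof (rule Ck_on_cong[OF assms(1) _ assms(3)[OF v]])
    fix x assume "x \<in> S"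
    then show "D x v = frechet_derivative f (at x within V) v"
      using frechet_derivative_subspace[OF relopenD(1)[OF assms(1)] relopenD(3)[OF assms(1)] v assms(2)] by metis
  qed
  then show ?thesis unfolding Ck_on.simps using assms(2) differentiableI by blast
qed

lemma Ck_on_SucE:
  assumes "Ck_on (Suc k) V S f"
  obtains D where "\<And>x. x \<in> S \<Longrightarrow> (f has_derivative D x) (at x within V)"
    "\<And>v. v \<in> V \<Longrightarrow> Ck_on k V S (\<lambda>x. D x v)"
  using assms that[of "\<lambda>x. frechet_derivative f (at x within V)"] by (auto simp: frechet_derivative_works)

lemma Ck_on_Suc_imp:
  assumes "relopen V S" "Ck_on (Suc k) V S f" shows "Ck_on k V S f"
  using assms(2)
proof (induction k arbitrary: f)
  case 0
  then have "\<forall>x\<in>S. f differentiable (at x within S)"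
    using at_within_relopen[OF assms(1)] by auto
  then show ?case by (auto intro: differentiable_imp_continuous_on simp: differentiable_on_def)
qed auto

lemma Ck_on_local:
  assumes "relopen V S" "\<And>x. x \<in> S \<Longrightarrow> \<exists>T. relopen V T \<and> x \<in> T \<and> Ck_on k V T f"
  shows "Ck_on k V S f"
  using assms(2)
proof (induction k arbitrary: f)
  case 0
  have "continuous (at x within S) f" if x: "x \<in> S" for x
  proof -
    obtain T where T: "relopen V T" "x \<in> T" "continuous_on T f"
      using 0[OF x] unfolding Ck_on.simps by blast
    then show ?thesis
      unfolding at_within_relopen[OF assms(1) x] at_within_relopen[OF T(1,2), symmetric]
      using continuous_on_eq_continuous_within by blast
  qed
  then show ?case by (simp add: continuous_on_eq_continuous_within)
next
  case (Suc k)
  show ?case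
    unfolding Ck_on.simps
  proof (intro conjI ballI)
    fix x assume "x \<in> S" then show "f differentiable at x within V"
      using Suc.prems[of x] unfolding Ck_on.simps by blast
  next
    fix v assume v: "v \<in> V"
    show "Ck_on k V S (\<lambda>x. frechet_derivative f (at x within V) v)"
    proof (rule Suc.IH)
      fix x assume "x \<in> S"
      with v show "\<exists>T. relopen V T \<and> x \<in> T \<and> Ck_on k V T (\<lambda>x. frechet_derivative f (at x within V) v)"
        using Suc.prems[of x] unfolding Ck_on.simps by blast
    qed
  qed
qed

lemma Ck_on_const: "relopen V S \<Longrightarrow> Ck_on k V S (\<lambda>x. c)"
proof (induction k arbitrary: c)
  case (Suc k)
  show ?case by (rule Ck_on_SucI[OF Suc.prems has_derivative_const]) (rule Suc.IH[OF Suc.prems])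
qed (auto)

lemma Ck_on_bounded_linear_comp:
  assumes "relopen V S" "bounded_linear L"
  shows "Ck_on k V S f \<Longrightarrow> Ck_on k V S (\<lambda>x. L (f x))"
proof (induction k arbitrary: f)
  case 0 then show ?case using assms(2) by (auto intro: bounded_linear.continuous_on)
next
  case (Suc k)
  obtain D where D: "\<And>x. x \<in> S \<Longrightarrow> (f has_derivative D x) (at x within V)"
    "\<And>v. v \<in> V \<Longrightarrow> Ck_on k V S (\<lambda>x. D x v)" by (rule Ck_on_SucE[OF Suc.prems]) (rule that)
  show ?case
    by (rule Ck_on_SucI[OF assms(1) bounded_linear.has_derivative[OF assms(2) D(1)] Suc.IH[OF D(2)]])
qed

lemma Ck_on_add:
  assumes "relopen V S"
  shows "Ck_on k V S f \<Longrightarrow> Ck_on k V S g \<Longrightarrow> Ck_on k V S (\<lambda>x. f x + g x)"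
proof (induction k arbitrary: f g)
  case 0 then show ?case by (auto intro: continuous_on_add)
next
  case (Suc k)
  obtain D where D: "\<And>x. x \<in> S \<Longrightarrow> (f has_derivative D x) (at x within V)"
    "\<And>v. v \<in> V \<Longrightarrow> Ck_on k V S (\<lambda>x. D x v)" by (rule Ck_on_SucE[OF Suc.prems(1)]) (rule that)
  obtain E where E: "\<And>x. x \<in> S \<Longrightarrow> (g has_derivative E x) (at x within V)"
    "\<And>v. v \<in> V \<Longrightarrow> Ck_on k V S (\<lambda>x. E x v)" by (rule Ck_on_SucE[OF Suc.prems(2)]) (rule that)
  show ?case
    by (rule Ck_on_SucI[OF assms(1) has_derivative_add[OF D(1) E(1)] Suc.IH[OF D(2) E(2)]])
qed

lemma Ck_on_scaleR:
  assumes "relopen V S"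
  shows "Ck_on k V S f \<Longrightarrow> Ck_on k V S g \<Longrightarrow> Ck_on k V S (\<lambda>x. f x *\<^sub>R g x)"
proof (induction k arbitrary: f g)
  case 0 then show ?case by (auto intro: continuous_on_scaleR)
next
  case (Suc k)
  obtain D where D: "\<And>x. x \<in> S \<Longrightarrow> (f has_derivative D x) (at x within V)"
    "\<And>v. v \<in> V \<Longrightarrow> Ck_on k V S (\<lambda>x. D x v)" by (rule Ck_on_SucE[OF Suc.prems(1)]) (rule that)
  obtain E where E: "\<And>x. x \<in> S \<Longrightarrow> (g has_derivative E x) (at x within V)"
    "\<And>v. v \<in> V \<Longrightarrow> Ck_on k V S (\<lambda>x. E x v)" by (rule Ck_on_SucE[OF Suc.prems(2)]) (rule that)
  note lower = Ck_on_Suc_imp[OF assms]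
  show ?case
    by (rule Ck_on_SucI[OF assms(1) has_derivative_scaleR[OF D(1) E(1)]
      Ck_on_add[OF assms Suc.IH[OF lower[OF Suc.prems(1)] E(2)] Suc.IH[OF D(2) lower[OF Suc.prems(2)]]]])
qed

lemma Ck_on_sum:
  assumes "relopen V S" "\<And>i. i \<in> I \<Longrightarrow> Ck_on k V S (f i)"
  shows "Ck_on k V S (\<lambda>x. \<Sum>i\<in>I. f i x)"
  using assms(2)
  by (induction I rule: infinite_finite_induct) (auto intro: Ck_on_const Ck_on_add assms(1))

lemma Ck_on_id: "relopen V S \<Longrightarrow> Ck_on k V S (\<lambda>x. x)"
proof (cases k)
  case (Suc j)
  assume "relopen V S"
  then show ?thesis unfolding Suc by (intro Ck_on_SucI[OF _ has_derivative_ident] Ck_on_const) auto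
qed auto

lemma Ck_on_Pair:
  assumes "relopen V S" "Ck_on k V S f" "Ck_on k V S g"
  shows "Ck_on k V S (\<lambda>x. (f x, g x))"
proof -
  have *: "bounded_linear (\<lambda>y. (y, 0))" "bounded_linear (\<lambda>y. (0, y))"
    by (intro bounded_linear_intros)+
  have "Ck_on k V S (\<lambda>x. (f x, 0) + (0, g x))"
    by (rule Ck_on_add[OF assms(1) Ck_on_bounded_linear_comp[OF assms(1) *(1) assms(2)]
       Ck_on_bounded_linear_comp[OF assms(1) *(2) assms(3)]])
  then show ?thesis by simp
qed

text \<open>The standard basis need not lie in \<open>V\<close>, but for a projection onto
  \<open>V\<close> the vectors \<open>P b\<close> do. The expansion separates a moving argument
  \<open>v\<close> from a moving map \<open>L\<close>: scalar coefficients on one side, values at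
  fixed vectors on the other.\<close>

lemma projection_expansion:
  fixes V :: "'a::euclidean_space set"
  assumes "bounded_linear P" "\<And>v. v \<in> V \<Longrightarrow> P v = v" "linear L" "v \<in> V"
  shows "L v = (\<Sum>b\<in>Basis. (v \<bullet> b) *\<^sub>R L (P b))"
proof -
  have "L v = L (P (\<Sum>b\<in>Basis. (v \<bullet> b) *\<^sub>R b))" using assms by (simp add: euclidean_representation)
  also have "\<dots> = (\<Sum>b\<in>Basis. (v \<bullet> b) *\<^sub>R L (P b))"
    using assms by (simp add: linear_sum linear_scale bounded_linear.linear o_def)
  finally show ?thesis .
qed

lemma Ck_on_compose:
  fixes f :: "'a::real_normed_vector \<Rightarrow> 'b::euclidean_space"
  assumes S: "relopen V S" and T: "relopen W T" and fT: "f ` S \<subseteq> T"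
  shows "Ck_on k V S f \<Longrightarrow> Ck_on k W T g \<Longrightarrow> Ck_on k V S (\<lambda>x. g (f x))"
proof (induction k arbitrary: g)
  case 0
  then show ?case using fT by (auto intro: continuous_on_compose2)
next
  case (Suc k)
  obtain D where D: "\<And>x. x \<in> S \<Longrightarrow> (f has_derivative D x) (at x within V)"
    "\<And>v. v \<in> V \<Longrightarrow> Ck_on k V S (\<lambda>x. D x v)" by (rule Ck_on_SucE[OF Suc.prems(1)]) (rule that)
  obtain E where E: "\<And>x. x \<in> T \<Longrightarrow> (g has_derivative E x) (at x within W)"
    "\<And>v. v \<in> W \<Longrightarrow> Ck_on k W T (\<lambda>x. E x v)" by (rule Ck_on_SucE[OF Suc.prems(2)]) (rule that)
  obtain P where P: "bounded_linear P" "range P \<subseteq> W" "\<And>w. w \<in> W \<Longrightarrow> P w = w"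
    using subspace_projection_exists[OF relopenD(1)[OF T]] by metis
  have TW: "T \<subseteq> W" using T relopenD by blast
  have "Ck_on k V S (\<lambda>x. E (f x) (D x v))" if v: "v \<in> V" for v
  proof -
    \<comment> \<open>In \<open>E (f x) (D x v)\<close> both the linear map and its argument depend
      on \<open>x\<close>. After expansion each summand is a product of a coefficient of
      \<open>D x v\<close> and a derivative of \<open>g\<close> in a fixed direction composed with
      \<open>f\<close>, to which the induction hypothesis applies.\<close>
    have eq: "E (f x) (D x v) = (\<Sum>b\<in>Basis. (D x v \<bullet> b) *\<^sub>R E (f x) (P b))" if x: "x \<in> S" for x
    proof (rule projection_expansion[OF P(1,3)])
      show "linear (E (f x))" using E(1) fT x has_derivative_linear by blast
      show "D x v \<in> W"
        using has_derivative_in_subspace[OF S x relopenD(1)[OF T] _ D(1)[OF x] v] fT TW by auto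
    qed
    have ck: "Ck_on k V S (\<lambda>x. \<Sum>b\<in>Basis. (D x v \<bullet> b) *\<^sub>R E (f x) (P b))"
    proof (intro Ck_on_sum S Ck_on_scaleR)
      fix b :: 'b
      show "Ck_on k V S (\<lambda>x. D x v \<bullet> b)"
        by (rule Ck_on_bounded_linear_comp[OF S bounded_linear_inner_left D(2)[OF v]])
      show "Ck_on k V S (\<lambda>x. E (f x) (P b))"
        using P(2) by (intro Suc.IH[OF Ck_on_Suc_imp[OF S Suc.prems(1)]] E(2)) auto
    qed
    show ?thesis by (rule Ck_on_cong[OF S _ ck]) (simp add: eq)
  qed
  note ck = this
  have "((\<lambda>x. g (f x)) has_derivative (\<lambda>v. E (f x) (D x v))) (at x within V)" if "x \<in> S" for x
    using that fT by (intro has_derivative_chain_subspace[OF S T _ fT D(1) E(1)]) auto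
  then show ?case using ck by (rule Ck_on_SucI[OF S])
qed

lemma relopen_UNIV: "relopen UNIV S \<longleftrightarrow> open S"
  by (simp add: relopen_def)

lemma smooth_onD: "smooth_on V S f \<Longrightarrow> Ck_on k V S f"
  by (simp add: smooth_on_def)

lemma smooth_on_imp_has_derivative:
  "smooth_on V S f \<Longrightarrow> x \<in> S \<Longrightarrow> (f has_derivative frechet_derivative f (at x within V)) (at x within V)"
  using smooth_onD[of V S f "Suc 0"] by (simp add: frechet_derivative_works)

lemma smooth_on_frechet_derivative:
  assumes "smooth_on V S f" "v \<in> V"
  shows "smooth_on V S (\<lambda>x. frechet_derivative f (at x within V) v)"
  unfolding smooth_on_def
proof
  fix k show "Ck_on k V S (\<lambda>x. frechet_derivative f (at x within V) v)"
    using smooth_onD[OF assms(1), of "Suc k"] assms(2) by simp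
qed

lemma smooth_on_imp_continuous_on: "smooth_on V S f \<Longrightarrow> continuous_on S f"
  using smooth_onD[of V S f 0] by simp

text \<open>Continuity of \<open>\<beta>\<close> suffices because \<open>a\<close> vanishes at the point. This is what makes the derivative of an
  inverse function differentiable without differentiating operator inversion.\<close>

lemma has_derivative_scaleR_vanishing:
  fixes a :: "'a::real_normed_vector \<Rightarrow> real"
  assumes a: "(a has_derivative a') (at y)" "a y = 0" and \<beta>: "isCont \<beta> y"
  shows "((\<lambda>z. a z *\<^sub>R \<beta> z) has_derivative (\<lambda>h. a' h *\<^sub>R \<beta> y)) (at y)"
proof -
  have bl: "bounded_linear a'" using has_derivative_bounded_linear[OF a(1)] .
  then obtain K where K: "\<And>h. norm (a' h) \<le> norm h * K" using bounded_linear.bounded by blast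
  define r where "r = (\<lambda>z. norm (a z - a y - a' (z - y)) / norm (z - y))"
  have r: "(r \<longlongrightarrow> 0) (at y)" using a(1) unfolding has_derivative_iff_norm r_def by blast
  have \<beta>0: "((\<lambda>z. norm (\<beta> z - \<beta> y)) \<longlongrightarrow> 0) (at y)"
    using \<beta> unfolding isCont_def by (simp add: LIM_zero tendsto_norm_zero)
  have "((\<lambda>z. (r z + K) * norm (\<beta> z - \<beta> y)) \<longlongrightarrow> (0 + K) * 0) (at y)"
    by (intro tendsto_intros r \<beta>0)
  then have up: "((\<lambda>z. (r z + K) * norm (\<beta> z - \<beta> y)) \<longlongrightarrow> 0) (at y)" by simp
  \<comment> \<open>As \<open>a y = 0\<close>, the value \<open>a z\<close> is an increment and
    hence of order \<open>norm (z - y)\<close>; smallness then comes from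
    \<open>\<beta> z - \<beta> y\<close> alone.\<close>
  have bound: "norm (a z *\<^sub>R (\<beta> z - \<beta> y)) / norm (z - y) \<le> (r z + K) * norm (\<beta> z - \<beta> y)" for z
  proof (cases "z = y")
    case False
    have "\<bar>a z\<bar> \<le> norm (a z - a y - a' (z - y)) + norm (a' (z - y))" using a(2) by simp
    also have "\<dots> \<le> norm (a z - a y - a' (z - y)) + norm (z - y) * K" using K by simp
    also have "\<dots> = (r z + K) * norm (z - y)" using False by (simp add: r_def field_simps)
    finally have "\<bar>a z\<bar> / norm (z - y) \<le> r z + K" using False by (simp add: field_simps)
    then have "\<bar>a z\<bar> / norm (z - y) * norm (\<beta> z - \<beta> y) \<le> (r z + K) * norm (\<beta> z - \<beta> y)"
      by (rule mult_right_mono) simp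
    then show ?thesis by simp
  qed (simp add: r_def)
  have "((\<lambda>z. norm (a z *\<^sub>R (\<beta> z - \<beta> y)) / norm (z - y)) \<longlongrightarrow> 0) (at y)"
    by (rule tendsto_sandwich[OF _ _ tendsto_const up]) (use bound in \<open>auto simp: divide_simps\<close>)
  then have "((\<lambda>z. a z *\<^sub>R (\<beta> z - \<beta> y)) has_derivative (\<lambda>h. 0)) (at y)"
    unfolding has_derivative_iff_norm using a(2) by simp
  from has_derivative_add[OF has_derivative_scaleR_left[OF a(1), of "\<beta> y"] this]
  show ?thesis by (simp add: scaleR_diff_right)
qed

text \<open>The C^1 inverse function theorem supplies \<open>\<phi>\<close> and its derivative
  \<open>g'\<close>. Smoothness is a bootstrap: the derivative of \<open>g'\<close> is a polynomial
  expression in \<open>g'\<close> and the second derivatives of \<open>F\<close> along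
  \<open>\<phi>\<close>, so each round gains one order of differentiability.\<close>

lemma smooth_local_inverse_UNIV:
  fixes F :: "'a::euclidean_space \<Rightarrow> 'a"
  assumes U: "open U" "a \<in> U" and sm: "smooth_on UNIV U F" and da: "(F has_derivative (\<lambda>v. v)) (at a)"
  obtains U' T \<phi> where "open U'" "U' \<subseteq> U" "a \<in> U'" "open T" "homeomorphism U' T F \<phi>"
    "smooth_on UNIV T \<phi>"
proof -
  define D where "D = (\<lambda>x. frechet_derivative F (at x))"
  have FD: "(F has_derivative D x) (at x)" if "x \<in> U" for x
    using smooth_on_imp_has_derivative[OF sm that] by (simp add: D_def)
  have Dsm: "smooth_on UNIV U (\<lambda>x. D x v)" for v
    using smooth_on_frechet_derivative[OF sm, of v] by (simp add: D_def)
  have Dbl: "bounded_linear (D x)" if "x \<in> U" for x using has_derivative_bounded_linear[OF FD[OF that]] .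
  define f' where "f' = (\<lambda>x. Blinfun (D x))"
  have f'D: "blinfun_apply (f' x) = D x" if "x \<in> U" for x
    using Dbl[OF that] by (simp add: f'_def bounded_linear_Blinfun_apply)
  have "continuous_on U (\<lambda>x. blinfun_apply (f' x) i)" for i
    using smooth_on_imp_continuous_on[OF Dsm[of i]] f'D by simp
  then have f'c: "continuous_on U f'" by (intro continuous_on_blinfun_componentwise)
  have Da: "D a = (\<lambda>v. v)" using has_derivative_unique[OF FD[OF U(2)] da] .
  have f'a: "f' a = id_blinfun" by (rule blinfun_eqI) (simp add: f'D[OF U(2)] Da)
  \<comment> \<open>The radius 1/2 keeps \<open>D x\<close> so close to the identity that its
    inverse has norm at most 2. This uniform bound is what makes \<open>g'\<close> continuous
    below.\<close>
  define U1 where "U1 = U \<inter> f' -` ball id_blinfun (1/2)"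
  have U1: "open U1" "a \<in> U1" "U1 \<subseteq> U"
    using continuous_open_preimage[OF f'c U(1)] U(2) f'a by (auto simp: U1_def)
  have inv1: "id_blinfun o\<^sub>L f' a = id_blinfun" by (rule blinfun_eqI) (simp add: f'a)
  have FD1: "(F has_derivative blinfun_apply (f' x)) (at x)" if "x \<in> U1" for x
    using FD f'D U1 that by auto
  obtain U' T \<phi> g' where U': "open U'" "U' \<subseteq> U1" "a \<in> U'" "open T" "F a \<in> T"
    and hom: "homeomorphism U' T F \<phi>"
    and g1: "\<And>y. y \<in> T \<Longrightarrow> (\<phi> has_derivative (g' y)) (at y)"
    and g2: "\<And>y. y \<in> T \<Longrightarrow> g' y = inv_into UNIV (blinfun_apply (f' (\<phi> y)))"
    and g3: "\<And>y. y \<in> T \<Longrightarrow> bij (blinfun_apply (f' (\<phi> y)))"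
    by (rule inverse_function_theorem[OF U1(1) FD1 continuous_on_subset[OF f'c U1(3)] U1(2) inv1], assumption, rule that)
  have \<phi>T: "\<phi> y \<in> U'" "\<phi> y \<in> U" "\<phi> y \<in> U1" if "y \<in> T" for y
    using hom that U' U1 unfolding homeomorphism_def by auto
  have Dg: "D (\<phi> y) (g' y v) = v" and gD: "g' y (D (\<phi> y) v) = v" if "y \<in> T" for y v
    using g2[OF that] g3[OF that] f'D[OF \<phi>T(2)[OF that]]
    by (simp_all add: surj_f_inv_f bij_is_surj bij_is_inj)
  have glin: "linear (g' y)" if "y \<in> T" for y using has_derivative_linear[OF g1[OF that]] .
  have gb: "norm (g' y v) \<le> 2 * norm v" if "y \<in> T" for y v
  proof -
    have "norm (f' (\<phi> y) - id_blinfun) \<le> 1/2"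
      using \<phi>T(3)[OF that] by (auto simp: U1_def dist_norm norm_minus_commute)
    then have "norm ((f' (\<phi> y) - id_blinfun) (g' y v)) \<le> 1/2 * norm (g' y v)"
      by (meson norm_blinfun order_trans mult_right_mono norm_ge_zero)
    then have "norm (v - g' y v) \<le> 1/2 * norm (g' y v)"
      using Dg[OF that, of v] f'D[OF \<phi>T(2)[OF that]] by (simp add: blinfun.diff_left)
    then show ?thesis using norm_triangle_ineq2[of "g' y v" v] by (simp add: norm_minus_commute)
  qed
  have expand: "L w = (\<Sum>b\<in>Basis. (w \<bullet> b) *\<^sub>R L b)" if "linear L" for L :: "'a \<Rightarrow> 'a" and w
    using projection_expansion[OF bounded_linear_ident, of UNIV L w] that by simp
  \<comment> \<open>The identity \<open>A\<inverse> - B\<inverse> = - A\<inverse> (A - B)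
    B\<inverse>\<close> for the derivatives of \<open>F\<close> at \<open>\<phi> y\<close> and
    \<open>\<phi> y0\<close>.\<close>
  have diff: "g' y v - g' y0 v = - g' y (D (\<phi> y) (g' y0 v) - v)" if "y \<in> T" "y0 \<in> T" for y y0 v
    using gD[OF that(1), of "g' y0 v"] linear_diff[OF glin[OF that(1)]] by simp
  have \<phi>c: "continuous_on T \<phi>" using hom unfolding homeomorphism_def by auto
  have gcont: "isCont (\<lambda>y. g' y v) y0" if y0: "y0 \<in> T" for y0 v
  proof -
    have "continuous_on T (\<lambda>y. D (\<phi> y) (g' y0 v))"
      by (rule continuous_on_compose2[OF smooth_on_imp_continuous_on[OF Dsm] \<phi>c]) (use \<phi>T in auto)
    then have "((\<lambda>y. D (\<phi> y) (g' y0 v)) \<longlongrightarrow> D (\<phi> y0) (g' y0 v)) (at y0)"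
      using y0 U'(4) by (auto simp: continuous_on_eq_continuous_at isCont_def)
    then have "((\<lambda>y. 2 * norm (D (\<phi> y) (g' y0 v) - v)) \<longlongrightarrow> 2 * 0) (at y0)"
      unfolding Dg[OF y0] by (intro tendsto_mult_left) (simp add: LIM_zero tendsto_norm_zero)
    then have lim: "((\<lambda>y. 2 * norm (D (\<phi> y) (g' y0 v) - v)) \<longlongrightarrow> 0) (at y0)" by simp
    have "\<forall>\<^sub>F y in at y0. y \<in> T" using y0 U'(4) by (simp add: eventually_at_in_open')
    then have "\<forall>\<^sub>F y in at y0. norm (g' y v - g' y0 v) \<le> 2 * norm (D (\<phi> y) (g' y0 v) - v)"
      by eventually_elim (use diff[OF _ y0] gb in auto)
    from Lim_null_comparison[OF this lim] show ?thesis
      unfolding isCont_def by (rule LIM_zero_cancel)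
  qed
  define E where "E = (\<lambda>c x. frechet_derivative (\<lambda>x. D x c) (at x))"
  have DE: "((\<lambda>x. D x c) has_derivative E c x) (at x)" if "x \<in> U" for c x
    using smooth_on_imp_has_derivative[OF Dsm that] by (simp add: E_def)
  have Esm: "smooth_on UNIV U (\<lambda>x. E c x u)" for c u
    using smooth_on_frechet_derivative[OF Dsm, of u c] by (simp add: E_def)
  \<comment> \<open>The derivative of operator inversion, written in a basis: the second derivative
    of \<open>F\<close> at \<open>\<phi> y\<close> is applied to \<open>g' y u\<close> and
    \<open>g' y v\<close>, and then \<open>- g' y\<close> is applied to the result.\<close>
  define H where "H = (\<lambda>y v u. - (\<Sum>b\<in>Basis. ((\<Sum>c\<in>Basis. (g' y v \<bullet> c) *\<^sub>R
    (\<Sum>d\<in>Basis. (g' y u \<bullet> d) *\<^sub>R E c (\<phi> y) d)) \<bullet> b) *\<^sub>R g' y b))"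
  have gder: "((\<lambda>y. g' y v) has_derivative H y0 v) (at y0)" if y0: "y0 \<in> T" for y0 v
  proof -
    \<comment> \<open>\<open>G y\<close> is \<open>D (\<phi> y)\<close> at the fixed vector
      \<open>g' y0 v\<close> and equals \<open>v\<close> at \<open>y0\<close>. The coefficients of
      \<open>G y - v\<close> therefore vanish at \<open>y0\<close>, and the accompanying factors
      \<open>g' y b\<close> need only be continuous.\<close>
    define G where "G = (\<lambda>y. \<Sum>c\<in>Basis. (g' y0 v \<bullet> c) *\<^sub>R D (\<phi> y) c)"
    have GD: "G y = D (\<phi> y) (g' y0 v)" if "y \<in> T" for y
      unfolding G_def
      by (rule expand[OF bounded_linear.linear[OF Dbl[OF \<phi>T(2)[OF that]]], symmetric])
    have "((\<lambda>y. D (\<phi> y) c) has_derivative (\<lambda>u. E c (\<phi> y0) (g' y0 u))) (at y0)" for c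
      using diff_chain_at[OF g1[OF y0] DE[OF \<phi>T(2)[OF y0]]] by (simp add: o_def)
    moreover have "E c (\<phi> y0) (g' y0 u) = (\<Sum>d\<in>Basis. (g' y0 u \<bullet> d) *\<^sub>R E c (\<phi> y0) d)" for c u
      by (rule expand[OF has_derivative_linear[OF DE[OF \<phi>T(2)[OF y0]]]])
    ultimately have *: "((\<lambda>y. D (\<phi> y) c) has_derivative
        (\<lambda>u. (\<Sum>d\<in>Basis. (g' y0 u \<bullet> d) *\<^sub>R E c (\<phi> y0) d))) (at y0)" for c by simp
    have dG: "(G has_derivative (\<lambda>u. \<Sum>c\<in>Basis. (g' y0 v \<bullet> c) *\<^sub>R
       (\<Sum>d\<in>Basis. (g' y0 u \<bullet> d) *\<^sub>R E c (\<phi> y0) d))) (at y0)"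
      unfolding G_def by (intro has_derivative_sum has_derivative_scaleR_right *)
    have dGb: "((\<lambda>y. (G y - v) \<bullet> b) has_derivative (\<lambda>u. (\<Sum>c\<in>Basis. (g' y0 v \<bullet> c) *\<^sub>R
       (\<Sum>d\<in>Basis. (g' y0 u \<bullet> d) *\<^sub>R E c (\<phi> y0) d)) \<bullet> b)) (at y0)" for b
      using has_derivative_inner_left[OF has_derivative_diff[OF dG has_derivative_const]] by simp
    have Gv: "G y0 = v" using GD Dg y0 by simp
    have "((\<lambda>y. g' y0 v - (\<Sum>b\<in>Basis. ((G y - v) \<bullet> b) *\<^sub>R g' y b)) has_derivative (\<lambda>u. 0 - (\<Sum>b\<in>Basis. ((\<Sum>c\<in>Basis. (g' y0 v \<bullet> c) *\<^sub>R
       (\<Sum>d\<in>Basis. (g' y0 u \<bullet> d) *\<^sub>R E c (\<phi> y0) d)) \<bullet> b) *\<^sub>R g' y0 b))) (at y0)"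
      by (intro has_derivative_diff has_derivative_const has_derivative_sum
          has_derivative_scaleR_vanishing dGb gcont y0) (simp add: Gv)
    then have main: "((\<lambda>y. g' y0 v - (\<Sum>b\<in>Basis. ((G y - v) \<bullet> b) *\<^sub>R g' y b)) has_derivative H y0 v) (at y0)"
      unfolding H_def by simp
    have eq: "g' y0 v - (\<Sum>b\<in>Basis. ((G y - v) \<bullet> b) *\<^sub>R g' y b) = g' y v" if y: "y \<in> T" for y
      using diff[OF y y0, of v] GD[OF y] expand[OF glin[OF y], of "G y - v"] by (simp add: algebra_simps)
    show ?thesis
      by (rule has_derivative_transform_within_open[OF main U'(4) y0 eq])
  qed
  have roT: "relopen UNIV T" and roU: "relopen UNIV U" using U'(4) U(1) by (simp_all add: relopen_UNIV)
  \<comment> \<open>\<open>\<phi>\<close> and all \<open>g'\<close> are treated together, since the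
    formula \<open>H\<close> for the derivative of \<open>g'\<close> contains both.\<close>
  have Ck: "Ck_on k UNIV T \<phi> \<and> (\<forall>v. Ck_on k UNIV T (\<lambda>y. g' y v))" for k
  proof (induction k)
    case 0
    have "continuous_on T (\<lambda>y. g' y v)" for v
      by (rule continuous_at_imp_continuous_on) (simp add: gcont)
    then show ?case using \<phi>c by simp
  next
    case (Suc k)
    then have IH: "Ck_on k UNIV T \<phi>" "\<And>v. Ck_on k UNIV T (\<lambda>y. g' y v)" by auto
    have "Ck_on k UNIV T (\<lambda>y. E c (\<phi> y) d)" for c d
      by (rule Ck_on_compose[OF roT roU _ IH(1) smooth_onD[OF Esm]]) (use \<phi>T in auto)
    moreover have inner: "Ck_on k UNIV T (\<lambda>y. h y \<bullet> b)" if "Ck_on k UNIV T h" for h :: "'a \<Rightarrow> 'a" and b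
      by (rule Ck_on_bounded_linear_comp[OF roT bounded_linear_inner_left that])
    ultimately have "Ck_on k UNIV T (\<lambda>y. H y v u)" for v u
      unfolding H_def
      by (intro Ck_on_bounded_linear_comp[OF roT bounded_linear_minus[OF bounded_linear_ident]]
         Ck_on_sum[OF roT] Ck_on_scaleR[OF roT] inner IH)
    then have "Ck_on (Suc k) UNIV T (\<lambda>y. g' y v)" for v
      by (intro Ck_on_SucI[OF roT gder])
    moreover have "Ck_on (Suc k) UNIV T \<phi>" by (rule Ck_on_SucI[OF roT g1 IH(2)])
    ultimately show ?case by blast
  qed
  show thesis
    by (rule that[OF U'(1) _ U'(3,4) hom]) (use U' U1 Ck in \<open>simp_all add: smooth_on_def subset_trans\<close>)
qed

lemma smooth_on_compose:
  fixes f :: "'a::real_normed_vector \<Rightarrow> 'b::euclidean_space"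
  assumes "relopen V S" "relopen W T" "f ` S \<subseteq> T" "smooth_on V S f" "smooth_on W T g"
  shows "smooth_on V S (\<lambda>x. g (f x))"
  unfolding smooth_on_def
  using Ck_on_compose[OF assms(1-3) smooth_onD[OF assms(4)] smooth_onD[OF assms(5)]] by blast

lemma smooth_on_add:
  "relopen V S \<Longrightarrow> smooth_on V S f \<Longrightarrow> smooth_on V S g \<Longrightarrow> smooth_on V S (\<lambda>x. f x + g x)"
  by (simp add: smooth_on_def Ck_on_add)

lemma smooth_on_bounded_linear_comp:
  "relopen V S \<Longrightarrow> bounded_linear L \<Longrightarrow> smooth_on V S f \<Longrightarrow> smooth_on V S (\<lambda>x. L (f x))"
  by (simp add: smooth_on_def Ck_on_bounded_linear_comp)

lemma smooth_on_scaleR: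
  "relopen V S \<Longrightarrow> smooth_on V S f \<Longrightarrow> smooth_on V S g \<Longrightarrow> smooth_on V S (\<lambda>x. f x *\<^sub>R g x)"
  by (simp add: smooth_on_def Ck_on_scaleR)

lemma smooth_on_sum:
  "relopen V S \<Longrightarrow> (\<And>i. i \<in> I \<Longrightarrow> smooth_on V S (f i)) \<Longrightarrow> smooth_on V S (\<lambda>x. \<Sum>i\<in>I. f i x)"
  by (simp add: smooth_on_def Ck_on_sum)

lemma smooth_on_const: "relopen V S \<Longrightarrow> smooth_on V S (\<lambda>x. c)"
  by (simp add: smooth_on_def Ck_on_const)

lemma smooth_on_ident: "relopen V S \<Longrightarrow> smooth_on V S (\<lambda>x. x)"
  by (simp add: smooth_on_def Ck_on_id)

lemma smooth_on_Pair:
  "relopen V S \<Longrightarrow> smooth_on V S f \<Longrightarrow> smooth_on V S g \<Longrightarrow> smooth_on V S (\<lambda>x. (f x, g x))"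
  by (simp add: smooth_on_def Ck_on_Pair)

lemma smooth_on_diff:
  assumes "relopen V S" "smooth_on V S f" "smooth_on V S g"
  shows "smooth_on V S (\<lambda>x. f x - g x)"
  using smooth_on_add[OF assms(1,2) smooth_on_bounded_linear_comp[OF assms(1) bounded_linear_minus[OF bounded_linear_ident] assms(3)]]
  by simp

lemma smooth_on_bounded_linear: "relopen V S \<Longrightarrow> bounded_linear L \<Longrightarrow> smooth_on V S L"
  using smooth_on_bounded_linear_comp[OF _ _ smooth_on_ident] by blast

lemma smooth_on_subset: "smooth_on V S f \<Longrightarrow> T \<subseteq> S \<Longrightarrow> smooth_on V T f"
  unfolding smooth_on_def using Ck_on_mono by blast

lemma smooth_on_cong:
  "relopen V S \<Longrightarrow> (\<And>x. x \<in> S \<Longrightarrow> f x = g x) \<Longrightarrow> smooth_on V S f \<Longrightarrow> smooth_on V S g"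
  unfolding smooth_on_def using Ck_on_cong by blast

lemma smooth_on_local:
  assumes "relopen V S" "\<And>x. x \<in> S \<Longrightarrow> \<exists>T. relopen V T \<and> x \<in> T \<and> smooth_on V T f"
  shows "smooth_on V S f"
  unfolding smooth_on_def
proof
  fix k show "Ck_on k V S f"
    by (rule Ck_on_local[OF assms(1)]) (use assms(2) in \<open>unfold smooth_on_def, blast\<close>)
qed

lemma relopen_Int_open: "relopen V S \<Longrightarrow> open T \<Longrightarrow> relopen V (S \<inter> T)"
  by (simp add: relopen_def openin_Int_open)

lemma relopen_vimage:
  assumes "relopen V S" "relopen W T" "continuous_on S f" "f ` S \<subseteq> W"
  shows "relopen V (S \<inter> f -` T)"
proof -
  have "openin (top_of_set S) (S \<inter> f -` T)"
    using continuous_openin_preimage[OF assms(3) _ relopenD(2)[OF assms(2)]] assms(4) by blast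
  then show ?thesis using assms(1) openin_trans unfolding relopen_def by blast
qed

text \<open>The derivative is normalised to the identity on \<open>V\<close> because the maps to be
  inverted have the form of the identity plus a term with vanishing derivative. The point to be
  checked is that the inverse of the ambient extension maps \<open>V\<close> to
  \<open>V\<close>.\<close>

lemma smooth_local_inverse:
  fixes F :: "'a::euclidean_space \<Rightarrow> 'a"
  assumes S: "relopen V S" "a \<in> S" and sm: "smooth_on V S F" and FV: "F ` S \<subseteq> V"
    and D: "(F has_derivative D) (at a within V)" "\<And>v. v \<in> V \<Longrightarrow> D v = v"
  obtains S' T \<phi> where "relopen V S'" "S' \<subseteq> S" "a \<in> S'" "relopen V T" "homeomorphism S' T F \<phi>"
    "smooth_on V T \<phi>"
proof -
  note V = relopenD(1)[OF S(1)]
  have SV: "S \<subseteq> V" using relopenD(3)[OF S(1)] by blast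
  obtain P where P: "bounded_linear P" "range P \<subseteq> V" "\<And>v. v \<in> V \<Longrightarrow> P v = v"
    using subspace_projection_exists[OF V] by metis
  define U where "U = UNIV \<inter> P -` S"
  have roU: "relopen UNIV U" unfolding U_def
    by (rule relopen_vimage[OF _ S(1)])
      (use P bounded_linear.continuous_on[OF P(1) continuous_on_id] in \<open>simp_all add: relopen_UNIV\<close>)
  have aU: "a \<in> U" using S SV P(3) by (auto simp: U_def)
  have PU: "P ` U \<subseteq> S" by (auto simp: U_def)
  \<comment> \<open>extends \<open>F\<close> by the identity transversally to \<open>V\<close>, to apply the inverse function theorem of the whole space\<close>
  define E where "E = (\<lambda>z. F (P z) + (z - P z))"
  have smP: "smooth_on UNIV U P" by (rule smooth_on_bounded_linear[OF roU P(1)])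
  have smE: "smooth_on UNIV U E"
    unfolding E_def
    by (intro smooth_on_add[OF roU] smooth_on_diff[OF roU] smooth_on_ident[OF roU] smP
        smooth_on_compose[OF roU S(1) PU smP sm])
  have Pa: "P a = a" using P(3) SV S(2) by blast
  have "(P has_derivative P) (at a within UNIV)" by (rule bounded_linear.has_derivative[OF P(1) has_derivative_ident])
  from has_derivative_chain_subspace[OF roU S(1) aU PU this, of F D] D(1)
  have "((\<lambda>z. F (P z)) has_derivative (\<lambda>v. D (P v))) (at a)" by (simp add: Pa)
  then have "(E has_derivative (\<lambda>v. D (P v) + (v - P v))) (at a)" unfolding E_def
    by (intro has_derivative_add has_derivative_diff has_derivative_ident bounded_linear.has_derivative[OF P(1)])
  moreover have "D (P v) + (v - P v) = v" for v using D(2)[of "P v"] P(2) by auto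
  ultimately have dE: "(E has_derivative (\<lambda>v. v)) (at a)" by simp
  have oU: "open U" using roU by (simp add: relopen_UNIV)
  obtain U' T' \<phi> where U': "open U'" "U' \<subseteq> U" "a \<in> U'" "open T'" and hom: "homeomorphism U' T' E \<phi>"
    and \<phi>: "smooth_on UNIV T' \<phi>"
    by (rule smooth_local_inverse_UNIV[OF oU aU smE dE])
  have EF: "E z = F z" if "z \<in> V" for z using P(3)[OF that] by (simp add: E_def)
  have hom': "\<And>x. x \<in> U' \<Longrightarrow> \<phi> (E x) = x" "E ` U' = T'" "\<And>y. y \<in> T' \<Longrightarrow> E (\<phi> y) = y" "\<phi> ` T' = U'"
    "continuous_on U' E" "continuous_on T' \<phi>"
    using hom unfolding homeomorphism_def by blast+
  \<comment> \<open>Solving \<open>E (\<phi> y) = y\<close> for \<open>\<phi> y\<close> expresses it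
    by \<open>y\<close>, a value of \<open>F\<close> and a value of \<open>P\<close>, all of which
    lie in \<open>V\<close>.\<close>
  have \<phi>V: "\<phi> y \<in> V" if y: "y \<in> T' \<inter> V" for y
  proof -
    have "\<phi> y \<in> U" using y hom'(4) U'(2) by blast
    then have "F (P (\<phi> y)) \<in> V" using FV PU by blast
    moreover have "y - F (P (\<phi> y)) + P (\<phi> y) = \<phi> y" using hom'(3)[of y] y by (simp add: E_def algebra_simps)
    ultimately show ?thesis using y V P(2) by (metis IntD2 range_subsetD subspace_add subspace_diff)
  qed
  have S'S: "V \<inter> U' \<subseteq> S" using U'(2) P(3) PU by fastforce
  have roV: "relopen V V" using V by (simp add: relopen_def)
  have roT: "relopen V (V \<inter> T')" by (rule relopen_Int_open[OF roV U'(4)])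
  have FV': "F ` (V \<inter> U') \<subseteq> V \<inter> T'"
  proof
    fix y assume "y \<in> F ` (V \<inter> U')"
    then obtain x where x: "x \<in> V" "x \<in> U'" "y = F x" by blast
    then have "E x \<in> T'" using hom'(2) by blast
    then show "y \<in> V \<inter> T'" using x EF S'S FV by auto
  qed
  show thesis
  proof (rule that[OF relopen_Int_open[OF roV U'(1)] S'S _ roT])
    show "a \<in> V \<inter> U'" using U'(3) SV S(2) by blast
    show "homeomorphism (V \<inter> U') (V \<inter> T') F \<phi>"
    proof (rule homeomorphismI)
      show "continuous_on (V \<inter> U') F"
        using continuous_on_subset[OF smooth_on_imp_continuous_on[OF sm] S'S] .
      show "continuous_on (V \<inter> T') \<phi>" using continuous_on_subset[OF hom'(6)] by blast
      show "F ` (V \<inter> U') \<subseteq> V \<inter> T'" by (rule FV')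
      show "\<phi> ` (V \<inter> T') \<subseteq> V \<inter> U'" using \<phi>V hom'(4) by blast
      show "\<phi> (F x) = x" if "x \<in> V \<inter> U'" for x using that hom'(1)[of x] EF by auto
      show "F (\<phi> y) = y" if "y \<in> V \<inter> T'" for y using that hom'(3)[of y] EF[OF \<phi>V] by auto
    qed
    show "smooth_on V (V \<inter> T') \<phi>"
      by (rule smooth_on_compose[OF roT _ _ smooth_on_ident[OF roT] \<phi>])
        (use U'(4) in \<open>auto simp: relopen_UNIV\<close>)
  qed
qed

section \<open>Smooth maps between manifolds\<close>

text \<open>Both charts are free parameters, unlike in \<open>tangent_map\<close>, so that
  compositions can be differentiated in charts that stay fixed while the point moves.\<close>

definition local_rep :: "('a, 'e) chart \<Rightarrow> ('b, 'f) chart \<Rightarrow> ('a \<Rightarrow> 'b) \<Rightarrow> 'e \<Rightarrow> 'f"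
  where "local_rep c d F = (\<lambda>y. chart_map d (F (chart_inv c y)))"

lemma smooth_manifold_subspace: "smooth_manifold X \<Longrightarrow> subspace (model X)"
  by (simp add: smooth_manifold_def)

lemma smooth_manifold_is_chart: "smooth_manifold X \<Longrightarrow> c \<in> atlas X \<Longrightarrow> is_chart (model X) c"
  by (simp add: smooth_manifold_def)

lemma chart_at:
  assumes "smooth_manifold X"
  shows "chart_at X x \<in> atlas X" "x \<in> chart_dom (chart_at X x)"
proof -
  have "\<exists>c. c \<in> atlas X \<and> x \<in> chart_dom c" using assms unfolding smooth_manifold_def by blast
  from someI_ex[OF this] show "chart_at X x \<in> atlas X" "x \<in> chart_dom (chart_at X x)"
    by (simp_all add: chart_at_def)
qed

lemma is_chartD:
  assumes "is_chart V c"
  shows "open (chart_dom c)" "openin (top_of_set V) (chart_img c)"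
    "homeomorphism (chart_dom c) (chart_img c) (chart_map c) (chart_inv c)"
    "\<And>x. x \<in> chart_dom c \<Longrightarrow> chart_inv c (chart_map c x) = x"
    "\<And>x. x \<in> chart_dom c \<Longrightarrow> chart_map c x \<in> chart_img c"
    "\<And>y. y \<in> chart_img c \<Longrightarrow> chart_map c (chart_inv c y) = y"
    "\<And>y. y \<in> chart_img c \<Longrightarrow> chart_inv c y \<in> chart_dom c"
    "continuous_on (chart_dom c) (chart_map c)" "continuous_on (chart_img c) (chart_inv c)"
proof -
  show "open (chart_dom c)" "openin (top_of_set V) (chart_img c)" and
    hom: "homeomorphism (chart_dom c) (chart_img c) (chart_map c) (chart_inv c)"
    using assms by (auto simp: is_chart_def)
  show "\<And>x. x \<in> chart_dom c \<Longrightarrow> chart_inv c (chart_map c x) = x"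
    "\<And>x. x \<in> chart_dom c \<Longrightarrow> chart_map c x \<in> chart_img c"
    "\<And>y. y \<in> chart_img c \<Longrightarrow> chart_map c (chart_inv c y) = y"
    "\<And>y. y \<in> chart_img c \<Longrightarrow> chart_inv c y \<in> chart_dom c"
    "continuous_on (chart_dom c) (chart_map c)" "continuous_on (chart_img c) (chart_inv c)"
    using hom unfolding homeomorphism_def by blast+
qed

lemma relopen_chart_img:
  assumes "subspace V" "is_chart V c" shows "relopen V (chart_img c)"
  using assms is_chartD(2) by (simp add: relopen_def)

lemma chart_image_eq:
  assumes "is_chart V c"
  shows "chart_map c ` (chart_dom c \<inter> U) = chart_img c \<inter> chart_inv c -` U"
  using is_chartD(4-7)[OF assms] by (auto simp: image_iff) (metis IntI)

lemma relopen_chart_image: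
  assumes V: "subspace V" "is_chart V c" and "open U"
  shows "relopen V (chart_map c ` (chart_dom c \<inter> U))"
proof -
  have "openin (top_of_set (chart_img c)) (chart_img c \<inter> chart_inv c -` U)"
    by (rule continuous_openin_preimage_gen[OF is_chartD(9)[OF V(2)] \<open>open U\<close>])
  then show ?thesis
    unfolding chart_image_eq[OF V(2)] using V(1) is_chartD(2)[OF V(2)] openin_trans
    unfolding relopen_def by blast
qed

lemma open_chart_inv_image:
  assumes c: "is_chart V c" and S: "openin (top_of_set V) S" "S \<subseteq> chart_img c"
  shows "open (chart_inv c ` S)"
proof -
  have "openin (top_of_set (chart_img c)) S"
    using openin_subset_trans[OF S(1) S(2)] openin_imp_subset[OF is_chartD(2)[OF c]] by blast
  then have "openin (top_of_set (chart_dom c)) (chart_dom c \<inter> chart_map c -` S)"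
    using continuous_openin_preimage[OF is_chartD(8)[OF c], of "chart_img c" S] is_chartD(5)[OF c] by blast
  moreover have "chart_dom c \<inter> chart_map c -` S = chart_inv c ` S"
    using is_chartD(4-7)[OF c] S(2) by (force simp: image_iff)
  ultimately show ?thesis using is_chartD(1)[OF c] openin_open_trans by metis
qed

lemma smooth_mapD:
  assumes "smooth_map X Y F"
  shows "continuous_on UNIV F"
    "c \<in> atlas X \<Longrightarrow> d \<in> atlas Y \<Longrightarrow>
     smooth_on (model X) (chart_map c ` (chart_dom c \<inter> F -` chart_dom d)) (local_rep c d F)"
  using assms by (auto simp: smooth_map_def local_rep_def o_def)

lemma smooth_mapI:
  assumes "continuous_on UNIV F"
    "\<And>c d. c \<in> atlas X \<Longrightarrow> d \<in> atlas Y \<Longrightarrow>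
     smooth_on (model X) (chart_map c ` (chart_dom c \<inter> F -` chart_dom d)) (local_rep c d F)"
  shows "smooth_map X Y F"
  using assms by (auto simp: smooth_map_def local_rep_def o_def)

lemma relopen_local_rep:
  assumes X: "smooth_manifold X" and Y: "smooth_manifold Y" and F: "continuous_on UNIV F"
    and c: "c \<in> atlas X" and d: "d \<in> atlas Y"
  shows "relopen (model X) (chart_map c ` (chart_dom c \<inter> F -` chart_dom d))"
  using relopen_chart_image[OF smooth_manifold_subspace[OF X] smooth_manifold_is_chart[OF X c]
      open_vimage[OF is_chartD(1)[OF smooth_manifold_is_chart[OF Y d]] F]] .

lemma local_rep_has_derivative:
  assumes X: "smooth_manifold X" and F: "smooth_map X Y F"
    and c: "c \<in> atlas X" "x \<in> chart_dom c" and d: "d \<in> atlas Y" "F x \<in> chart_dom d"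
  shows "(local_rep c d F has_derivative frechet_derivative (local_rep c d F) (at (chart_map c x) within model X))
    (at (chart_map c x) within model X)"
  by (rule smooth_on_imp_has_derivative[OF smooth_mapD(2)[OF F c(1) d(1)]]) (use c d in auto)

text \<open>Representatives compose only where \<open>F\<close> lands in the domain of
  \<open>d\<close>, which contains a neighbourhood of the point by continuity of \<open>F\<close>.
  With \<open>F\<close> the identity the lemma also governs a change of charts.\<close>

lemma local_rep_chain:
  assumes X: "smooth_manifold X" and Y: "smooth_manifold Y"
    and F: "continuous_on UNIV F"
    and c: "c \<in> atlas X" "x \<in> chart_dom c" and d: "d \<in> atlas Y" "F x \<in> chart_dom d"
    and D: "(local_rep c d F has_derivative D) (at (chart_map c x) within model X)"
    and E: "(local_rep d e K has_derivative E) (at (chart_map d (F x)) within model Y)"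
  shows "(local_rep c e (\<lambda>x. K (F x)) has_derivative (\<lambda>v. E (D v))) (at (chart_map c x) within model X)"
proof -
  define S where "S = chart_map c ` (chart_dom c \<inter> F -` chart_dom d)"
  have S: "relopen (model X) S" unfolding S_def by (rule relopen_local_rep[OF X Y F c(1) d(1)])
  note cc = is_chartD[OF smooth_manifold_is_chart[OF X c(1)]]
  note dd = is_chartD[OF smooth_manifold_is_chart[OF Y d(1)]]
  have T: "relopen (model Y) (chart_img d)"
    using relopen_chart_img[OF smooth_manifold_subspace[OF Y] smooth_manifold_is_chart[OF Y d(1)]] .
  have xS: "chart_map c x \<in> S" using c d by (auto simp: S_def)
  have sub: "local_rep c d F ` S \<subseteq> chart_img d"
    using cc(4) dd(5) by (auto simp: S_def local_rep_def)
  have rx: "local_rep c d F (chart_map c x) = chart_map d (F x)" using cc(4) c by (simp add: local_rep_def)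
  have "((\<lambda>y. local_rep d e K (local_rep c d F y)) has_derivative (\<lambda>v. E (D v))) (at (chart_map c x) within model X)"
    by (rule has_derivative_chain_subspace[OF S T xS sub D]) (simp add: rx E)
  moreover have "local_rep d e K (local_rep c d F y) = local_rep c e (\<lambda>x. K (F x)) y" if "y \<in> S" for y
    using that cc(4) dd(4) by (auto simp: S_def local_rep_def)
  ultimately show ?thesis by (rule has_derivative_cong_relopen[OF S xS, rotated])
qed

lemma smooth_map_compose:
  assumes X: "smooth_manifold X" and Y: "smooth_manifold Y" and Z: "smooth_manifold Z"
    and F: "smooth_map X Y F" and K: "smooth_map Y Z K"
  shows "smooth_map X Z (\<lambda>x. K (F x))"
proof (rule smooth_mapI)
  note Fc = smooth_mapD(1)[OF F] and Kc = smooth_mapD(1)[OF K]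
  show KFc: "continuous_on UNIV (\<lambda>x. K (F x))" by (rule continuous_on_compose2[OF Kc Fc]) simp
  fix c e assume c: "c \<in> atlas X" and e: "e \<in> atlas Z"
  note cc = is_chartD[OF smooth_manifold_is_chart[OF X c]]
  show "smooth_on (model X) (chart_map c ` (chart_dom c \<inter> (\<lambda>x. K (F x)) -` chart_dom e)) (local_rep c e (\<lambda>x. K (F x)))"
    (is "smooth_on _ ?S _")
  proof (rule smooth_on_local[OF relopen_local_rep[OF X Z KFc c e]])
    fix y assume "y \<in> ?S"
    then obtain x where x: "x \<in> chart_dom c" "K (F x) \<in> chart_dom e" "y = chart_map c x" by auto
    define d where "d = chart_at Y (F x)"
    have d: "d \<in> atlas Y" "F x \<in> chart_dom d" using chart_at[OF Y] by (simp_all add: d_def)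
    note dd = is_chartD[OF smooth_manifold_is_chart[OF Y d(1)]]
    \<comment> \<open>Points of the middle chart that \<open>K\<close> sends into \<open>e\<close>.
      Where \<open>F\<close> lands in this set, the representative of the composition is the
      composition of the representatives.\<close>
    define O' where "O' = chart_dom d \<inter> K -` chart_dom e"
    have O': "open O'" unfolding O'_def
      by (intro open_Int dd(1) open_vimage Kc is_chartD(1)[OF smooth_manifold_is_chart[OF Z e]])
    define T where "T = chart_map c ` (chart_dom c \<inter> F -` O')"
    have roT: "relopen (model X) T" unfolding T_def
      by (rule relopen_chart_image[OF smooth_manifold_subspace[OF X] smooth_manifold_is_chart[OF X c] open_vimage[OF O' Fc]])
    have sF: "smooth_on (model X) T (local_rep c d F)"
      by (rule smooth_on_subset[OF smooth_mapD(2)[OF F c d(1)]]) (auto simp: T_def O'_def)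
    have "smooth_on (model X) T (\<lambda>y. local_rep d e K (local_rep c d F y))"
    proof (rule smooth_on_compose[OF roT relopen_local_rep[OF Y Z Kc d(1) e] _ sF smooth_mapD(2)[OF K d(1) e]])
      show "local_rep c d F ` T \<subseteq> chart_map d ` (chart_dom d \<inter> K -` chart_dom e)"
        using cc(4) by (auto simp: T_def O'_def local_rep_def)
    qed
    moreover have "local_rep d e K (local_rep c d F y) = local_rep c e (\<lambda>x. K (F x)) y" if "y \<in> T" for y
      using that cc(4) dd(4) by (auto simp: T_def O'_def local_rep_def)
    ultimately have "smooth_on (model X) T (local_rep c e (\<lambda>x. K (F x)))"
      by (rule smooth_on_cong[OF roT, rotated])
    moreover have "y \<in> T" using x d by (auto simp: T_def O'_def)
    ultimately show "\<exists>T. relopen (model X) T \<and> y \<in> T \<and> smooth_on (model X) T (local_rep c e (\<lambda>x. K (F x)))"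
      using roT by blast
  qed
qed

lemma smooth_map_ident: "smooth_manifold X \<Longrightarrow> smooth_map X X (\<lambda>x. x)"
  by (rule smooth_mapI) (simp_all add: smooth_manifold_def local_rep_def o_def vimage_def)

lemma smooth_map_const:
  assumes X: "smooth_manifold X" and Y: "smooth_manifold Y"
  shows "smooth_map X Y (\<lambda>x. p)"
proof (rule smooth_mapI)
  show c: "continuous_on UNIV (\<lambda>x. p)" by simp
  fix c d assume "c \<in> atlas X" "d \<in> atlas Y"
  then show "smooth_on (model X) (chart_map c ` (chart_dom c \<inter> (\<lambda>x. p) -` chart_dom d)) (local_rep c d (\<lambda>x. p))"
    unfolding local_rep_def by (intro smooth_on_const relopen_local_rep[OF X Y c])
qed

section \<open>Products of manifolds\<close>

abbreviation prod_chart :: "('a, 'e) chart \<Rightarrow> ('b, 'f) chart \<Rightarrow> ('a \<times> 'b, 'e \<times> 'f) chart"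
  where "prod_chart c d \<equiv> (chart_dom c \<times> chart_dom d, map_prod (chart_map c) (chart_map d))"

lemma chart_img_prod: "chart_img (prod_chart c d) = chart_img c \<times> chart_img d"
  by (auto simp: chart_img_def)

lemma chart_inv_prod:
  assumes "is_chart V c" "is_chart W d" "y \<in> chart_img c" "z \<in> chart_img d"
  shows "chart_inv (prod_chart c d) (y, z) = (chart_inv c y, chart_inv d z)"
proof -
  note cc = is_chartD(4-7)[OF assms(1)] and dd = is_chartD(4-7)[OF assms(2)]
  have "inj_on (map_prod (chart_map c) (chart_map d)) (chart_dom c \<times> chart_dom d)"
    by (intro map_prod_inj_on inj_on_inverseI[of _ "chart_inv c"] inj_on_inverseI[of _ "chart_inv d"] cc(1) dd(1))
  then show ?thesis unfolding chart_inv_def[of "prod_chart c d"] fst_conv snd_conv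
    by (rule inv_into_f_eq) (use cc dd assms in auto)
qed

lemma is_chart_prod:
  assumes c: "is_chart V c" and d: "is_chart W d"
  shows "is_chart (V \<times> W) (prod_chart c d)"
  unfolding is_chart_def
proof (intro conjI)
  note cc = is_chartD[OF c] and dd = is_chartD[OF d]
  show "open (chart_dom (prod_chart c d))" using cc(1) dd(1) by (simp add: open_Times)
  show "openin (top_of_set (V \<times> W)) (chart_img (prod_chart c d))"
    unfolding chart_img_prod by (rule openin_Times[OF cc(2) dd(2)])
  show "homeomorphism (chart_dom (prod_chart c d)) (chart_img (prod_chart c d))
    (chart_map (prod_chart c d)) (chart_inv (prod_chart c d))"
    unfolding chart_img_prod fst_conv snd_conv
  proof (rule homeomorphismI)
    show "continuous_on (chart_dom c \<times> chart_dom d) (map_prod (chart_map c) (chart_map d))"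
      unfolding map_prod_def case_prod_unfold
      by (intro continuous_on_Pair continuous_on_compose2[OF cc(8)] continuous_on_compose2[OF dd(8)]
          continuous_on_fst continuous_on_snd continuous_on_id) auto
    have "continuous_on (chart_img c \<times> chart_img d) (\<lambda>p. (chart_inv c (fst p), chart_inv d (snd p)))"
      by (intro continuous_on_Pair continuous_on_compose2[OF cc(9)] continuous_on_compose2[OF dd(9)]
          continuous_on_fst continuous_on_snd continuous_on_id) auto
    then show "continuous_on (chart_img c \<times> chart_img d) (chart_inv (prod_chart c d))"
      by (rule continuous_on_eq) (auto simp: chart_inv_prod[OF c d])
    show "map_prod (chart_map c) (chart_map d) ` (chart_dom c \<times> chart_dom d) \<subseteq> chart_img c \<times> chart_img d"
      by (auto intro: cc(5) dd(5))
    show "chart_inv (prod_chart c d) ` (chart_img c \<times> chart_img d) \<subseteq> chart_dom c \<times> chart_dom d"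
      by (auto simp: chart_inv_prod[OF c d] intro: cc(7) dd(7))
    show "chart_inv (prod_chart c d) (map_prod (chart_map c) (chart_map d) p) = p" if "p \<in> chart_dom c \<times> chart_dom d" for p
      using that by (cases p) (simp add: chart_inv_prod[OF c d] cc(4,5) dd(4,5))
    show "map_prod (chart_map c) (chart_map d) (chart_inv (prod_chart c d) p) = p" if "p \<in> chart_img c \<times> chart_img d" for p
      using that by (cases p) (simp add: chart_inv_prod[OF c d] cc(6) dd(6))
  qed
qed

lemma atlas_prod: "atlas (prod_mfd X Y) = {prod_chart c d | c d. c \<in> atlas X \<and> d \<in> atlas Y}"
  and model_prod: "model (prod_mfd X Y) = model X \<times> model Y"
  by (simp_all add: prod_mfd_def)

lemma prod_chart_in_atlas: "c \<in> atlas X \<Longrightarrow> d \<in> atlas Y \<Longrightarrow> prod_chart c d \<in> atlas (prod_mfd X Y)"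
  unfolding atlas_prod by blast

lemma smooth_manifold_prod:
  assumes X: "smooth_manifold X" and Y: "smooth_manifold Y"
  shows "smooth_manifold (prod_mfd X Y)"
  unfolding smooth_manifold_def
proof (intro conjI ballI)
  show "subspace (model (prod_mfd X Y))"
    unfolding model_prod by (intro subspace_Times smooth_manifold_subspace X Y)
  show ch: "is_chart (model (prod_mfd X Y)) e" if "e \<in> atlas (prod_mfd X Y)" for e
    using that is_chart_prod[OF smooth_manifold_is_chart[OF X] smooth_manifold_is_chart[OF Y]]
    unfolding atlas_prod model_prod by blast
  have "p \<in> chart_dom (prod_chart (chart_at X (fst p)) (chart_at Y (snd p)))" for p
    using chart_at[OF X] chart_at[OF Y] by (cases p) auto
  then show "(\<Union>e\<in>atlas (prod_mfd X Y). chart_dom e) = UNIV"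
    using prod_chart_in_atlas[OF chart_at(1)[OF X] chart_at(1)[OF Y]] by blast
  fix e e' assume e: "e \<in> atlas (prod_mfd X Y)" and e': "e' \<in> atlas (prod_mfd X Y)"
  obtain c d where cd: "e = prod_chart c d" "c \<in> atlas X" "d \<in> atlas Y" using e by (auto simp: atlas_prod)
  obtain c' d' where cd': "e' = prod_chart c' d'" "c' \<in> atlas X" "d' \<in> atlas Y" using e' by (auto simp: atlas_prod)
  note ch_c = smooth_manifold_is_chart[OF X cd(2)] and ch_d = smooth_manifold_is_chart[OF Y cd(3)]
  note cc = is_chartD[OF ch_c] and dd = is_chartD[OF ch_d]
  define S where "S = chart_map c ` (chart_dom c \<inter> chart_dom c')"
  define T where "T = chart_map d ` (chart_dom d \<inter> chart_dom d')"
  have S: "relopen (model X) S" unfolding S_def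
    by (rule relopen_chart_image[OF smooth_manifold_subspace[OF X] ch_c is_chartD(1)[OF smooth_manifold_is_chart[OF X cd'(2)]]])
  have T: "relopen (model Y) T" unfolding T_def
    by (rule relopen_chart_image[OF smooth_manifold_subspace[OF Y] ch_d is_chartD(1)[OF smooth_manifold_is_chart[OF Y cd'(3)]]])
  have ST: "relopen (model X \<times> model Y) (S \<times> T)"
    using S T unfolding relopen_def by (simp add: subspace_Times openin_Times)
  have trS: "smooth_on (model X) S (chart_map c' \<circ> chart_inv c)"
    using X cd cd' by (simp add: smooth_manifold_def S_def)
  have trT: "smooth_on (model Y) T (chart_map d' \<circ> chart_inv d)"
    using Y cd cd' by (simp add: smooth_manifold_def T_def)
  have "smooth_on (model X \<times> model Y) (S \<times> T) (\<lambda>p. ((chart_map c' \<circ> chart_inv c) (fst p), (chart_map d' \<circ> chart_inv d) (snd p)))"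
    by (intro smooth_on_Pair[OF ST] smooth_on_compose[OF ST S _ _ trS] smooth_on_compose[OF ST T _ _ trT]
        smooth_on_bounded_linear[OF ST] bounded_linear_fst bounded_linear_snd) auto
  moreover have "((chart_map c' \<circ> chart_inv c) (fst p), (chart_map d' \<circ> chart_inv d) (snd p)) = (chart_map e' \<circ> chart_inv e) p"
    if "p \<in> S \<times> T" for p
    using that chart_inv_prod[OF ch_c ch_d] cc(5) dd(5) by (auto simp: cd cd' S_def T_def)
  ultimately have "smooth_on (model X \<times> model Y) (S \<times> T) (chart_map e' \<circ> chart_inv e)"
    by (rule smooth_on_cong[OF ST, rotated])
  moreover have "S \<times> T = chart_map e ` (chart_dom e \<inter> chart_dom e')"
    by (auto simp: S_def T_def cd cd' image_iff)
  ultimately show "smooth_on (model (prod_mfd X Y)) (chart_map e ` (chart_dom e \<inter> chart_dom e')) (chart_map e' \<circ> chart_inv e)"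
    by (simp add: model_prod)
qed

lemma smooth_map_fst:
  assumes X: "smooth_manifold X" and Y: "smooth_manifold Y"
  shows "smooth_map (prod_mfd X Y) X fst"
proof (rule smooth_mapI)
  note XY = smooth_manifold_prod[OF X Y]
  show cont: "continuous_on UNIV fst" by (intro continuous_on_fst continuous_on_id)
  fix e c' assume e: "e \<in> atlas (prod_mfd X Y)" and c': "c' \<in> atlas X"
  obtain c d where cd: "e = prod_chart c d" "c \<in> atlas X" "d \<in> atlas Y" using e by (auto simp: atlas_prod)
  note ch_c = smooth_manifold_is_chart[OF X cd(2)] and ch_d = smooth_manifold_is_chart[OF Y cd(3)]
  note cc = is_chartD[OF ch_c] and dd = is_chartD[OF ch_d]
  let ?S = "chart_map e ` (chart_dom e \<inter> fst -` chart_dom c')"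
  have S: "relopen (model X \<times> model Y) ?S" using relopen_local_rep[OF XY X cont e c'] by (simp add: model_prod)
  have tr: "smooth_on (model X) (chart_map c ` (chart_dom c \<inter> (\<lambda>x. x) -` chart_dom c')) (local_rep c c' (\<lambda>x. x))"
    by (rule smooth_mapD(2)[OF smooth_map_ident[OF X] cd(2) c'])
  have "smooth_on (model X \<times> model Y) ?S (\<lambda>p. local_rep c c' (\<lambda>x. x) (fst p))"
    by (rule smooth_on_compose[OF S relopen_local_rep[OF X X continuous_on_id cd(2) c'] _ smooth_on_bounded_linear[OF S bounded_linear_fst] tr])
      (auto simp: cd)
  then show "smooth_on (model (prod_mfd X Y)) ?S (local_rep e c' fst)"
    unfolding model_prod
    by (rule smooth_on_cong[OF S, rotated])
      (use chart_inv_prod[OF ch_c ch_d] cc(5) dd(5) in \<open>auto simp: cd local_rep_def\<close>)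
qed

lemma smooth_map_snd:
  assumes X: "smooth_manifold X" and Y: "smooth_manifold Y"
  shows "smooth_map (prod_mfd X Y) Y snd"
proof (rule smooth_mapI)
  note XY = smooth_manifold_prod[OF X Y]
  show cont: "continuous_on UNIV snd" by (intro continuous_on_snd continuous_on_id)
  fix e c' assume e: "e \<in> atlas (prod_mfd X Y)" and c': "c' \<in> atlas Y"
  obtain c d where cd: "e = prod_chart c d" "c \<in> atlas X" "d \<in> atlas Y" using e by (auto simp: atlas_prod)
  note ch_c = smooth_manifold_is_chart[OF X cd(2)] and ch_d = smooth_manifold_is_chart[OF Y cd(3)]
  note cc = is_chartD[OF ch_c] and dd = is_chartD[OF ch_d]
  let ?S = "chart_map e ` (chart_dom e \<inter> snd -` chart_dom c')"
  have S: "relopen (model X \<times> model Y) ?S" using relopen_local_rep[OF XY Y cont e c'] by (simp add: model_prod)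
  have tr: "smooth_on (model Y) (chart_map d ` (chart_dom d \<inter> (\<lambda>x. x) -` chart_dom c')) (local_rep d c' (\<lambda>x. x))"
    by (rule smooth_mapD(2)[OF smooth_map_ident[OF Y] cd(3) c'])
  have "smooth_on (model X \<times> model Y) ?S (\<lambda>p. local_rep d c' (\<lambda>x. x) (snd p))"
    by (rule smooth_on_compose[OF S relopen_local_rep[OF Y Y continuous_on_id cd(3) c'] _ smooth_on_bounded_linear[OF S bounded_linear_snd] tr])
      (auto simp: cd)
  then show "smooth_on (model (prod_mfd X Y)) ?S (local_rep e c' snd)"
    unfolding model_prod
    by (rule smooth_on_cong[OF S, rotated])
      (use chart_inv_prod[OF ch_c ch_d] cc(5) dd(5) in \<open>auto simp: cd local_rep_def\<close>)
qed

lemma smooth_map_Pair: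
  assumes Z: "smooth_manifold Z" and X: "smooth_manifold X" and Y: "smooth_manifold Y"
    and F: "smooth_map Z X F" and K: "smooth_map Z Y K"
  shows "smooth_map Z (prod_mfd X Y) (\<lambda>z. (F z, K z))"
proof (rule smooth_mapI)
  note XY = smooth_manifold_prod[OF X Y]
  show cont: "continuous_on UNIV (\<lambda>z. (F z, K z))"
    by (intro continuous_on_Pair smooth_mapD(1)[OF F] smooth_mapD(1)[OF K])
  fix b e assume b: "b \<in> atlas Z" and e: "e \<in> atlas (prod_mfd X Y)"
  obtain c d where cd: "e = prod_chart c d" "c \<in> atlas X" "d \<in> atlas Y" using e by (auto simp: atlas_prod)
  let ?S = "chart_map b ` (chart_dom b \<inter> (\<lambda>z. (F z, K z)) -` chart_dom e)"
  have S: "relopen (model Z) ?S" using relopen_local_rep[OF Z XY cont b e] .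
  have "smooth_on (model Z) ?S (local_rep b c F)"
    by (rule smooth_on_subset[OF smooth_mapD(2)[OF F b cd(2)]]) (auto simp: cd)
  moreover have "smooth_on (model Z) ?S (local_rep b d K)"
    by (rule smooth_on_subset[OF smooth_mapD(2)[OF K b cd(3)]]) (auto simp: cd)
  ultimately have "smooth_on (model Z) ?S (\<lambda>y. (local_rep b c F y, local_rep b d K y))"
    by (rule smooth_on_Pair[OF S])
  then show "smooth_on (model Z) ?S (local_rep b e (\<lambda>z. (F z, K z)))"
    by (simp add: local_rep_def cd)
qed

section \<open>Tangent maps and coordinate vectors\<close>

lemma tangent_map_eq:
  "tangent_map X Y F x = frechet_derivative (local_rep (chart_at X x) (chart_at Y (F x)) F)
     (at (chart_map (chart_at X x) x) within model X)"
  by (simp add: tangent_map_def local_rep_def o_def)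

lemma tangent_map_has_derivative:
  assumes X: "smooth_manifold X" and Y: "smooth_manifold Y" and F: "smooth_map X Y F"
  shows "(local_rep (chart_at X x) (chart_at Y (F x)) F has_derivative tangent_map X Y F x)
     (at (chart_map (chart_at X x) x) within model X)"
  unfolding tangent_map_eq by (rule local_rep_has_derivative[OF X F chart_at[OF X] chart_at[OF Y]])

lemma chart_map_in_model:
  assumes "smooth_manifold X" "c \<in> atlas X" "x \<in> chart_dom c"
  shows "chart_map c x \<in> model X"
  using is_chartD(5)[OF smooth_manifold_is_chart[OF assms(1,2)] assms(3)]
    relopenD(3)[OF relopen_chart_img[OF smooth_manifold_subspace[OF assms(1)] smooth_manifold_is_chart[OF assms(1,2)]]]
  by blast

lemma tangent_map_eqI:
  assumes X: "smooth_manifold X" and v: "v \<in> model X"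
    and D: "(local_rep (chart_at X x) (chart_at Y (F x)) F has_derivative D)
     (at (chart_map (chart_at X x) x) within model X)"
  shows "tangent_map X Y F x v = D v"
  unfolding tangent_map_eq
  by (rule frechet_derivative_subspace[OF smooth_manifold_subspace[OF X] chart_map_in_model[OF X chart_at[OF X]] v D])

lemma linear_tangent_map:
  assumes "smooth_manifold X" "smooth_manifold Y" "smooth_map X Y F"
  shows "linear (tangent_map X Y F x)"
  using has_derivative_linear[OF tangent_map_has_derivative[OF assms]] .

lemma local_rep_derivative_in_model:
  assumes X: "smooth_manifold X" and Y: "smooth_manifold Y" and F: "continuous_on UNIV F"
    and c: "c \<in> atlas X" "x \<in> chart_dom c" and d: "d \<in> atlas Y" "F x \<in> chart_dom d"
    and D: "(local_rep c d F has_derivative D) (at (chart_map c x) within model X)"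
    and v: "v \<in> model X"
  shows "D v \<in> model Y"
proof (rule has_derivative_in_subspace[OF relopen_local_rep[OF X Y F c(1) d(1)] _ smooth_manifold_subspace[OF Y] _ D v])
  show "chart_map c x \<in> chart_map c ` (chart_dom c \<inter> F -` chart_dom d)" using c d by auto
  show "local_rep c d F ` (chart_map c ` (chart_dom c \<inter> F -` chart_dom d)) \<subseteq> model Y"
    using is_chartD(4)[OF smooth_manifold_is_chart[OF X c(1)]] chart_map_in_model[OF Y d(1)]
    by (auto simp: local_rep_def)
qed

lemma tangent_map_in_model:
  assumes X: "smooth_manifold X" and Y: "smooth_manifold Y" and F: "smooth_map X Y F" and v: "v \<in> model X"
  shows "tangent_map X Y F x v \<in> model Y"
  by (rule local_rep_derivative_in_model[OF X Y smooth_mapD(1)[OF F] chart_at[OF X] chart_at[OF Y]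
        tangent_map_has_derivative[OF X Y F] v])

lemma tangent_map_compose:
  assumes X: "smooth_manifold X" and Y: "smooth_manifold Y" and Z: "smooth_manifold Z"
    and F: "smooth_map X Y F" and K: "smooth_map Y Z K" and v: "v \<in> model X"
  shows "tangent_map X Z (\<lambda>x. K (F x)) x v = tangent_map Y Z K (F x) (tangent_map X Y F x v)"
  by (rule tangent_map_eqI[OF X v local_rep_chain[OF X Y smooth_mapD(1)[OF F] chart_at[OF X] chart_at[OF Y]
        tangent_map_has_derivative[OF X Y F] tangent_map_has_derivative[OF Y Z K]]])

lemma tangent_map_ident:
  assumes X: "smooth_manifold X" and v: "v \<in> model X"
  shows "tangent_map X X (\<lambda>x. x) x v = v"
proof (rule tangent_map_eqI[OF X v])
  let ?c = "chart_at X x"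
  note ch = smooth_manifold_is_chart[OF X chart_at(1)[OF X]]
  note ro = relopen_chart_img[OF smooth_manifold_subspace[OF X] ch]
  show "(local_rep ?c ?c (\<lambda>x. x) has_derivative (\<lambda>v. v)) (at (chart_map ?c x) within model X)"
    by (rule has_derivative_cong_relopen[OF ro is_chartD(5)[OF ch chart_at(2)[OF X]] _ has_derivative_ident])
      (simp add: local_rep_def is_chartD(6)[OF ch])
qed

lemma tangent_map_const:
  assumes X: "smooth_manifold X" and v: "v \<in> model X"
  shows "tangent_map X Y (\<lambda>x. p) x v = 0"
  by (rule tangent_map_eqI[OF X v]) (simp add: local_rep_def)

lemma coord_vector_eq:
  "coord_vector X c w y = frechet_derivative (local_rep c (chart_at X (chart_inv c y)) (\<lambda>x. x)) (at y within model X) w"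
  by (simp add: coord_vector_def local_rep_def o_def)

text \<open>\<open>coord_vector\<close> is the derivative of the change from \<open>c\<close> to the
  selected chart, so the chain rule cancels the selected source chart and leaves the fixed chart
  \<open>c\<close>. The target chart \<open>e\<close> is still a selected one; it is fixed too
  whenever \<open>F\<close> has the same value at all points considered.\<close>

lemma tangent_map_coord_vector:
  assumes X: "smooth_manifold X" and Y: "smooth_manifold Y" and F: "smooth_map X Y F"
    and c: "c \<in> atlas X" "y \<in> chart_img c" and w: "w \<in> model X" and e: "e = chart_at Y (F (chart_inv c y))"
  shows "tangent_map X Y F (chart_inv c y) (coord_vector X c w y)
    = frechet_derivative (local_rep c e F) (at y within model X) w"
proof -
  note cc = is_chartD[OF smooth_manifold_is_chart[OF X c(1)]]
  define x where "x = chart_inv c y"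
  have x: "x \<in> chart_dom c" "chart_map c x = y" using cc(6,7) c by (simp_all add: x_def)
  have D: "(local_rep c (chart_at X x) (\<lambda>x. x) has_derivative (\<lambda>w. coord_vector X c w y)) (at y within model X)"
    using local_rep_has_derivative[OF X smooth_map_ident[OF X] c(1) x(1) chart_at[OF X, of x]]
    unfolding coord_vector_eq x_def[symmetric] x(2) by simp
  have "(local_rep c e F has_derivative (\<lambda>w. tangent_map X Y F x (coord_vector X c w y))) (at (chart_map c x) within model X)"
    unfolding e x_def[symmetric]
    by (rule local_rep_chain[OF X X continuous_on_id c(1) x(1) chart_at[OF X] _ tangent_map_has_derivative[OF X Y F]])
      (simp add: x(2) D)
  from frechet_derivative_subspace[OF smooth_manifold_subspace[OF X] chart_map_in_model[OF X c(1) x(1)] w this]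
  show ?thesis by (simp add: x(2) x_def[symmetric])
qed

lemma coord_vector_in_model:
  assumes X: "smooth_manifold X" and c: "c \<in> atlas X" "y \<in> chart_img c" and w: "w \<in> model X"
  shows "coord_vector X c w y \<in> model X"
proof -
  note cc = is_chartD[OF smooth_manifold_is_chart[OF X c(1)]]
  have x: "chart_inv c y \<in> chart_dom c" "chart_map c (chart_inv c y) = y" using cc(6,7) c by simp_all
  show ?thesis unfolding coord_vector_eq
    using local_rep_derivative_in_model[OF X X continuous_on_id c(1) x(1) chart_at[OF X]
        local_rep_has_derivative[OF X smooth_map_ident[OF X] c(1) x(1) chart_at[OF X]] w]
    by (simp add: x(2))
qed

section \<open>The orbit map of a transitive action\<close>

text \<open>The chain rule for \<open>K \<circ> F = id\<close>; it yields injectivity of the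
  derivative of a left translation.\<close>

lemma local_rep_left_inverse:
  assumes X: "smooth_manifold X" and Y: "smooth_manifold Y"
    and F: "continuous_on UNIV F" and KF: "\<And>x. K (F x) = x"
    and c: "c \<in> atlas X" "x \<in> chart_dom c" and d: "d \<in> atlas Y" "F x \<in> chart_dom d"
    and D: "(local_rep c d F has_derivative D) (at (chart_map c x) within model X)"
    and E: "(local_rep d c K has_derivative E) (at (chart_map d (F x)) within model Y)"
    and v: "v \<in> model X"
  shows "E (D v) = v"
proof -
  note ch = smooth_manifold_is_chart[OF X c(1)]
  note ro = relopen_chart_img[OF smooth_manifold_subspace[OF X] ch]
  have "(local_rep c c (\<lambda>x. K (F x)) has_derivative (\<lambda>v. v)) (at (chart_map c x) within model X)"
    by (rule has_derivative_cong_relopen[OF ro is_chartD(5)[OF ch c(2)] _ has_derivative_ident])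
      (simp add: local_rep_def is_chartD(6)[OF ch] KF)
  from has_derivative_subspace_unique[OF smooth_manifold_subspace[OF X] chart_map_in_model[OF X c] v
      local_rep_chain[OF X Y F c d D E] this]
  show ?thesis .
qed

lemma smooth_manifold_real: "smooth_manifold real_mfd"
  using smooth_on_ident[of UNIV UNIV]
  by (simp add: smooth_manifold_def real_mfd_def is_chart_def chart_img_def chart_inv_def id_def o_def
      relopen_UNIV homeomorphism_def)

section \<open>Tangent action, adjoint action and the orbit map in coordinates\<close>

locale lie_transitive_action =
  fixes X :: "('g::{t2_space, second_countable_topology}, 'e::euclidean_space) mfd"
    and G :: "'g monoid"
    and M :: "('m::{t2_space, second_countable_topology}, 'f::euclidean_space) mfd"
    and act :: "'g \<Rightarrow> 'm \<Rightarrow> 'm"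
    and orig :: 'm
  assumes lie_group: "lie_group X G"
    and homogeneous_space: "homogeneous_space X G M act"
begin

lemma X: "smooth_manifold X" and M: "smooth_manifold M" and grp: "group G" and carrier: "carrier G = UNIV"
  using lie_group homogeneous_space by (simp_all add: lie_group_def homogeneous_space_def)

sublocale group G by (rule grp)

sublocale transitive_action G UNIV act
  using homogeneous_space by (simp add: homogeneous_space_def)

lemma in_carrier [simp]: "g \<in> carrier G"
  by (simp add: carrier)

lemma act_mult: "act (g \<otimes>\<^bsub>G\<^esub> k) x = act g (act k x)"
  by (rule composition_rule) simp_all

lemma act_one [simp]: "act \<one>\<^bsub>G\<^esub> x = x"
  using id_eq_one by (metis UNIV_I restrict_apply')

lemma act_inv [simp]: "act (inv\<^bsub>G\<^esub> g) (act g x) = x" "act g (act (inv\<^bsub>G\<^esub> g) x) = x"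
  by (simp_all add: act_mult[symmetric])

lemma act_transitive: "\<exists>g. act g x = y"
  using unique_orbit[of x y] by auto

lemma smooth_act:
  assumes "smooth_manifold Z" "smooth_map Z X F" "smooth_map Z M K"
  shows "smooth_map Z M (\<lambda>z. act (F z) (K z))"
proof -
  have "smooth_map (prod_mfd X M) M (\<lambda>p. act (fst p) (snd p))"
    using homogeneous_space by (simp add: homogeneous_space_def case_prod_unfold)
  from smooth_map_compose[OF assms(1) smooth_manifold_prod[OF X M] M smooth_map_Pair[OF assms(1) X M assms(2,3)] this]
  show ?thesis by simp
qed

lemma smooth_mult:
  assumes "smooth_manifold Z" "smooth_map Z X F" "smooth_map Z X K"
  shows "smooth_map Z X (\<lambda>z. F z \<otimes>\<^bsub>G\<^esub> K z)"
proof -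
  have "smooth_map (prod_mfd X X) X (\<lambda>p. fst p \<otimes>\<^bsub>G\<^esub> snd p)"
    using lie_group by (simp add: lie_group_def case_prod_unfold)
  from smooth_map_compose[OF assms(1) smooth_manifold_prod[OF X X] X smooth_map_Pair[OF assms(1) X X assms(2,3)] this]
  show ?thesis by simp
qed

lemma smooth_inv:
  assumes "smooth_manifold Z" "smooth_map Z X F"
  shows "smooth_map Z X (\<lambda>z. inv\<^bsub>G\<^esub> F z)"
proof -
  have "smooth_map X X (\<lambda>g. inv\<^bsub>G\<^esub> g)" using lie_group by (simp add: lie_group_def)
  from smooth_map_compose[OF assms(1) X X assms(2) this] show ?thesis .
qed

lemma smooth_act_left: "smooth_map M M (act g)"
  using smooth_act[OF M smooth_map_const[OF M X] smooth_map_ident[OF M]] .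

lemma smooth_orbit: "smooth_map X M (\<lambda>g. act g x)"
  using smooth_act[OF X smooth_map_ident[OF X] smooth_map_const[OF X M]] .

lemma smooth_left_mult: "smooth_map X X (\<lambda>k. g \<otimes>\<^bsub>G\<^esub> k)"
  using smooth_mult[OF X smooth_map_const[OF X X] smooth_map_ident[OF X]] .

lemma smooth_conj: "smooth_map X X (\<lambda>k. g \<otimes>\<^bsub>G\<^esub> k \<otimes>\<^bsub>G\<^esub> inv\<^bsub>G\<^esub> g)"
  using smooth_mult[OF X smooth_left_mult smooth_map_const[OF X X]] .

abbreviation tact :: "'g \<Rightarrow> 'm \<Rightarrow> 'f \<Rightarrow> 'f"
  where "tact g x \<equiv> tangent_map M M (act g) x"

abbreviation Adj :: "'g \<Rightarrow> 'e \<Rightarrow> 'e"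
  where "Adj \<equiv> Ad X G"

abbreviation infa :: "'e \<Rightarrow> 'm \<Rightarrow> 'f"
  where "infa \<equiv> inf_action X G M act"

lemma subspace_X: "subspace (model X)" and subspace_M: "subspace (model M)"
  by (rule smooth_manifold_subspace X M)+

lemma linear_tact: "linear (tact g x)"
  by (rule linear_tangent_map[OF M M smooth_act_left])

lemma tact_in: "f \<in> model M \<Longrightarrow> tact g x f \<in> model M"
  by (rule tangent_map_in_model[OF M M smooth_act_left])

lemma tact_mult: "f \<in> model M \<Longrightarrow> tact (g \<otimes>\<^bsub>G\<^esub> k) x f = tact g (act k x) (tact k x f)"
  using tangent_map_compose[OF M M M smooth_act_left smooth_act_left, of f g k x]
  by (simp add: act_mult[abs_def])

lemma tact_one: "f \<in> model M \<Longrightarrow> tact \<one>\<^bsub>G\<^esub> x f = f"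
  using tangent_map_ident[OF M, of f x] by (simp add: act_one[abs_def] eta_contract_eq)

lemma tact_inv: "f \<in> model M \<Longrightarrow> tact (inv\<^bsub>G\<^esub> g) (act g x) (tact g x f) = f"
  using tact_mult[of f "inv\<^bsub>G\<^esub> g" g x] by (simp add: tact_one)

lemma tact_inv': "f \<in> model M \<Longrightarrow> tact g (act (inv\<^bsub>G\<^esub> g) x) (tact (inv\<^bsub>G\<^esub> g) x f) = f"
  using tact_mult[of f g "inv\<^bsub>G\<^esub> g" x] by (simp add: tact_one)

lemma linear_Adj: "linear (Adj g)"
  unfolding Ad_def by (rule linear_tangent_map[OF X X smooth_conj])

lemma Adj_in: "\<xi> \<in> model X \<Longrightarrow> Adj g \<xi> \<in> model X"
  unfolding Ad_def by (rule tangent_map_in_model[OF X X smooth_conj])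

lemma Adj_mult: 
  assumes "\<xi> \<in> model X" shows "Adj (g \<otimes>\<^bsub>G\<^esub> k) \<xi> = Adj g (Adj k \<xi>)"
proof -
  have "(\<lambda>l. (g \<otimes>\<^bsub>G\<^esub> k) \<otimes>\<^bsub>G\<^esub> l \<otimes>\<^bsub>G\<^esub> inv\<^bsub>G\<^esub> (g \<otimes>\<^bsub>G\<^esub> k))
    = (\<lambda>l. g \<otimes>\<^bsub>G\<^esub> (k \<otimes>\<^bsub>G\<^esub> l \<otimes>\<^bsub>G\<^esub> inv\<^bsub>G\<^esub> k) \<otimes>\<^bsub>G\<^esub> inv\<^bsub>G\<^esub> g)"
    by (simp add: inv_mult_group m_assoc fun_eq_iff)
  then show ?thesis
    using tangent_map_compose[OF X X X smooth_conj smooth_conj assms, of g k "\<one>\<^bsub>G\<^esub>"] by (simp add: Ad_def)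
qed

lemma linear_infa: "linear (\<lambda>\<xi>. infa \<xi> x)"
  unfolding inf_action_def by (rule linear_tangent_map[OF X M smooth_orbit])

lemma infa_in: "\<xi> \<in> model X \<Longrightarrow> infa \<xi> x \<in> model M"
  unfolding inf_action_def by (rule tangent_map_in_model[OF X M smooth_orbit])

text \<open>Both sides are the derivative at the unit of one map, since
  \<open>g k g\<inverse>\<close> moves \<open>g \<cdot> x\<close> to
  \<open>g \<cdot> (k \<cdot> x)\<close>.\<close>

lemma infa_Adj:
  assumes "\<xi> \<in> model X" shows "infa (Adj g \<xi>) (act g x) = tact g x (infa \<xi> x)"
proof -
  have "(\<lambda>k. act (g \<otimes>\<^bsub>G\<^esub> k \<otimes>\<^bsub>G\<^esub> inv\<^bsub>G\<^esub> g) (act g x)) = (\<lambda>k. act g (act k x))"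
    by (simp add: act_mult)
  moreover have "tangent_map X M (\<lambda>k. act (g \<otimes>\<^bsub>G\<^esub> k \<otimes>\<^bsub>G\<^esub> inv\<^bsub>G\<^esub> g) (act g x)) \<one>\<^bsub>G\<^esub> \<xi> = infa (Adj g \<xi>) (act g x)"
    using tangent_map_compose[OF X X M smooth_conj smooth_orbit assms, of g "act g x" "\<one>\<^bsub>G\<^esub>"]
    by (simp add: Ad_def inf_action_def)
  moreover have "tangent_map X M (\<lambda>k. act g (act k x)) \<one>\<^bsub>G\<^esub> \<xi> = tact g x (infa \<xi> x)"
    using tangent_map_compose[OF X M M smooth_orbit smooth_act_left assms, of g x "\<one>\<^bsub>G\<^esub>"]
    by (simp add: inf_action_def)
  ultimately show ?thesis by simp
qed

text \<open>\<open>f0\<close> is the orbit map of \<open>orig\<close> in the charts \<open>c0\<close>, \<open>d0\<close>, with domain \<open>S0\<close>; \<open>A0\<close> is its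
  derivative at the point \<open>a0\<close>, which represents the unit.\<close>

definition "c0 = chart_at X \<one>\<^bsub>G\<^esub>"
definition "d0 = chart_at M orig"
definition "a0 = chart_map c0 \<one>\<^bsub>G\<^esub>"
definition "f0 = local_rep c0 d0 (\<lambda>g. act g orig)"
definition "S0 = chart_map c0 ` (chart_dom c0 \<inter> (\<lambda>g. act g orig) -` chart_dom d0)"
definition "A0 = (\<lambda>\<xi>. infa \<xi> orig)"

lemma c0: "c0 \<in> atlas X" "\<one>\<^bsub>G\<^esub> \<in> chart_dom c0" and d0: "d0 \<in> atlas M" "orig \<in> chart_dom d0"
  using chart_at[OF X] chart_at[OF M] by (simp_all add: c0_def d0_def)

lemmas cc0 = is_chartD[OF smooth_manifold_is_chart[OF X c0(1)]]
lemmas dd0 = is_chartD[OF smooth_manifold_is_chart[OF M d0(1)]]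

lemma linear_A0: "linear A0"
  unfolding A0_def by (rule linear_infa)

lemma A0_in: "\<xi> \<in> model X \<Longrightarrow> A0 \<xi> \<in> model M"
  unfolding A0_def by (rule infa_in)

lemma relopen_S0: "relopen (model X) S0"
  unfolding S0_def by (rule relopen_local_rep[OF X M smooth_mapD(1)[OF smooth_orbit] c0(1) d0(1)])

lemma a0_in: "a0 \<in> S0" "a0 \<in> model X" "chart_inv c0 a0 = \<one>\<^bsub>G\<^esub>"
proof -
  show "a0 \<in> S0" using c0 d0 by (auto simp: a0_def S0_def)
  then show "a0 \<in> model X" using relopenD(3)[OF relopen_S0] by blast
  show "chart_inv c0 a0 = \<one>\<^bsub>G\<^esub>" using cc0(4)[OF c0(2)] by (simp add: a0_def)
qed

lemma f0_a0: "f0 a0 = chart_map d0 orig"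
  by (simp add: f0_def local_rep_def a0_in)

lemma S0D:
  assumes "x \<in> S0"
  shows "x \<in> chart_img c0" "chart_inv c0 x \<in> chart_dom c0" "act (chart_inv c0 x) orig \<in> chart_dom d0"
    "f0 x \<in> model M" "f0 x \<in> chart_img d0" "act (chart_inv c0 x) orig = chart_inv d0 (f0 x)"
  using assms cc0(4,5) chart_map_in_model[OF M d0(1)] dd0(4,5)
  by (auto simp: S0_def f0_def local_rep_def)

lemma smooth_f0: "smooth_on (model X) S0 f0"
  unfolding S0_def f0_def by (rule smooth_mapD(2)[OF smooth_orbit c0(1) d0(1)])

lemma f0_has_derivative: "(f0 has_derivative A0) (at a0 within model X)"
  using tangent_map_has_derivative[OF X M smooth_orbit, of "\<one>\<^bsub>G\<^esub>" orig]
  by (simp add: f0_def c0_def d0_def a0_def A0_def inf_action_def[abs_def] eta_contract_eq)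

text \<open>Here \<open>L\<close> is a generalised inverse of \<open>A0\<close> and \<open>\<Psi> x = x + L (f0 x - f0 a0 - A0 (x - a0))\<close>. In the
  coordinates \<open>\<phi> = \<Psi>\<inverse>\<close> the map \<open>A0 \<circ> L \<circ> f0\<close> is affine, even when \<open>A0\<close> is not yet known to be onto.\<close>

lemma straightening:
  obtains L S \<Psi> T \<phi> where "linear L" "range L \<subseteq> model X"
    "\<And>v. v \<in> model X \<Longrightarrow> A0 (L (A0 v)) = A0 v"
    "relopen (model X) S" "S \<subseteq> S0" "a0 \<in> S" "relopen (model X) T" "homeomorphism S T \<Psi> \<phi>" "\<Psi> a0 = a0"
    "smooth_on (model X) S \<Psi>" "smooth_on (model X) T \<phi>"
    "(\<Psi> has_derivative (\<lambda>v. v)) (at a0 within model X)"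
    "\<And>y. y \<in> T \<Longrightarrow> A0 (L (f0 (\<phi> y) - f0 a0)) = A0 (y - a0)"
proof -
  obtain L where L: "range L \<subseteq> model X" "linear L" "\<forall>w\<in>A0 ` model X. A0 (L w) = w"
    using linear_exists_right_inverse_on[OF linear_A0 subspace_X] by blast
  have bL: "bounded_linear L" and bA: "bounded_linear A0"
    using L(2) linear_A0 by (simp_all add: linear_conv_bounded_linear)
  \<comment> \<open>The correction is \<open>L\<close> of the first-order Taylor remainder of
    \<open>f0\<close> at \<open>a0\<close>. It vanishes to first order there, which gives
    \<open>\<Psi>\<close> the identity as derivative.\<close>
  define \<Psi> where "\<Psi> = (\<lambda>x. x + L (f0 x - f0 a0 - A0 (x - a0)))"
  have sm: "smooth_on (model X) S0 \<Psi>" unfolding \<Psi>_def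
    by (intro smooth_on_add[OF relopen_S0] smooth_on_ident[OF relopen_S0] smooth_f0
        smooth_on_bounded_linear_comp[OF relopen_S0 bL] smooth_on_bounded_linear_comp[OF relopen_S0 bA]
        smooth_on_diff[OF relopen_S0] smooth_on_const[OF relopen_S0])
  have S0X: "S0 \<subseteq> model X" using relopenD(3)[OF relopen_S0] by blast
  have \<Psi>X: "\<Psi> ` S0 \<subseteq> model X"
    using S0X L(1) subspace_add[OF subspace_X] by (auto simp: \<Psi>_def)
  have "((\<lambda>x. x + L (f0 x - f0 a0 - A0 (x - a0))) has_derivative (\<lambda>v. v + L (A0 v - 0 - A0 (v - 0)))) (at a0 within model X)"
    by (intro has_derivative_add has_derivative_ident bounded_linear.has_derivative[OF bL]
        bounded_linear.has_derivative[OF bA] has_derivative_diff f0_has_derivative has_derivative_const)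
  then have d\<Psi>: "(\<Psi> has_derivative (\<lambda>v. v)) (at a0 within model X)"
    by (simp add: \<Psi>_def linear_0[OF L(2)])
  obtain S T \<phi> where S: "relopen (model X) S" "S \<subseteq> S0" "a0 \<in> S" and T: "relopen (model X) T"
    and hom: "homeomorphism S T \<Psi> \<phi>" and \<phi>: "smooth_on (model X) T \<phi>"
    by (rule smooth_local_inverse[OF relopen_S0 a0_in(1) sm \<Psi>X d\<Psi>]) simp
  have \<Psi>a: "\<Psi> a0 = a0" by (simp add: \<Psi>_def linear_0[OF linear_A0] linear_0[OF L(2)])
  have ALA: "A0 (L (A0 v)) = A0 v" if "v \<in> model X" for v using L(3) that by blast
  have key: "A0 (L (f0 (\<phi> y) - f0 a0)) = A0 (y - a0)" if y: "y \<in> T" for y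
  proof -
    have x: "\<phi> y \<in> S" "\<Psi> (\<phi> y) = y" using hom y unfolding homeomorphism_def by blast+
    have xa: "\<phi> y - a0 \<in> model X" using x S S0X a0_in(2) subspace_diff[OF subspace_X] by blast
    \<comment> \<open>Applying \<open>A0\<close> to the definition of \<open>\<Psi>\<close> produces
      \<open>A0 (x - a0)\<close> and \<open>- A0 (L (A0 (x - a0)))\<close> with
      \<open>x = \<phi> y\<close>; these cancel because \<open>L\<close> is a generalised
      inverse.\<close>
    have "A0 (y - a0) = A0 (\<phi> y - a0 + L (f0 (\<phi> y) - f0 a0 - A0 (\<phi> y - a0)))"
      using x(2) by (simp add: \<Psi>_def algebra_simps)
    also have "\<dots> = A0 (L (f0 (\<phi> y) - f0 a0))"
      using ALA[OF xa] by (simp add: linear_add[OF linear_A0] linear_diff[OF linear_A0] linear_diff[OF L(2)])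
    finally show ?thesis by simp
  qed
  show thesis
    by (rule that[OF L(2,1) ALA S T hom \<Psi>a smooth_on_subset[OF sm S(2)] \<phi> d\<Psi> key])
qed

end

section \<open>Constant rank and surjectivity of the infinitesimal action\<close>

context lie_transitive_action
begin

text \<open>The orbit map intertwines left translation by \<open>g\<close> with the action of
  \<open>g\<close>, where \<open>g\<close> is the group element with coordinates \<open>x\<close>.
  Differentiating at the unit gives \<open>B \<circ> J = B' \<circ> A0\<close> with \<open>J\<close>
  the derivative of the translation, so \<open>J\<close> carries the kernel of \<open>A0\<close>
  into that of \<open>B\<close>. Translation by the inverse of \<open>g\<close> makes
  \<open>J\<close> injective.\<close>

lemma kernel_translate:
  assumes x: "x \<in> S0" and B: "(f0 has_derivative B) (at x within model X)"
  obtains J where "linear J" "\<And>v. v \<in> model X \<Longrightarrow> J v \<in> model X" "inj_on J (model X)"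
    "\<And>v. v \<in> model X \<Longrightarrow> A0 v = 0 \<Longrightarrow> B (J v) = 0"
proof -
  define g where "g = chart_inv c0 x"
  have g: "g \<in> chart_dom c0" "act g orig \<in> chart_dom d0" "chart_map c0 g = x"
    using S0D[OF x] cc0(6) by (simp_all add: g_def)
  define l where "l = (\<lambda>k. g \<otimes>\<^bsub>G\<^esub> k)"
  define l' where "l' = (\<lambda>k. inv\<^bsub>G\<^esub> g \<otimes>\<^bsub>G\<^esub> k)"
  have sl: "smooth_map X X l" "smooth_map X X l'" unfolding l_def l'_def by (rule smooth_left_mult)+
  have l1: "l \<one>\<^bsub>G\<^esub> = g" "l' g = \<one>\<^bsub>G\<^esub>" "\<And>k. l' (l k) = k" by (simp_all add: l_def l'_def m_assoc[symmetric])
  have lg: "l \<one>\<^bsub>G\<^esub> \<in> chart_dom c0" using l1 g by simp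
  define J where "J = frechet_derivative (local_rep c0 c0 l) (at a0 within model X)"
  have J: "(local_rep c0 c0 l has_derivative J) (at (chart_map c0 \<one>\<^bsub>G\<^esub>) within model X)"
    using local_rep_has_derivative[OF X sl(1) c0 c0(1) lg] by (simp add: J_def a0_def)
  obtain J' where J': "(local_rep c0 c0 l' has_derivative J') (at (chart_map c0 (l \<one>\<^bsub>G\<^esub>)) within model X)"
    using local_rep_has_derivative[OF X sl(2) c0(1) lg c0(1)] l1 c0(2) by auto
  have J'J: "J' (J v) = v" if "v \<in> model X" for v
    by (rule local_rep_left_inverse[OF X X smooth_mapD(1)[OF sl(1)] l1(3) c0 c0(1) lg J J' that])
  have BJ: "(local_rep c0 d0 (\<lambda>k. act (l k) orig) has_derivative (\<lambda>v. B (J v))) (at (chart_map c0 \<one>\<^bsub>G\<^esub>) within model X)"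
    by (rule local_rep_chain[OF X X smooth_mapD(1)[OF sl(1)] c0 c0(1) lg J])
      (use B in \<open>simp add: f0_def[symmetric] l1 g\<close>)
  have o1: "act \<one>\<^bsub>G\<^esub> orig \<in> chart_dom d0" using d0 by simp
  obtain B' where B': "(local_rep d0 d0 (act g) has_derivative B') (at (chart_map d0 (act \<one>\<^bsub>G\<^esub> orig)) within model M)"
    using local_rep_has_derivative[OF M smooth_act_left d0(1) o1 d0(1)] g(2) by auto
  have "(local_rep c0 d0 (\<lambda>k. act g (act k orig)) has_derivative (\<lambda>v. B' (A0 v))) (at (chart_map c0 \<one>\<^bsub>G\<^esub>) within model X)"
    by (rule local_rep_chain[OF X M smooth_mapD(1)[OF smooth_orbit] c0 d0(1) o1 _ B'])
      (use f0_has_derivative in \<open>simp add: f0_def a0_def\<close>)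
  then have BA: "(local_rep c0 d0 (\<lambda>k. act (l k) orig) has_derivative (\<lambda>v. B' (A0 v))) (at (chart_map c0 \<one>\<^bsub>G\<^esub>) within model X)"
    by (simp add: l_def act_mult)
  have eq: "B (J v) = B' (A0 v)" if "v \<in> model X" for v
    using has_derivative_subspace_unique[OF subspace_X _ that BJ BA] a0_in(2) by (simp add: a0_def)
  have lB': "linear B'" using has_derivative_linear[OF B'] .
  show thesis
  proof (rule that)
    show "linear J" using has_derivative_linear[OF J] .
    show "J v \<in> model X" if "v \<in> model X" for v
      by (rule local_rep_derivative_in_model[OF X X smooth_mapD(1)[OF sl(1)] c0 c0(1) lg J that])
    show "inj_on J (model X)" by (rule inj_on_inverseI[of _ J']) (rule J'J)
    show "B (J v) = 0" if "v \<in> model X" "A0 v = 0" for v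
      using eq[OF that(1)] that(2) linear_0[OF lB'] by simp
  qed
qed

text \<open>The kernel of the derivative of \<open>f0\<close> at \<open>\<phi> y\<close> is contained in the image of the kernel of \<open>A0\<close> under
  the derivative of \<open>\<phi>\<close>. By left translation it has at least the same dimension, so the two agree.\<close>

lemma kernel_constant_rank:
  assumes S: "relopen (model X) S" "S \<subseteq> S0" and T: "relopen (model X) T" and hom: "homeomorphism S T \<Psi> \<phi>"
    and \<Psi>: "smooth_on (model X) S \<Psi>" and \<phi>: "smooth_on (model X) T \<phi>" and "linear L"
    and key: "\<And>y. y \<in> T \<Longrightarrow> A0 (L (f0 (\<phi> y) - f0 a0)) = A0 (y - a0)" and y: "y \<in> T"
  obtains D where "((\<lambda>y. f0 (\<phi> y)) has_derivative D) (at y within model X)"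
    "\<And>v. v \<in> model X \<Longrightarrow> A0 v = 0 \<Longrightarrow> D v = 0"
proof -
  let ?V = "model X"
  have h: "\<And>y. y \<in> T \<Longrightarrow> \<phi> y \<in> S" "\<And>y. y \<in> T \<Longrightarrow> \<Psi> (\<phi> y) = y" "\<And>x. x \<in> S \<Longrightarrow> \<Psi> x \<in> T" "\<And>x. x \<in> S \<Longrightarrow> \<phi> (\<Psi> x) = x"
    using hom unfolding homeomorphism_def by blast+
  define x where "x = \<phi> y"
  have x: "x \<in> S" "x \<in> S0" "x \<in> ?V" and yV: "y \<in> ?V"
    using h(1)[OF y] S relopenD(3)[OF S(1)] relopenD(3)[OF T y] by (auto simp: x_def)
  have SV: "S \<subseteq> ?V" and TV: "T \<subseteq> ?V" using relopenD(3)[OF S(1)] relopenD(3)[OF T] by blast+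
  define B where "B = frechet_derivative f0 (at x within ?V)"
  define \<Phi> where "\<Phi> = frechet_derivative \<phi> (at y within ?V)"
  define Q where "Q = frechet_derivative \<Psi> (at x within ?V)"
  have B: "(f0 has_derivative B) (at x within ?V)" unfolding B_def
    by (rule smooth_on_imp_has_derivative[OF smooth_f0 x(2)])
  have \<Phi>: "(\<phi> has_derivative \<Phi>) (at y within ?V)" unfolding \<Phi>_def
    by (rule smooth_on_imp_has_derivative[OF \<phi> y])
  have Q: "(\<Psi> has_derivative Q) (at x within ?V)" unfolding Q_def
    by (rule smooth_on_imp_has_derivative[OF \<Psi> x(1)])
  have \<phi>S: "\<phi> ` T \<subseteq> S" and \<Psi>T: "\<Psi> ` S \<subseteq> T" using h by blast+
  have \<Phi>V: "\<Phi> v \<in> ?V" if "v \<in> ?V" for v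
    by (rule has_derivative_in_subspace[OF T y subspace_X _ \<Phi> that]) (use \<phi>S SV in blast)
  have QV: "Q v \<in> ?V" if "v \<in> ?V" for v
    by (rule has_derivative_in_subspace[OF S(1) x(1) subspace_X _ Q that]) (use \<Psi>T TV in blast)
  have d1: "((\<lambda>x. \<phi> (\<Psi> x)) has_derivative (\<lambda>v. \<Phi> (Q v))) (at x within ?V)"
    by (rule has_derivative_chain_subspace[OF S(1) T x(1) \<Psi>T Q]) (use \<Phi> h(2)[OF y] in \<open>simp add: x_def\<close>)
  have d2: "((\<lambda>x. \<phi> (\<Psi> x)) has_derivative (\<lambda>v. v)) (at x within ?V)"
    by (rule has_derivative_cong_relopen[OF S(1) x(1) _ has_derivative_ident]) (simp add: h)
  have \<Phi>Q: "\<Phi> (Q v) = v" if "v \<in> ?V" for v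
    by (rule has_derivative_subspace_unique[OF subspace_X x(3) that d1 d2])
  have D: "((\<lambda>y. f0 (\<phi> y)) has_derivative (\<lambda>v. B (\<Phi> v))) (at y within ?V)"
    by (rule has_derivative_chain_subspace[OF T relopen_S0 y order_trans[OF \<phi>S S(2)] \<Phi>]) (use B in \<open>simp add: x_def\<close>)
  have bL: "bounded_linear L" and bA: "bounded_linear A0"
    using \<open>linear L\<close> linear_A0 by (simp_all add: linear_conv_bounded_linear)
  have d3: "((\<lambda>y. A0 (L (f0 (\<phi> y) - f0 a0))) has_derivative (\<lambda>v. A0 (L (B (\<Phi> v) - 0)))) (at y within ?V)"
    by (intro bounded_linear.has_derivative[OF bA] bounded_linear.has_derivative[OF bL] has_derivative_diff D has_derivative_const)
  have d4: "((\<lambda>y. A0 (L (f0 (\<phi> y) - f0 a0))) has_derivative (\<lambda>v. A0 (v - 0))) (at y within ?V)"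
    by (rule has_derivative_cong_relopen[OF T y _ bounded_linear.has_derivative[OF bA has_derivative_diff[OF has_derivative_ident has_derivative_const]]])
      (simp add: key)
  \<comment> \<open>The derivative of \<open>key\<close>. It shows that
    \<open>B (\<Phi> v) = 0\<close> implies \<open>A0 v = 0\<close>, the inclusion of kernels that
    holds without a count of dimensions.\<close>
  have ALB: "A0 (L (B (\<Phi> v))) = A0 v" if "v \<in> ?V" for v
    using has_derivative_subspace_unique[OF subspace_X yV that d3 d4] by simp
  have lB: "linear B" and lQ: "linear Q" using has_derivative_linear[OF B] has_derivative_linear[OF Q] by simp_all
  define KA where "KA = {v \<in> ?V. A0 v = 0}"
  define KB where "KB = {v \<in> ?V. B v = 0}"
  have sub: "subspace KA" "subspace KB"
    unfolding KA_def KB_def subspace_def using subspace_X linear_A0 lB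
    by (simp_all add: subspace_0 subspace_add subspace_scale linear_0 linear_add linear_scale)
  obtain J where J: "linear J" "\<And>v. v \<in> model X \<Longrightarrow> J v \<in> model X" "inj_on J (model X)"
    "\<And>v. v \<in> model X \<Longrightarrow> A0 v = 0 \<Longrightarrow> B (J v) = 0"
    by (rule kernel_translate[OF x(2) B]) (rule that)
  have KAV: "KA \<subseteq> ?V" and KBV: "KB \<subseteq> ?V" by (auto simp: KA_def KB_def)
  have spA: "span KA = KA" and spB: "span KB = KB" using sub by simp_all
  have "dim (J ` KA) = dim KA"
    by (rule dim_image_eq[OF J(1)]) (use inj_on_subset[OF J(3) KAV] in \<open>simp add: spA\<close>)
  moreover have "J ` KA \<subseteq> KB" using J by (auto simp: KA_def KB_def)
  ultimately have le: "dim KA \<le> dim KB" using dim_subset by metis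
  have "inj_on Q KB" by (rule inj_on_inverseI[of _ \<Phi>]) (use \<Phi>Q KBV in blast)
  then have "dim (Q ` KB) = dim KB" by (intro dim_image_eq[OF lQ]) (simp add: spB)
  moreover have "Q ` KB \<subseteq> KA"
  proof
    fix u assume "u \<in> Q ` KB"
    then obtain w where w: "w \<in> ?V" "B w = 0" "u = Q w" by (auto simp: KB_def)
    have "A0 u = A0 (L (B w))" using ALB[OF QV[OF w(1)]] \<Phi>Q[OF w(1)] w(3) by simp
    then show "u \<in> KA" using w QV[OF w(1)] by (simp add: KA_def linear_0[OF \<open>linear L\<close>] linear_0[OF linear_A0])
  qed
  \<comment> \<open>\<open>Q\<close> is injective on \<open>KB\<close>, so its image of
    \<open>KB\<close> has dimension at least \<open>dim KA\<close>; a subspace of \<open>KA\<close>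
    of that dimension is all of \<open>KA\<close>.\<close>
  ultimately have QK: "Q ` KB = KA"
    using subspace_dim_equal[OF linear_subspace_image[OF lQ sub(2)] sub(1)] le by simp
  show thesis
  proof (rule that[OF D])
    fix v assume "v \<in> ?V" "A0 v = 0"
    then have "v \<in> Q ` KB" using QK by (simp add: KA_def)
    then obtain w where "w \<in> ?V" "B w = 0" "v = Q w" by (auto simp: KB_def)
    then show "B (\<Phi> v) = 0" using \<Phi>Q by simp
  qed
qed

text \<open>Countably many translates of \<open>N\<close> cover the group, so by Baire one translate of the compact orbit piece
  has interior points. This is the only use of second countability.\<close>

lemma orbit_open_part:
  assumes K: "compact K" and N: "open N" "\<one>\<^bsub>G\<^esub> \<in> N" "N \<subseteq> K" and Kd: "(\<lambda>g. act g orig) ` K \<subseteq> chart_dom d0"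
  obtains O' where "relopen (model M) O'" "O' \<noteq> {}" "O' \<subseteq> (\<lambda>g. chart_map d0 (act g orig)) ` K"
proof -
  define \<pi> where "\<pi> = (\<lambda>g. act g orig)"
  have c\<pi>: "continuous_on UNIV \<pi>" unfolding \<pi>_def by (rule smooth_mapD(1)[OF smooth_orbit])
  have cact: "continuous_on UNIV (act g)" for g by (rule smooth_mapD(1)[OF smooth_act_left])
  have "compact (\<pi> ` K)" by (rule compact_continuous_image[OF continuous_on_subset[OF c\<pi>] K]) simp
  \<comment> \<open>Compactness of \<open>K\<close>, rather than closedness, is what survives the
    orbit map and the translations; in a Hausdorff space the images are then closed, as Baire
    requires.\<close>
  then have clK: "closed (act g ` \<pi> ` K)" for g
    by (intro compact_imp_closed compact_continuous_image[OF continuous_on_subset[OF cact]]) simp_all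
  define N' where "N' = (\<lambda>g. (\<lambda>k. inv\<^bsub>G\<^esub> g \<otimes>\<^bsub>G\<^esub> k) -` N)"
  have oN': "open (N' g)" for g
    unfolding N'_def by (rule open_vimage[OF N(1) smooth_mapD(1)[OF smooth_left_mult]])
  have gN': "g \<in> N' g" for g using N(2) by (simp add: N'_def)
  obtain \<F> where \<F>: "\<F> \<subseteq> range N'" "countable \<F>" "\<Union>\<F> = \<Union>(range N')"
    by (rule Lindelof[of "range N'"]) (use oN' in auto)
  obtain C where C: "countable C" "\<F> = N' ` C"
    using countable_subset_image[of \<F> N' UNIV] \<F>(1,2) by auto
  have cov: "\<exists>g\<in>C. p \<in> act g ` \<pi> ` K" for p
  proof -
    obtain k where k: "act k orig = p" using act_transitive by blast
    have "k \<in> \<Union>(range N')" using gN' by blast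
    then obtain g where g: "g \<in> C" "k \<in> N' g" using \<F>(3) C(2) by blast
    then have "inv\<^bsub>G\<^esub> g \<otimes>\<^bsub>G\<^esub> k \<in> K" using N(3) by (auto simp: N'_def)
    moreover have "p = act g (\<pi> (inv\<^bsub>G\<^esub> g \<otimes>\<^bsub>G\<^esub> k))" using k by (simp add: \<pi>_def act_mult)
    ultimately show ?thesis using g(1) by blast
  qed
  define E where "E = chart_img d0"
  have E: "relopen (model M) E" "chart_map d0 orig \<in> E"
    using relopen_chart_img[OF subspace_M smooth_manifold_is_chart[OF M d0(1)]] dd0(5)[OF d0(2)] by (simp_all add: E_def)
  define Cl where "Cl = (\<lambda>g. E \<inter> chart_inv d0 -` (act g ` \<pi> ` K))"
  have clE: "closedin (top_of_set E) (Cl g)" for g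
    unfolding Cl_def E_def by (rule continuous_closedin_preimage[OF dd0(9) clK])
  have "E = \<Union>(Cl ` C)" using cov by (auto simp: Cl_def)
  then have int: "top_of_set E interior_of \<Union>(Cl ` C) \<noteq> {}"
    using E(2) interior_of_topspace[of "top_of_set E"] by auto
  \<comment> \<open>Baire is applied inside the chart image, which is open in a closed subspace of a
    Euclidean space and therefore completely metrizable.\<close>
  have cm: "completely_metrizable_space (top_of_set E)"
  proof -
    have "completely_metrizable_space (top_of_set (model M))"
      using completely_metrizable_space_closedin[OF completely_metrizable_space_euclidean] closed_subspace[OF subspace_M] by simp
    from completely_metrizable_space_openin[OF this relopenD(2)[OF E(1)]]
    show ?thesis using relopenD(3)[OF E(1)] by (simp add: subtopology_subtopology Int_absorb1 subsetI)
  qed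
  have "\<exists>g\<in>C. top_of_set E interior_of (Cl g) \<noteq> {}"
  proof (rule ccontr)
    assume "\<not> ?thesis"
    then have "top_of_set E interior_of \<Union>(Cl ` C) = {}"
      by (intro Baire_category_alt) (use cm C(1) clE in auto)
    then show False using int by blast
  qed
  then obtain g where g: "top_of_set E interior_of (Cl g) \<noteq> {}" by blast
  define O1 where "O1 = top_of_set E interior_of (Cl g)"
  have O1: "openin (top_of_set E) O1" "O1 \<subseteq> Cl g" "O1 \<noteq> {}"
    using g interior_of_subset[of "top_of_set E" "Cl g"] by (simp_all add: O1_def)
  have O1M: "openin (top_of_set (model M)) O1" using openin_trans[OF O1(1) relopenD(2)[OF E(1)]] .
  have O1E: "O1 \<subseteq> chart_img d0" using O1(2) by (auto simp: Cl_def E_def)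
  have oP: "open (chart_inv d0 ` O1)"
    by (rule open_chart_inv_image[OF smooth_manifold_is_chart[OF M d0(1)] O1M O1E])
  \<comment> \<open>The interior points belong to the translate by \<open>g\<close>. Since
    \<open>g\<close> acts by a homeomorphism, its inverse moves them back to the orbit piece of
    \<open>K\<close> itself, which lies in the domain of \<open>d0\<close>.\<close>
  define P where "P = act g -` (chart_inv d0 ` O1)"
  have P: "open P" unfolding P_def by (rule open_vimage[OF oP cact])
  obtain z where z: "z \<in> O1" using O1(3) by blast
  have P0: "act (inv\<^bsub>G\<^esub> g) (chart_inv d0 z) \<in> P" using z by (simp add: P_def)
  have PK: "P \<subseteq> \<pi> ` K"
  proof
    fix p assume "p \<in> P"
    then obtain w where w: "w \<in> O1" "act g p = chart_inv d0 w" by (auto simp: P_def)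
    then obtain k where "k \<in> K" "act g p = act g (\<pi> k)" using O1(2) by (auto simp: Cl_def)
    then show "p \<in> \<pi> ` K" using act_inv(1) by (metis imageI)
  qed
  show thesis
  proof (rule that)
    show "relopen (model M) (chart_map d0 ` (chart_dom d0 \<inter> P))"
      by (rule relopen_chart_image[OF subspace_M smooth_manifold_is_chart[OF M d0(1)] P])
    show "chart_map d0 ` (chart_dom d0 \<inter> P) \<noteq> {}" using P0 PK Kd by (auto simp: \<pi>_def)
    show "chart_map d0 ` (chart_dom d0 \<inter> P) \<subseteq> (\<lambda>g. chart_map d0 (act g orig)) ` K"
      using PK by (auto simp: \<pi>_def)
  qed
qed

lemma relopen_ball:
  assumes "relopen V T" "a \<in> T"
  obtains r where "r > 0" "cball a r \<inter> V \<subseteq> T"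
proof -
  obtain U where U: "open U" "T = V \<inter> U" using relopenD(2)[OF assms(1)] by (auto simp: openin_open)
  then obtain r where "r > 0" "cball a r \<subseteq> U" using assms(2) open_contains_cball by blast
  then show thesis using that U(2) by blast
qed

text \<open>On a piece of the orbit with interior points the linear map \<open>A0 \<circ> L\<close> is injective, since \<open>f0 \<circ> \<phi>\<close> is
  constant in the directions of the kernel of \<open>A0\<close>. Hence it is injective everywhere, and
  \<open>A0 L (w - A0 L w) = 0\<close> gives \<open>w = A0 L w\<close>.\<close>

lemma A0_surj:
  assumes "w \<in> model M" shows "\<exists>\<xi>\<in>model X. A0 \<xi> = w"
proof -
  let ?V = "model X"
  obtain L S \<Psi> T \<phi> where L: "linear L" "range L \<subseteq> ?V" "\<And>v. v \<in> ?V \<Longrightarrow> A0 (L (A0 v)) = A0 v"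
    and S: "relopen ?V S" "S \<subseteq> S0" "a0 \<in> S" and T: "relopen ?V T" and hom: "homeomorphism S T \<Psi> \<phi>"
    and \<Psi>a: "\<Psi> a0 = a0"
    and \<Psi>: "smooth_on ?V S \<Psi>" and \<phi>: "smooth_on ?V T \<phi>"
    and key: "\<And>y. y \<in> T \<Longrightarrow> A0 (L (f0 (\<phi> y) - f0 a0)) = A0 (y - a0)"
    by (rule straightening) (rule that)
  have h: "\<And>y. y \<in> T \<Longrightarrow> \<phi> y \<in> S" "\<And>y. y \<in> T \<Longrightarrow> \<Psi> (\<phi> y) = y" "\<And>x. x \<in> S \<Longrightarrow> \<Psi> x \<in> T" "\<And>x. x \<in> S \<Longrightarrow> \<phi> (\<Psi> x) = x"
    using hom unfolding homeomorphism_def by blast+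
  have TV: "T \<subseteq> ?V" using relopenD(3)[OF T] by blast
  have aT: "a0 \<in> T" using h(3)[OF S(3)] \<Psi>a by simp
  have \<phi>a: "\<phi> a0 = a0" using h(4)[OF S(3)] \<Psi>a by simp
  obtain r where r: "r > 0" "cball a0 r \<inter> ?V \<subseteq> T" by (rule relopen_ball[OF T aT])
  let ?B = "cball a0 r \<inter> ?V"
  have convB: "convex ?B" by (intro convex_Int convex_cball subspace_imp_convex subspace_X)
  have lAL: "linear (\<lambda>w. A0 (L w))" using linear_compose[OF L(1) linear_A0] by (simp add: o_def)
  \<comment> \<open>By \<open>key\<close>, equal values of \<open>A0 \<circ> L\<close> force
    \<open>y' - y\<close> into the kernel of \<open>A0\<close>. On the segment from \<open>y\<close>
    to \<open>y'\<close>, which convexity keeps in the ball, the derivative of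
    \<open>f0 \<circ> \<phi>\<close> vanishes in this direction.\<close>
  have inj: "f0 (\<phi> y) = f0 (\<phi> y')"
    if y: "y \<in> ?B" "y' \<in> ?B" and eq: "A0 (L (f0 (\<phi> y))) = A0 (L (f0 (\<phi> y')))" for y y'
  proof -
    have "y \<in> T" "y' \<in> T" using y r(2) by blast+
    then have "A0 (y - a0) = A0 (y' - a0)"
      using key[of y] key[of y'] eq by (simp add: linear_diff[OF lAL])
    then have k0: "A0 (y' - y) = 0" by (simp add: linear_diff[OF linear_A0])
    have kV: "y' - y \<in> ?V" using y subspace_diff[OF subspace_X] by blast
    define c where "c = (\<lambda>t::real. y + t *\<^sub>R (y' - y))"
    have cB: "c t \<in> ?B" if "t \<in> {0..1}" for t
      using convexD_alt[OF convB y, of t] that by (simp add: c_def algebra_simps)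
    have "((\<lambda>t. f0 (\<phi> (c t))) has_derivative (\<lambda>h. 0)) (at t within {0..1})" if t: "t \<in> {0..1}" for t
    proof -
      have cT: "c t \<in> T" using cB[OF t] r(2) by blast
      obtain D where D: "((\<lambda>y. f0 (\<phi> y)) has_derivative D) (at (c t) within ?V)"
        "\<And>v. v \<in> ?V \<Longrightarrow> A0 v = 0 \<Longrightarrow> D v = 0"
        by (rule kernel_constant_rank[OF S(1,2) T hom \<Psi> \<phi> L(1) key cT], assumption, rule that)
      have dc: "(c has_derivative (\<lambda>h. h *\<^sub>R (y' - y))) (at t within {0..1})"
        unfolding c_def by (auto intro!: derivative_eq_intros)
      have "((\<lambda>y. f0 (\<phi> y)) has_derivative D) (at (c t) within c ` {0..1})"
        by (rule has_derivative_subset[OF D(1)]) (use cB in blast)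
      from diff_chain_within[OF dc this]
      have "((\<lambda>t. f0 (\<phi> (c t))) has_derivative (\<lambda>h. D (h *\<^sub>R (y' - y)))) (at t within {0..1})"
        by (simp add: o_def)
      moreover have "D (h *\<^sub>R (y' - y)) = 0" for h
        using D(2)[OF kV k0] linear_scale[OF has_derivative_linear[OF D(1)]] by simp
      ultimately show ?thesis by simp
    qed
    from has_derivative_zero_constant[OF _ this]
    obtain q where "\<forall>t\<in>{0..1}. f0 (\<phi> (c t)) = q" by auto
    then have "f0 (\<phi> (c 0)) = f0 (\<phi> (c 1))" by simp
    then show ?thesis by (simp add: c_def)
  qed
  define K where "K = chart_inv c0 ` \<phi> ` ?B"
  have \<phi>B: "\<phi> ` ?B \<subseteq> S0" using h(1) r(2) S(2) by blast
  have S0c: "S0 \<subseteq> chart_img c0" using S0D(1) by blast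
  have "compact ?B" by (intro compact_Int_closed compact_cball closed_subspace subspace_X)
  then have c\<phi>: "compact (\<phi> ` ?B)"
    by (rule compact_continuous_image[OF continuous_on_subset[OF smooth_on_imp_continuous_on[OF \<phi>] r(2)]])
  have compK: "compact K" unfolding K_def
    by (rule compact_continuous_image[OF continuous_on_subset[OF cc0(9)] c\<phi>]) (use \<phi>B S0c in blast)
  \<comment> \<open>\<open>K\<close> comes from a closed ball in the coordinates
    \<open>\<Psi>\<close> and is compact, \<open>N\<close> from the open ball of the same radius and
    is open.\<close>
  define N where "N = chart_inv c0 ` (S \<inter> \<Psi> -` (?V \<inter> ball a0 r))"
  have roV: "relopen ?V (?V \<inter> ball a0 r)"
    by (rule relopen_Int_open) (simp_all add: relopen_def subspace_X)
  have roN: "relopen ?V (S \<inter> \<Psi> -` (?V \<inter> ball a0 r))"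
    by (rule relopen_vimage[OF S(1) roV smooth_on_imp_continuous_on[OF \<Psi>]]) (use h(3) TV in blast)
  have oN: "open N" unfolding N_def
    by (rule open_chart_inv_image[OF smooth_manifold_is_chart[OF X c0(1)] relopenD(2)[OF roN]]) (use S(2) S0c in blast)
  have "a0 \<in> S \<inter> \<Psi> -` (?V \<inter> ball a0 r)" using S(3) \<Psi>a r(1) a0_in(2) by simp
  then have N1: "\<one>\<^bsub>G\<^esub> \<in> N" unfolding N_def using a0_in(3) by (metis imageI)
  have NK: "N \<subseteq> K"
  proof
    fix g assume "g \<in> N"
    then obtain x where x: "x \<in> S" "\<Psi> x \<in> ?V" "\<Psi> x \<in> ball a0 r" "g = chart_inv c0 x" by (auto simp: N_def)
    then have "\<Psi> x \<in> ?B" by auto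
    then show "g \<in> K" unfolding K_def using x(4) h(4)[OF x(1)] by (metis imageI)
  qed
  have Kd: "(\<lambda>g. act g orig) ` K \<subseteq> chart_dom d0" using \<phi>B S0D(3) by (auto simp: K_def)
  obtain O' where O': "relopen (model M) O'" "O' \<noteq> {}" "O' \<subseteq> (\<lambda>g. chart_map d0 (act g orig)) ` K"
    by (rule orbit_open_part[OF compK oN N1 NK Kd])
  have O'f: "\<exists>y\<in>?B. z = f0 (\<phi> y)" if "z \<in> O'" for z
    using O'(3) that by (auto simp: K_def f0_def local_rep_def)
  have ker: "u = 0" if u: "u \<in> model M" "A0 (L u) = 0" for u
  proof -
    obtain z where z: "z \<in> O'" using O'(2) by blast
    obtain \<epsilon> where \<epsilon>: "\<epsilon> > 0" "cball z \<epsilon> \<inter> model M \<subseteq> O'" by (rule relopen_ball[OF O'(1) z])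
    \<comment> \<open>The added 1 keeps the denominator positive when \<open>u = 0\<close>, and
      makes \<open>z + t *\<^sub>R u\<close> stay in the ball around \<open>z\<close>.\<close>
    define t where "t = \<epsilon> / (norm u + 1)"
    have t: "t > 0" "norm (t *\<^sub>R u) \<le> \<epsilon>"
      using \<epsilon>(1) by (auto simp: t_def field_simps add_pos_nonneg)
    have "z + t *\<^sub>R u \<in> O'"
      using \<epsilon>(2) t(2) relopenD(3)[OF O'(1) z] u(1) subspace_M
      by (intro subsetD[OF \<epsilon>(2)]) (auto simp: dist_norm subspace_add subspace_scale)
    then obtain y' where y': "y' \<in> ?B" "z + t *\<^sub>R u = f0 (\<phi> y')" using O'f by blast
    obtain y where y: "y \<in> ?B" "z = f0 (\<phi> y)" using O'f[OF z] by blast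
    have "A0 (L (z + t *\<^sub>R u)) = A0 (L z)" using u(2) by (simp add: linear_add[OF lAL] linear_scale[OF lAL])
    then have "z + t *\<^sub>R u = z" using inj[OF y'(1) y(1)] y(2) y'(2) by simp
    then show "u = 0" using t(1) by simp
  qed
  have LV: "L w \<in> ?V" using L(2) by blast
  have "A0 (L (w - A0 (L w))) = 0"
    using L(3)[OF LV] by (simp add: linear_diff[OF lAL])
  then have "w = A0 (L w)" using ker[of "w - A0 (L w)"] assms A0_in[OF LV] subspace_diff[OF subspace_M] by auto
  then show ?thesis using LV by metis
qed

end

text \<open>Differentiation exchanges sine and cosine, so both are handled in one induction; the
  amplitude \<open>a\<close> varies in it because each derivative changes the amplitude.\<close>

lemma Ck_on_sin_cos:
  "Ck_on k UNIV UNIV (\<lambda>t::real. a * sin (\<nu> * t)) \<and> Ck_on k UNIV UNIV (\<lambda>t::real. a * cos (\<nu> * t))"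
proof (induction k arbitrary: a)
  case 0
  show ?case by (auto intro!: continuous_intros)
next
  case (Suc k)
  have ro: "relopen (UNIV :: real set) UNIV" by (simp add: relopen_UNIV)
  have "((\<lambda>t. a * sin (\<nu> * t)) has_derivative (\<lambda>h. (a * \<nu> * h) * cos (\<nu> * t))) (at t)" for t :: real
    by (auto intro!: derivative_eq_intros)
  then have "Ck_on (Suc k) UNIV UNIV (\<lambda>t. a * sin (\<nu> * t))"
    by (intro Ck_on_SucI[OF ro, where D = "\<lambda>t h. (a * \<nu> * h) * cos (\<nu> * t)"]) (simp_all only: Suc)
  moreover have "((\<lambda>t. a * cos (\<nu> * t)) has_derivative (\<lambda>h. (- a * \<nu> * h) * sin (\<nu> * t))) (at t)" for t :: real
    by (auto intro!: derivative_eq_intros)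
  then have "Ck_on (Suc k) UNIV UNIV (\<lambda>t. a * cos (\<nu> * t))"
    by (intro Ck_on_SucI[OF ro, where D = "\<lambda>t h. (- a * \<nu> * h) * sin (\<nu> * t)"]) (simp_all only: Suc)
  ultimately show ?case ..
qed

text \<open>The inclusion that fixes the first factor is \<open>y \<mapsto> (a, y)\<close> in
  charts, with derivative \<open>w \<mapsto> (0, w)\<close>. The lemma turns a derivative that
  depends on a parameter in \<open>Z\<close> into a joint derivative evaluated at
  \<open>(a, y)\<close>, whose smoothness in the parameter is then immediate.\<close>

lemma partial_derivative_local_rep:
  assumes Z: "smooth_manifold Z" and N: "smooth_manifold N" and Y: "smooth_manifold Y"
    and F: "smooth_map (prod_mfd Z N) Y F" and b: "b \<in> atlas Z" and c: "c \<in> atlas N" and e: "e \<in> atlas Y"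
    and a: "a \<in> chart_img b" and y: "y \<in> chart_img c" and Fe: "F (chart_inv b a, chart_inv c y) \<in> chart_dom e"
    and w: "w \<in> model N"
  shows "frechet_derivative (local_rep c e (\<lambda>z. F (chart_inv b a, z))) (at y within model N) w =
    frechet_derivative (local_rep (prod_chart b c) e F) (at (a, y) within model Z \<times> model N) (0, w)"
proof -
  note bb = is_chartD[OF smooth_manifold_is_chart[OF Z b]] and cc = is_chartD[OF smooth_manifold_is_chart[OF N c]]
  note ro = relopen_chart_img[OF smooth_manifold_subspace[OF N] smooth_manifold_is_chart[OF N c]]
  define g where "g = chart_inv b a"
  define x where "x = chart_inv c y"
  have x: "x \<in> chart_dom c" "chart_map c x = y" using cc(6,7) y by (simp_all add: x_def)
  have g: "g \<in> chart_dom b" "chart_map b g = a" using bb(6,7) a by (simp_all add: g_def)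
  have pc: "prod_chart b c \<in> atlas (prod_mfd Z N)" by (rule prod_chart_in_atlas[OF b c])
  have ZN: "smooth_manifold (prod_mfd Z N)" by (rule smooth_manifold_prod[OF Z N])
  have inc: "continuous_on UNIV (\<lambda>z. (g, z))" by (intro continuous_intros)
  have gx: "(g, x) \<in> chart_dom (prod_chart b c)" using g x by simp
  have m: "chart_map (prod_chart b c) (g, x) = (a, y)" using g x by simp
  have "((\<lambda>z. (a, z)) has_derivative (\<lambda>w. (0, w))) (at (chart_map c x) within model N)"
    by (intro has_derivative_Pair has_derivative_const has_derivative_ident)
  then have 1: "(local_rep c (prod_chart b c) (\<lambda>z. (g, z)) has_derivative (\<lambda>w. (0, w))) (at (chart_map c x) within model N)"
    by (rule has_derivative_cong_relopen[OF ro cc(5)[OF x(1)], rotated]) (simp add: local_rep_def g(2) cc(6))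
  have "(local_rep (prod_chart b c) e F has_derivative
      frechet_derivative (local_rep (prod_chart b c) e F) (at (chart_map (prod_chart b c) (g, x)) within model (prod_mfd Z N)))
      (at (chart_map (prod_chart b c) (g, x)) within model (prod_mfd Z N))"
    by (rule local_rep_has_derivative[OF ZN F pc gx e]) (use Fe in \<open>simp add: g_def x_def\<close>)
  from local_rep_chain[OF N ZN inc c x(1) pc gx 1 this]
  have "(local_rep c e (\<lambda>z. F (g, z)) has_derivative
      (\<lambda>w. frechet_derivative (local_rep (prod_chart b c) e F) (at (a, y) within model Z \<times> model N) (0, w)))
      (at (chart_map c x) within model N)"
    by (simp only: m model_prod)
  from frechet_derivative_subspace[OF smooth_manifold_subspace[OF N] chart_map_in_model[OF N c x(1)] w this]
  show ?thesis by (simp only: x(2) g_def)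
qed

lemma prod_chart_image_mem:
  assumes Z: "smooth_manifold Z" and N: "smooth_manifold N" and b: "b \<in> atlas Z" and c: "c \<in> atlas N"
    and a: "a \<in> chart_img b" and y: "y \<in> chart_img c" and F: "F (chart_inv b a, chart_inv c y) \<in> U"
  shows "(a, y) \<in> chart_map (prod_chart b c) ` (chart_dom (prod_chart b c) \<inter> F -` U)"
proof (rule image_eqI)
  note bb = is_chartD[OF smooth_manifold_is_chart[OF Z b]] and cc = is_chartD[OF smooth_manifold_is_chart[OF N c]]
  show "(a, y) = chart_map (prod_chart b c) (chart_inv b a, chart_inv c y)" using bb(6)[OF a] cc(6)[OF y] by simp
  show "(chart_inv b a, chart_inv c y) \<in> chart_dom (prod_chart b c) \<inter> F -` U"
    using bb(7)[OF a] cc(7)[OF y] F by simp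
qed

section \<open>The isotropy algebra, local sections and smoothness of transported forms\<close>

context lie_transitive_action
begin

text \<open>Since \<open>A0\<close> is onto, the generalised inverse \<open>L\<close> is a genuine
  right inverse. The relation obtained in \<open>straightening\<close> then determines
  \<open>f0 \<circ> \<phi>\<close> itself and not only its image under
  \<open>A0 \<circ> L\<close>.\<close>

lemma submersion_chart:
  obtains L T \<phi> where "linear L" "range L \<subseteq> model X" "\<And>w. w \<in> model M \<Longrightarrow> A0 (L w) = w"
    "relopen (model X) T" "a0 \<in> T" "\<phi> a0 = a0" "smooth_on (model X) T \<phi>" "\<phi> ` T \<subseteq> S0"
    "\<And>y. y \<in> T \<Longrightarrow> f0 (\<phi> y) = f0 a0 + A0 (y - a0)"
    "\<And>v. v \<in> model X \<Longrightarrow> frechet_derivative \<phi> (at a0 within model X) v = v"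
proof -
  let ?V = "model X"
  obtain L S \<Psi> T \<phi> where L: "linear L" "range L \<subseteq> ?V" "\<And>v. v \<in> ?V \<Longrightarrow> A0 (L (A0 v)) = A0 v"
    and S: "relopen ?V S" "S \<subseteq> S0" "a0 \<in> S" and T: "relopen ?V T" and hom: "homeomorphism S T \<Psi> \<phi>"
    and \<Psi>a: "\<Psi> a0 = a0"
    and \<Psi>: "smooth_on ?V S \<Psi>" and \<phi>: "smooth_on ?V T \<phi>"
    and d\<Psi>: "(\<Psi> has_derivative (\<lambda>v. v)) (at a0 within ?V)"
    and key: "\<And>y. y \<in> T \<Longrightarrow> A0 (L (f0 (\<phi> y) - f0 a0)) = A0 (y - a0)"
    by (rule straightening) (rule that)
  have h: "\<And>y. y \<in> T \<Longrightarrow> \<phi> y \<in> S" "\<And>y. y \<in> T \<Longrightarrow> \<Psi> (\<phi> y) = y" "\<And>x. x \<in> S \<Longrightarrow> \<Psi> x \<in> T" "\<And>x. x \<in> S \<Longrightarrow> \<phi> (\<Psi> x) = x"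
    using hom unfolding homeomorphism_def by blast+
  have aT: "a0 \<in> T" using h(3)[OF S(3)] \<Psi>a by simp
  have \<phi>a: "\<phi> a0 = a0" using h(4)[OF S(3)] \<Psi>a by simp
  have AL: "A0 (L w) = w" if "w \<in> model M" for w
    using A0_surj[OF that] L(3) by metis
  have \<phi>S: "\<phi> ` T \<subseteq> S0" using h(1) S(2) by blast
  have key': "f0 (\<phi> y) = f0 a0 + A0 (y - a0)" if y: "y \<in> T" for y
  proof -
    have "f0 (\<phi> y) - f0 a0 \<in> model M"
      using S0D(4) a0_in(1) \<phi>S y subspace_diff[OF subspace_M] by blast
    then show ?thesis using key[OF y] AL by (metis add.commute diff_add_cancel)
  qed
  have d\<phi>: "(\<phi> has_derivative frechet_derivative \<phi> (at a0 within ?V)) (at a0 within ?V)"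
    by (rule smooth_on_imp_has_derivative[OF \<phi> aT])
  have \<Psi>T: "\<Psi> ` S \<subseteq> T" using h by blast
  have d1: "((\<lambda>x. \<phi> (\<Psi> x)) has_derivative (\<lambda>v. frechet_derivative \<phi> (at a0 within ?V) v)) (at a0 within ?V)"
    by (rule has_derivative_chain_subspace[OF S(1) T S(3) \<Psi>T d\<Psi>]) (use d\<phi> in \<open>simp add: \<Psi>a\<close>)
  have d2: "((\<lambda>x. \<phi> (\<Psi> x)) has_derivative (\<lambda>v. v)) (at a0 within ?V)"
    by (rule has_derivative_cong_relopen[OF S(1,3) _ has_derivative_ident]) (simp add: h)
  have "frechet_derivative \<phi> (at a0 within ?V) v = v" if "v \<in> ?V" for v
    by (rule has_derivative_subspace_unique[OF subspace_X a0_in(2) that d1 d2])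
  with L(1,2) AL T aT \<phi>a \<phi> \<phi>S key' show thesis by (rule that)
qed

text \<open>In the coordinates \<open>\<phi>\<close> the fibre of the orbit map through the unit is
  flat, so moving from \<open>a0\<close> along \<open>\<xi>\<close> stays in the isotropy group. The
  velocity is \<open>\<xi>\<close> because both \<open>\<rho>\<close> and \<open>\<phi>\<close> have
  identity derivative at the base point.\<close>

lemma kernel_in_subgroup_lie_algebra:
  assumes \<xi>: "\<xi> \<in> model X" "A0 \<xi> = 0"
  shows "\<xi> \<in> subgroup_lie_algebra X G (stabilizer G act orig)"
proof -
  let ?V = "model X"
  obtain L T \<phi> where T: "relopen ?V T" "a0 \<in> T" "\<phi> a0 = a0" and \<phi>: "smooth_on ?V T \<phi>" "\<phi> ` T \<subseteq> S0"
    "\<And>y. y \<in> T \<Longrightarrow> f0 (\<phi> y) = f0 a0 + A0 (y - a0)"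
    and d\<phi>: "\<And>v. v \<in> ?V \<Longrightarrow> frechet_derivative \<phi> (at a0 within ?V) v = v"
    by (rule submersion_chart) (rule that)
  obtain r where r: "r > 0" "cball a0 r \<inter> ?V \<subseteq> T" by (rule relopen_ball[OF T(1,2)])
  \<comment> \<open>\<open>\<delta>\<close> bounds the parameter \<open>\<rho>\<close>, so that
    \<open>a0 + \<rho> t *\<^sub>R \<xi>\<close> never leaves the ball contained in
    \<open>T\<close>; the added 1 covers \<open>\<xi> = 0\<close>.\<close>
  define \<delta> where "\<delta> = r / (norm \<xi> + 1)"
  have \<delta>: "\<delta> > 0" "\<delta> * norm \<xi> \<le> r" using r(1) by (auto simp: \<delta>_def field_simps add_pos_nonneg)
  \<comment> \<open>a bounded parameter, since curves in the subgroup have to be defined on the whole line\<close>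
  define \<rho> where "\<rho> = (\<lambda>t::real. \<delta> * sin (1 / \<delta> * t))"
  define p where "p = (\<lambda>t. a0 + \<rho> t *\<^sub>R \<xi>)"
  define \<gamma> where "\<gamma> = (\<lambda>t. chart_inv c0 (\<phi> (p t)))"
  have roU: "relopen (UNIV :: real set) UNIV" by (simp add: relopen_UNIV)
  have \<rho>b: "\<bar>\<rho> t\<bar> \<le> \<delta>" for t using \<delta>(1) abs_sin_le_one[of "1 / \<delta> * t"] by (simp add: \<rho>_def abs_mult)
  have pT: "p t \<in> T" for t
  proof (rule subsetD[OF r(2)])
    have "\<bar>\<rho> t\<bar> * norm \<xi> \<le> r" using mult_right_mono[OF \<rho>b[of t], of "norm \<xi>"] \<delta>(2) by simp
    then show "p t \<in> cball a0 r \<inter> ?V"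
      using a0_in(2) \<xi>(1) subspace_X by (simp add: p_def dist_norm subspace_add subspace_scale)
  qed
  have sp: "smooth_on UNIV UNIV p"
    unfolding p_def \<rho>_def using Ck_on_sin_cos[of _ \<delta> "1 / \<delta>"]
    by (intro smooth_on_add[OF roU] smooth_on_scaleR[OF roU] smooth_on_const[OF roU]) (simp add: smooth_on_def)
  define q where "q = (\<lambda>t. \<phi> (p t))"
  have sq: "smooth_on UNIV UNIV q" unfolding q_def
    by (rule smooth_on_compose[OF roU T(1) _ sp \<phi>(1)]) (use pT in blast)
  have qS: "q t \<in> S0" for t using \<phi>(2) pT by (auto simp: q_def)
  have q\<gamma>: "\<gamma> t \<in> chart_dom c0" "chart_map c0 (\<gamma> t) = q t" for t
    using S0D(1,2)[OF qS[of t]] cc0(6) by (simp_all add: \<gamma>_def q_def)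
  have \<gamma>0: "\<gamma> 0 = \<one>\<^bsub>G\<^esub>" by (simp add: \<gamma>_def p_def \<rho>_def T(3) a0_in(3))
  have real_inv: "chart_inv (UNIV, id) = (\<lambda>t::real. t)" by (simp add: chart_inv_def fun_eq_iff)
  have real_at: "chart_at real_mfd 0 = (UNIV, id)"
    using chart_at(1)[OF smooth_manifold_real, of 0] by (simp add: real_mfd_def)
  have cont: "continuous_on UNIV \<gamma>"
    unfolding \<gamma>_def q_def[symmetric]
    by (rule continuous_on_compose2[OF cc0(9) smooth_on_imp_continuous_on[OF sq[unfolded q_def]]]) (use S0D(1) qS in \<open>auto simp: q_def\<close>)
  have sm: "smooth_map real_mfd X \<gamma>"
  proof (rule smooth_mapI[OF cont])
    fix c d assume c: "c \<in> atlas real_mfd" and d: "d \<in> atlas X"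
    have c': "c = (UNIV, id)" using c by (simp add: real_mfd_def)
    have ro\<gamma>: "relopen UNIV (\<gamma> -` chart_dom d)"
      unfolding relopen_UNIV by (rule open_vimage[OF is_chartD(1)[OF smooth_manifold_is_chart[OF X d]] cont])
    \<comment> \<open>The curve is smooth in the chart \<open>c0\<close> by construction; any other
      chart \<open>d\<close> is reached by the coordinate change from \<open>c0\<close> to
      \<open>d\<close>.\<close>
    have "smooth_on UNIV (\<gamma> -` chart_dom d) (\<lambda>t. local_rep c0 d (\<lambda>x. x) (q t))"
      by (rule smooth_on_compose[OF ro\<gamma> relopen_local_rep[OF X X continuous_on_id c0(1) d] _ smooth_on_subset[OF sq]
            smooth_mapD(2)[OF smooth_map_ident[OF X] c0(1) d]])
        (use q\<gamma> in \<open>auto simp flip: q\<gamma>(2)\<close>)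
    then have "smooth_on UNIV (\<gamma> -` chart_dom d) (local_rep c d \<gamma>)"
      by (simp add: local_rep_def c' real_inv \<gamma>_def q_def)
    then show "smooth_on (model real_mfd) (chart_map c ` (chart_dom c \<inter> \<gamma> -` chart_dom d)) (local_rep c d \<gamma>)"
      by (simp add: c' real_mfd_def)
  qed
  have H: "range \<gamma> \<subseteq> stabilizer G act orig"
  proof -
    have "act (\<gamma> t) orig = orig" for t
    proof -
      have "f0 (q t) = f0 a0" using \<phi>(3)[OF pT[of t]] \<xi>(2) by (simp add: q_def p_def linear_scale[OF linear_A0])
      then have "act (chart_inv c0 (q t)) orig = act (chart_inv c0 a0) orig"
        using S0D(6)[OF qS[of t]] S0D(6)[OF a0_in(1)] by simp
      then show ?thesis by (simp add: q_def \<gamma>_def a0_in(3))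
    qed
    then show ?thesis by (auto simp: stabilizer_def)
  qed
  have "(\<rho> has_derivative (\<lambda>h. h)) (at 0)"
    unfolding \<rho>_def using \<delta>(1) by (auto intro!: derivative_eq_intros)
  then have dp: "(p has_derivative (\<lambda>h. 0 + h *\<^sub>R \<xi>)) (at 0)" unfolding p_def
    by (intro has_derivative_add has_derivative_const has_derivative_scaleR_left)
  have p0: "p 0 = a0" by (simp add: p_def \<rho>_def)
  have "((\<lambda>t. \<phi> (p t)) has_derivative (\<lambda>h. frechet_derivative \<phi> (at a0 within ?V) (0 + h *\<^sub>R \<xi>))) (at 0)"
    by (rule has_derivative_chain_subspace[OF roU T(1) _ _ dp])
      (use pT smooth_on_imp_has_derivative[OF \<phi>(1) T(2)] in \<open>auto simp: p0\<close>)
  then have "(local_rep (chart_at real_mfd 0) (chart_at X (\<gamma> 0)) \<gamma> has_derivative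
      (\<lambda>h. frechet_derivative \<phi> (at a0 within ?V) (0 + h *\<^sub>R \<xi>))) (at (chart_map (chart_at real_mfd 0) 0) within model real_mfd)"
    using q\<gamma>(2) by (simp add: real_at \<gamma>0 c0_def[symmetric] local_rep_def real_inv q_def, simp add: real_mfd_def)
  from tangent_map_eqI[OF smooth_manifold_real _ this, of 1]
  have "tangent_map real_mfd X \<gamma> 0 1 = \<xi>" using d\<phi>[OF \<xi>(1)] by (simp add: real_mfd_def)
  then show ?thesis using sm \<gamma>0 H unfolding subgroup_lie_algebra_def by blast
qed

text \<open>A curve in the isotropy group is sent to a constant by the orbit map, so its velocity
  lies in the kernel. From here on the isotropy algebra is the kernel of a linear map, and in
  particular visibly a subspace.\<close>

lemma subgroup_lie_algebra_eq:
  "subgroup_lie_algebra X G (stabilizer G act orig) = {\<xi> \<in> model X. A0 \<xi> = 0}"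
proof (intro equalityI subsetI)
  fix \<xi> assume "\<xi> \<in> subgroup_lie_algebra X G (stabilizer G act orig)"
  then obtain \<gamma> where \<gamma>: "\<xi> = tangent_map real_mfd X \<gamma> 0 1" "smooth_map real_mfd X \<gamma>" "\<gamma> 0 = \<one>\<^bsub>G\<^esub>"
    "range \<gamma> \<subseteq> stabilizer G act orig"
    unfolding subgroup_lie_algebra_def by blast
  have one: "1 \<in> model real_mfd" by (simp add: real_mfd_def)
  have "act (\<gamma> t) orig = orig" for t using \<gamma>(4) by (auto simp: stabilizer_def)
  then have "tangent_map real_mfd M (\<lambda>t. act (\<gamma> t) orig) 0 1 = 0"
    using tangent_map_const[OF smooth_manifold_real one] by simp
  then have "A0 \<xi> = 0"
    using tangent_map_compose[OF smooth_manifold_real X M \<gamma>(2) smooth_orbit one] \<gamma>(1,3)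
    by (simp add: A0_def inf_action_def)
  moreover have "\<xi> \<in> model X" using tangent_map_in_model[OF smooth_manifold_real X \<gamma>(2) one] \<gamma>(1) by simp
  ultimately show "\<xi> \<in> {\<xi> \<in> model X. A0 \<xi> = 0}" by simp
qed (use kernel_in_subgroup_lie_algebra in blast)

text \<open>The straightened orbit map is affine with linear part \<open>A0\<close>, so a right
  inverse of \<open>A0\<close> gives an affine section \<open>\<tau>\<close> of it; composing with
  \<open>\<phi>\<close> returns to the coordinates of \<open>c0\<close>.\<close>

lemma local_section:
  obtains N \<sigma> where "relopen (model M) N" "chart_map d0 orig \<in> N" "smooth_on (model M) N \<sigma>"
    "\<sigma> ` N \<subseteq> chart_img c0" "\<sigma> ` N \<subseteq> model X" "\<And>y. y \<in> N \<Longrightarrow> act (chart_inv c0 (\<sigma> y)) orig = chart_inv d0 y"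
proof -
  obtain L T \<phi> where L: "linear L" "range L \<subseteq> model X" "\<And>w. w \<in> model M \<Longrightarrow> A0 (L w) = w"
    and T: "relopen (model X) T" "a0 \<in> T" and \<phi>: "smooth_on (model X) T \<phi>" "\<phi> ` T \<subseteq> S0"
    "\<And>y. y \<in> T \<Longrightarrow> f0 (\<phi> y) = f0 a0 + A0 (y - a0)"
    by (rule submersion_chart) (rule that)
  define \<tau> where "\<tau> = (\<lambda>y. a0 + L (y - f0 a0))"
  have roM: "relopen (model M) (model M)" by (simp add: relopen_def subspace_M)
  have bL: "bounded_linear L" using L(1) by (simp add: linear_conv_bounded_linear)
  have s\<tau>: "smooth_on (model M) (model M) \<tau>" unfolding \<tau>_def
    by (intro smooth_on_add[OF roM] smooth_on_const[OF roM] smooth_on_bounded_linear_comp[OF roM bL]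
        smooth_on_diff[OF roM] smooth_on_ident[OF roM])
  have \<tau>X: "\<tau> ` model M \<subseteq> model X"
    using L(2) a0_in(2) subspace_add[OF subspace_X] by (auto simp: \<tau>_def)
  define N where "N = model M \<inter> \<tau> -` T"
  have roN: "relopen (model M) N" unfolding N_def
    by (rule relopen_vimage[OF roM T(1) smooth_on_imp_continuous_on[OF s\<tau>] \<tau>X])
  have f0M: "f0 a0 \<in> model M" using S0D(4)[OF a0_in(1)] .
  have fN: "f0 a0 \<in> N" using f0M T(2) by (simp add: N_def \<tau>_def linear_0[OF L(1)])
  have \<tau>N: "\<tau> ` N \<subseteq> T" by (auto simp: N_def)
  have sS: "\<phi> (\<tau> y) \<in> S0" if "y \<in> N" for y using \<phi>(2) that \<tau>N by blast
  have eq: "f0 (\<phi> (\<tau> y)) = y" if y: "y \<in> N" for y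
  proof -
    have "A0 (L (y - f0 a0)) = y - f0 a0" using y f0M subspace_diff[OF subspace_M] L(3) by (simp add: N_def)
    then show ?thesis using \<phi>(3)[of "\<tau> y"] y \<tau>N by (auto simp: \<tau>_def N_def)
  qed
  show thesis
  proof (rule that[OF roN])
    show "chart_map d0 orig \<in> N" using fN f0_a0 by simp
    show "smooth_on (model M) N (\<lambda>y. \<phi> (\<tau> y))"
      by (rule smooth_on_compose[OF roN T(1) \<tau>N smooth_on_subset[OF s\<tau>] \<phi>(1)]) (auto simp: N_def)
    show "(\<lambda>y. \<phi> (\<tau> y)) ` N \<subseteq> chart_img c0" using sS S0D(1) by blast
    show "(\<lambda>y. \<phi> (\<tau> y)) ` N \<subseteq> model X" using sS relopenD(3)[OF relopen_S0] by blast
    show "act (chart_inv c0 (\<phi> (\<tau> y))) orig = chart_inv d0 y" if "y \<in> N" for y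
      using S0D(6)[OF sS[OF that]] eq[OF that] by simp
  qed
qed

text \<open>Along a smooth local section of the orbit map, both the adjoint action and the tangent action of the
  inverse are partial derivatives of smooth maps on product manifolds.\<close>

lemma transported_form_smooth:
  assumes \<theta>: "bounded_linear \<theta>" "\<theta> ` model M \<subseteq> model X"
    and \<omega>: "\<And>g x f. act g orig = x \<Longrightarrow> f \<in> model M \<Longrightarrow> \<omega> x f = Adj g (\<theta> (tact (inv\<^bsub>G\<^esub> g) x f))"
    and c: "c \<in> atlas M" and w: "w \<in> model M"
  shows "smooth_on (model M) (chart_img c) (\<lambda>y. \<omega> (chart_inv c y) (coord_vector M c w y))"
proof (rule smooth_on_local[OF relopen_chart_img[OF subspace_M smooth_manifold_is_chart[OF M c]]])
  let ?V = "model X" and ?W = "model M"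
  note cc = is_chartD[OF smooth_manifold_is_chart[OF M c]]
  fix y0 assume y0: "y0 \<in> chart_img c"
  obtain g0 where g0: "act g0 orig = chart_inv c y0" using act_transitive by blast
  obtain N \<sigma> where N: "relopen ?W N" "chart_map d0 orig \<in> N" and \<sigma>: "smooth_on ?W N \<sigma>"
    "\<sigma> ` N \<subseteq> chart_img c0" "\<sigma> ` N \<subseteq> ?V" "\<And>y. y \<in> N \<Longrightarrow> act (chart_inv c0 (\<sigma> y)) orig = chart_inv d0 y"
    by (rule local_section) (rule that)
  \<comment> \<open>\<open>k\<close> carries the point with coordinates \<open>y0\<close> to
    \<open>orig\<close>, which makes the section \<open>\<sigma>\<close>, available only near
    \<open>orig\<close>, usable near an arbitrary point.\<close>
  define k where "k = inv\<^bsub>G\<^esub> g0"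
  define E where "E = chart_map c ` (chart_dom c \<inter> act k -` chart_dom d0)"
  define \<tau> where "\<tau> = local_rep c d0 (act k)"
  have E: "relopen ?W E" unfolding E_def
    by (rule relopen_local_rep[OF M M smooth_mapD(1)[OF smooth_act_left] c d0(1)])
  have s\<tau>: "smooth_on ?W E \<tau>" unfolding E_def \<tau>_def
    by (rule smooth_mapD(2)[OF smooth_act_left c d0(1)])
  have Ec: "E \<subseteq> chart_img c" using cc(5) by (auto simp: E_def)
  have \<tau>E: "\<tau> ` E \<subseteq> ?W" using chart_map_in_model[OF M d0(1)] cc(4) by (auto simp: E_def \<tau>_def local_rep_def)
  define N' where "N' = E \<inter> \<tau> -` N"
  have N': "relopen ?W N'" unfolding N'_def by (rule relopen_vimage[OF E N(1) smooth_on_imp_continuous_on[OF s\<tau>] \<tau>E])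
  have k0: "act k (chart_inv c y0) = orig" unfolding k_def g0[symmetric] by simp
  have y0N: "y0 \<in> N'"
  proof -
    have "y0 \<in> E" unfolding E_def
      by (rule image_eqI[of _ _ "chart_inv c y0"]) (use cc(6,7)[OF y0] k0 d0(2) in auto)
    then show ?thesis using N(2) k0 by (simp add: N'_def \<tau>_def local_rep_def)
  qed
  have N'c: "N' \<subseteq> chart_img c" and N'E: "N' \<subseteq> E" using Ec by (auto simp: N'_def)
  define s where "s = (\<lambda>y. \<sigma> (\<tau> y))"
  have ss: "smooth_on ?W N' s" unfolding s_def
    by (rule smooth_on_compose[OF N' N(1) _ smooth_on_subset[OF s\<tau> N'E] \<sigma>(1)]) (auto simp: N'_def)
  have sc: "s y \<in> chart_img c0" "s y \<in> ?V" if "y \<in> N'" for y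
    using that \<sigma>(2,3) by (auto simp: s_def N'_def)
  \<comment> \<open>A group element that carries \<open>orig\<close> to the point with coordinates
    \<open>y\<close>. Only its factor \<open>chart_inv c0 (s y)\<close> varies with
    \<open>y\<close>, and it does so inside the single chart \<open>c0\<close>.\<close>
  define h where "h = (\<lambda>y. g0 \<otimes>\<^bsub>G\<^esub> chart_inv c0 (s y))"
  have hy: "act (h y) orig = chart_inv c y" if y: "y \<in> N'" for y
  proof -
    have dom: "act k (chart_inv c y) \<in> chart_dom d0" using y N'E cc(4) by (auto simp: E_def)
    have "act (chart_inv c0 (s y)) orig = chart_inv d0 (\<tau> y)" using \<sigma>(4) y by (simp add: s_def N'_def)
    also have "\<dots> = act k (chart_inv c y)" using dd0(4)[OF dom] by (simp add: \<tau>_def local_rep_def)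
    finally show ?thesis by (simp add: h_def act_mult k_def)
  qed
  \<comment> \<open>\<open>F\<close> and \<open>K\<close> are the inverse action and the conjugation
    with the varying factor of \<open>h\<close> as an additional argument; their derivatives in the
    second argument are the tangent action and the adjoint action.\<close>
  define F where "F = (\<lambda>p. act (inv\<^bsub>G\<^esub> (g0 \<otimes>\<^bsub>G\<^esub> fst p)) (snd p))"
  define K where "K = (\<lambda>p. (g0 \<otimes>\<^bsub>G\<^esub> fst p) \<otimes>\<^bsub>G\<^esub> snd p \<otimes>\<^bsub>G\<^esub> inv\<^bsub>G\<^esub> (g0 \<otimes>\<^bsub>G\<^esub> fst p))"
  note XM = smooth_manifold_prod[OF X M] and XX = smooth_manifold_prod[OF X X]
  have sF: "smooth_map (prod_mfd X M) M F" unfolding F_def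
    by (intro smooth_act[OF XM] smooth_inv[OF XM] smooth_mult[OF XM] smooth_map_const[OF XM X]
        smooth_map_fst[OF X M] smooth_map_snd[OF X M])
  have sK: "smooth_map (prod_mfd X X) X K" unfolding K_def
    by (intro smooth_inv[OF XX] smooth_mult[OF XX] smooth_map_const[OF XX X]
        smooth_map_fst[OF X X] smooth_map_snd[OF X X])
  have cM: "prod_chart c0 c \<in> atlas (prod_mfd X M)" and cX: "prod_chart c0 c0 \<in> atlas (prod_mfd X X)"
    by (intro prod_chart_in_atlas c0(1) c)+
  define DF where "DF = chart_map (prod_chart c0 c) ` (chart_dom (prod_chart c0 c) \<inter> F -` chart_dom d0)"
  define DK where "DK = chart_map (prod_chart c0 c0) ` (chart_dom (prod_chart c0 c0) \<inter> K -` chart_dom c0)"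
  have roF: "relopen (?V \<times> ?W) DF" and roK: "relopen (?V \<times> ?V) DK"
    using relopen_local_rep[OF XM M smooth_mapD(1)[OF sF] cM d0(1)] relopen_local_rep[OF XX X smooth_mapD(1)[OF sK] cX c0(1)]
    unfolding DF_def DK_def model_prod by blast+
  have repF: "smooth_on (?V \<times> ?W) DF (local_rep (prod_chart c0 c) d0 F)"
    and repK: "smooth_on (?V \<times> ?V) DK (local_rep (prod_chart c0 c0) c0 K)"
    using smooth_mapD(2)[OF sF cM d0(1)] smooth_mapD(2)[OF sK cX c0(1)]
    unfolding DF_def DK_def model_prod by blast+
  define F' where "F' = (\<lambda>q. frechet_derivative (local_rep (prod_chart c0 c) d0 F) (at q within ?V \<times> ?W) (0, w))"
  define K' where "K' = (\<lambda>\<eta> q. frechet_derivative (local_rep (prod_chart c0 c0) c0 K) (at q within ?V \<times> ?V) (0, \<eta>))"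
  have sF': "smooth_on (?V \<times> ?W) DF F'" unfolding F'_def
    by (rule smooth_on_frechet_derivative[OF repF]) (use w subspace_0[OF subspace_X] in simp)
  have sK': "smooth_on (?V \<times> ?V) DK (K' \<eta>)" if "\<eta> \<in> ?V" for \<eta> unfolding K'_def
    by (rule smooth_on_frechet_derivative[OF repK]) (use that subspace_0[OF subspace_X] in simp)
  have ka: "a0 \<in> chart_img c0" using S0D(1)[OF a0_in(1)] .
  have Fy: "F (chart_inv c0 (s y), chart_inv c y) = orig" if "y \<in> N'" for y
  proof -
    have "F (chart_inv c0 (s y), chart_inv c y) = act (inv\<^bsub>G\<^esub> (h y)) (act (h y) orig)"
      unfolding hy[OF that] by (simp add: F_def h_def)
    then show ?thesis by simp
  qed
  have Ky: "K (chart_inv c0 (s y), chart_inv c0 a0) = \<one>\<^bsub>G\<^esub>" for y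
    by (simp add: K_def a0_in(3))
  have inF: "(s y, y) \<in> DF" if "y \<in> N'" for y unfolding DF_def
    by (rule prod_chart_image_mem[OF X M c0(1) c sc(1)[OF that]]) (use that N'c Fy d0(2) in auto)
  have inK: "(s y, a0) \<in> DK" if "y \<in> N'" for y unfolding DK_def
    by (rule prod_chart_image_mem[OF X X c0(1) c0(1) sc(1)[OF that] ka]) (use Ky c0(2) in auto)
  \<comment> \<open>The inverse of \<open>h y\<close> moves every point considered to
    \<open>orig\<close>, so the chart selected at the image is \<open>d0\<close> for all
    \<open>y\<close>.\<close>
  have tF: "tact (inv\<^bsub>G\<^esub> (h y)) (chart_inv c y) (coord_vector M c w y) = F' (s y, y)" if y: "y \<in> N'" for y
  proof -
    have yc: "y \<in> chart_img c" using y N'c by blast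
    have "d0 = chart_at M (act (inv\<^bsub>G\<^esub> (h y)) (chart_inv c y))" using hy[OF y, symmetric] by (simp add: d0_def)
    from tangent_map_coord_vector[OF M M smooth_act_left c yc w this]
    have "tact (inv\<^bsub>G\<^esub> (h y)) (chart_inv c y) (coord_vector M c w y)
      = frechet_derivative (local_rep c d0 (\<lambda>z. F (chart_inv c0 (s y), z))) (at y within ?W) w"
      by (simp add: F_def h_def eta_contract_eq)
    also have "\<dots> = F' (s y, y)" unfolding F'_def
      by (rule partial_derivative_local_rep[OF X M M sF c0(1) c d0(1) sc(1)[OF y] yc _ w]) (simp add: Fy[OF y] d0(2))
    finally show ?thesis .
  qed
  \<comment> \<open>Conjugation fixes the unit, so \<open>c0\<close> is the selected chart on both
    sides for all \<open>y\<close>.\<close>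
  have tK: "Adj (h y) \<eta> = K' \<eta> (s y, a0)" if y: "y \<in> N'" and \<eta>: "\<eta> \<in> ?V" for y \<eta>
  proof -
    have "Adj (h y) \<eta> = frechet_derivative (local_rep c0 c0 (\<lambda>z. K (chart_inv c0 (s y), z))) (at a0 within ?V) \<eta>"
      by (simp add: Ad_def tangent_map_eq K_def h_def c0_def[symmetric] a0_def)
    also have "\<dots> = K' \<eta> (s y, a0)" unfolding K'_def
      by (rule partial_derivative_local_rep[OF X X X sK c0(1) c0(1) c0(1) sc(1)[OF y] ka _ \<eta>]) (simp add: Ky c0(2))
    finally show ?thesis .
  qed
  obtain P where P: "bounded_linear P" "range P \<subseteq> ?V" "\<And>v. v \<in> ?V \<Longrightarrow> P v = v"
    using subspace_projection_exists[OF subspace_X] by metis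
  \<comment> \<open>Smoothness of \<open>Adj (h y)\<close> is available at fixed vectors only, hence
    the moving argument is expanded along the vectors \<open>P b\<close>.\<close>
  have eq: "(\<Sum>b\<in>Basis. (\<theta> (F' (s y, y)) \<bullet> b) *\<^sub>R K' (P b) (s y, a0)) = \<omega> (chart_inv c y) (coord_vector M c w y)"
    if y: "y \<in> N'" for y
  proof -
    have yc: "y \<in> chart_img c" using y N'c by blast
    have cv: "coord_vector M c w y \<in> ?W" by (rule coord_vector_in_model[OF M c yc w])
    have "F' (s y, y) \<in> ?W" using tact_in[OF cv, of "inv\<^bsub>G\<^esub> (h y)" "chart_inv c y"] tF[OF y] by simp
    then have \<theta>V: "\<theta> (F' (s y, y)) \<in> ?V" using \<theta>(2) by blast
    have "\<omega> (chart_inv c y) (coord_vector M c w y) = Adj (h y) (\<theta> (F' (s y, y)))"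
      using \<omega>[OF hy[OF y] cv] tF[OF y] by simp
    also have "\<dots> = (\<Sum>b\<in>Basis. (\<theta> (F' (s y, y)) \<bullet> b) *\<^sub>R Adj (h y) (P b))"
      by (rule projection_expansion[OF P(1,3) linear_Adj \<theta>V])
    also have "\<dots> = (\<Sum>b\<in>Basis. (\<theta> (F' (s y, y)) \<bullet> b) *\<^sub>R K' (P b) (s y, a0))"
      using tK[OF y] P(2) by (intro sum.cong refl) auto
    finally show ?thesis by simp
  qed
  have s1: "smooth_on ?W N' (\<lambda>y. F' (s y, y))"
    by (rule smooth_on_compose[OF N' roF _ smooth_on_Pair[OF N' ss smooth_on_ident[OF N']] sF']) (use inF in blast)
  have s2: "smooth_on ?W N' (\<lambda>y. K' (P b) (s y, a0))" for b
    by (rule smooth_on_compose[OF N' roK _ smooth_on_Pair[OF N' ss smooth_on_const[OF N']] sK']) (use inK P(2) in blast)+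
  have "smooth_on ?W N' (\<lambda>y. (\<Sum>b\<in>Basis. (\<theta> (F' (s y, y)) \<bullet> b) *\<^sub>R K' (P b) (s y, a0)))"
    by (intro smooth_on_sum[OF N'] smooth_on_scaleR[OF N'] s2
        smooth_on_bounded_linear_comp[OF N' bounded_linear_inner_left] smooth_on_bounded_linear_comp[OF N' \<theta>(1)] s1)
  then have "smooth_on ?W N' (\<lambda>y. \<omega> (chart_inv c y) (coord_vector M c w y))"
    by (rule smooth_on_cong[OF N', rotated]) (rule eq)
  then show "\<exists>T. relopen ?W T \<and> y0 \<in> T \<and> smooth_on ?W T (\<lambda>y. \<omega> (chart_inv c y) (coord_vector M c w y))"
    using N' y0N by blast
qed

end

section \<open>Sections, complements and connections\<close>

lemma coset_eq_iff:
  assumes "subspace h" shows "coset h \<xi> = coset h \<xi>' \<longleftrightarrow> \<xi> - \<xi>' \<in> h"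
proof
  assume eq: "coset h \<xi> = coset h \<xi>'"
  have "\<xi> \<in> coset h \<xi>" using subspace_0[OF assms] by (force simp: coset_def)
  then show "\<xi> - \<xi>' \<in> h" unfolding eq by (auto simp: coset_def)
next
  have sub: "coset h a \<subseteq> coset h b" if "a - b \<in> h" for a b
  proof
    fix z assume "z \<in> coset h a"
    then obtain \<eta> where "\<eta> \<in> h" "z = a + \<eta>" by (auto simp: coset_def)
    then have "z = b + ((a - b) + \<eta>)" "(a - b) + \<eta> \<in> h" using that subspace_add[OF assms] by auto
    then show "z \<in> coset h b" unfolding coset_def by blast
  qed
  assume "\<xi> - \<xi>' \<in> h"
  moreover from this have "\<xi>' - \<xi> \<in> h" using subspace_neg[OF assms] by fastforce
  ultimately show "coset h \<xi> = coset h \<xi>'" using sub by blast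
qed

lemma linear_on_combination:
  assumes "linear_on V f" "linear_on V g"
  shows "linear_on V (\<lambda>x. u *\<^sub>R f x + v *\<^sub>R g x)"
  using assms by (simp add: linear_on_def algebra_simps)

lemma linear_on_compose:
  assumes "linear_on V f" "f ` V \<subseteq> W" "linear_on W g"
  shows "linear_on V (\<lambda>x. g (f x))"
  using assms by (simp add: linear_on_def image_subset_iff)

lemma linear_imp_linear_on: "linear f \<Longrightarrow> linear_on V f"
  by (simp add: linear_on_def linear_add linear_scale)

lemma in_quotient_space: "\<xi> \<in> V \<Longrightarrow> coset h \<xi> \<in> quotient_space V h"
  by (simp add: quotient_space_def)

lemma quotient_linear_maps_iff:
  "\<mu> \<in> quotient_linear_maps V h W \<longleftrightarrow> linear_on V (\<lambda>\<xi>. \<mu> (coset h \<xi>)) \<and>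
     (\<forall>\<xi>\<in>V. \<mu> (coset h \<xi>) \<in> W) \<and> (\<forall>A. A \<notin> quotient_space V h \<longrightarrow> \<mu> A = 0)"
  by (auto simp: quotient_linear_maps_def quotient_space_def)

text \<open>The convention that such maps vanish outside the quotient turns agreement on cosets into
  equality of functions.\<close>

lemma quotient_linear_maps_eqI:
  assumes "\<mu> \<in> quotient_linear_maps V h W" "\<nu> \<in> quotient_linear_maps V h U"
    "\<And>\<xi>. \<xi> \<in> V \<Longrightarrow> \<mu> (coset h \<xi>) = \<nu> (coset h \<xi>)"
  shows "\<mu> = \<nu>"
proof
  fix A show "\<mu> A = \<nu> A"
    using assms by (cases "A \<in> quotient_space V h") (auto simp: quotient_linear_maps_iff quotient_space_def)
qed

lemma quotient_linear_maps_combination: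
  assumes "subspace W" "\<mu> \<in> quotient_linear_maps V h W" "\<nu> \<in> quotient_linear_maps V h W"
  shows "u *\<^sub>R \<mu> + v *\<^sub>R \<nu> \<in> quotient_linear_maps V h W"
  using assms linear_on_combination[of V "\<lambda>\<xi>. \<mu> (coset h \<xi>)" "\<lambda>\<xi>. \<nu> (coset h \<xi>)" u v]
  by (simp add: quotient_linear_maps_iff scaleR_fun_def subspace_add subspace_scale)

section \<open>Linear sections and complements\<close>

locale subspace_pair =
  fixes V h :: "'e::real_vector set"
  assumes V: "subspace V" and h: "subspace h" and hV: "h \<subseteq> V"
begin

lemma linear_sections_iff:
  "\<mu> \<in> linear_sections V h \<longleftrightarrow>
    \<mu> \<in> quotient_linear_maps V h V \<and> (\<forall>\<xi>\<in>V. \<mu> (coset h \<xi>) - \<xi> \<in> h)"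
  by (auto simp: linear_sections_def quotient_space_def coset_eq_iff[OF h])

lemma image_quotient: "\<mu> ` quotient_space V h = (\<lambda>\<xi>. \<mu> (coset h \<xi>)) ` V"
  by (auto simp: quotient_space_def)

lemma section_image_complement:
  assumes \<mu>: "\<mu> \<in> linear_sections V h"
  shows "\<mu> ` quotient_space V h \<in> complements V h"
proof -
  let ?s = "\<lambda>\<xi>. \<mu> (coset h \<xi>)"
  have lin: "linear_on V ?s" and sV: "\<And>\<xi>. \<xi> \<in> V \<Longrightarrow> ?s \<xi> \<in> V" and sh: "\<And>\<xi>. \<xi> \<in> V \<Longrightarrow> ?s \<xi> - \<xi> \<in> h"
    using \<mu> by (auto simp: linear_sections_iff quotient_linear_maps_iff)
  have s0: "?s 0 = 0" using lin subspace_0[OF V] unfolding linear_on_def by (metis scaleR_zero_left)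
  have sub: "subspace (?s ` V)"
    unfolding subspace_def
  proof (intro conjI ballI allI)
    show "0 \<in> ?s ` V" using s0 subspace_0[OF V] by (metis imageI)
    show "x + y \<in> ?s ` V" if xy: "x \<in> ?s ` V" "y \<in> ?s ` V" for x y
    proof -
      obtain a b where ab: "a \<in> V" "b \<in> V" "x = ?s a" "y = ?s b" using xy by blast
      then have "x + y = ?s (a + b)" using lin by (simp add: linear_on_def)
      then show ?thesis using ab(1,2) subspace_add[OF V] by blast
    qed
    show "c *\<^sub>R x \<in> ?s ` V" if x: "x \<in> ?s ` V" for c x
    proof -
      obtain a where a: "a \<in> V" "x = ?s a" using x by blast
      then have "c *\<^sub>R x = ?s (c *\<^sub>R a)" using lin by (simp add: linear_on_def)
      then show ?thesis using a(1) subspace_scale[OF V] by blast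
    qed
  qed
  have "V = {\<eta> + \<xi> |\<eta> \<xi>. \<eta> \<in> h \<and> \<xi> \<in> ?s ` V}"
  proof (intro equalityI subsetI)
    fix \<xi> assume \<xi>: "\<xi> \<in> V"
    then have "- (?s \<xi> - \<xi>) \<in> h" using subspace_neg[OF h sh] by blast
    moreover have "\<xi> = - (?s \<xi> - \<xi>) + ?s \<xi>" by simp
    ultimately show "\<xi> \<in> {\<eta> + \<xi> |\<eta> \<xi>. \<eta> \<in> h \<and> \<xi> \<in> ?s ` V}" using \<xi> by blast
  qed (use sV hV subspace_add[OF V] in blast)
  moreover have "h \<inter> ?s ` V = {0}"
  proof -
    \<comment> \<open>If the value of a section lies in \<open>h\<close>, then so does its argument,
      as the two differ by an element of \<open>h\<close>; the coset is thus that of 0.\<close>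
    have "?s \<xi> = 0" if "\<xi> \<in> V" "?s \<xi> \<in> h" for \<xi>
    proof -
      have "\<xi> \<in> h" using subspace_diff[OF h that(2) sh[OF that(1)]] by simp
      then have "coset h \<xi> = coset h 0" by (simp add: coset_eq_iff[OF h])
      then show ?thesis using s0 by simp
    qed
    moreover have "0 \<in> ?s ` V" using s0 subspace_0[OF V] by (metis imageI)
    ultimately show ?thesis using subspace_0[OF h] by auto
  qed
  ultimately show ?thesis unfolding complements_def image_quotient using sub by simp
qed

text \<open>On a given coset the two values differ by an element of \<open>h\<close> and both lie in
  the common image, which meets \<open>h\<close> in 0 only.\<close>

lemma linear_sections_eqI:
  assumes \<mu>: "\<mu> \<in> linear_sections V h" and \<nu>: "\<nu> \<in> linear_sections V h"
    and im: "\<mu> ` quotient_space V h = \<nu> ` quotient_space V h"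
  shows "\<mu> = \<nu>"
proof (rule quotient_linear_maps_eqI)
  show "\<mu> \<in> quotient_linear_maps V h V" "\<nu> \<in> quotient_linear_maps V h V"
    using \<mu> \<nu> by (simp_all add: linear_sections_iff)
  fix \<xi> assume \<xi>: "\<xi> \<in> V"
  let ?m = "\<mu> ` quotient_space V h"
  have c: "subspace ?m" "h \<inter> ?m = {0}" using section_image_complement[OF \<mu>] by (simp_all add: complements_def)
  have "\<mu> (coset h \<xi>) \<in> ?m" using \<xi> by (simp add: in_quotient_space)
  moreover have "\<nu> (coset h \<xi>) \<in> ?m" unfolding im using \<xi> by (simp add: in_quotient_space)
  ultimately have "\<mu> (coset h \<xi>) - \<nu> (coset h \<xi>) \<in> ?m" by (rule subspace_diff[OF c(1)])
  moreover have "(\<mu> (coset h \<xi>) - \<xi>) - (\<nu> (coset h \<xi>) - \<xi>) \<in> h"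
    by (rule subspace_diff[OF h]) (use \<mu> \<nu> \<xi> in \<open>simp_all add: linear_sections_iff\<close>)
  ultimately have "\<mu> (coset h \<xi>) - \<nu> (coset h \<xi>) \<in> h \<inter> ?m" by simp
  then show "\<mu> (coset h \<xi>) = \<nu> (coset h \<xi>)" unfolding c(2) by simp
qed

text \<open>The section picks from each coset its unique element in \<open>m\<close>. Linearity is a
  consequence of this uniqueness, since sums and multiples of picked elements again lie in
  \<open>m\<close> and in the right coset.\<close>

lemma complement_section_exists:
  assumes m: "m \<in> complements V h"
  shows "\<exists>\<mu>. \<mu> \<in> linear_sections V h \<and> \<mu> ` quotient_space V h = m"
proof -
  have sm: "subspace m" and dec: "V = {\<eta> + \<xi> |\<eta> \<xi>. \<eta> \<in> h \<and> \<xi> \<in> m}" and int: "h \<inter> m = {0}"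
    using m by (simp_all add: complements_def)
  have mV: "m \<subseteq> V"
  proof
    fix x assume "x \<in> m"
    then have "0 + x \<in> V" using subspace_0[OF h] unfolding dec by blast
    then show "x \<in> V" by simp
  qed
  have uniq: "x = y" if "x \<in> m" "y \<in> m" "x - \<xi> \<in> h" "y - \<xi> \<in> h" for x y \<xi>
  proof -
    have "(x - \<xi>) - (y - \<xi>) \<in> h" by (rule subspace_diff[OF h that(3,4)])
    then have "x - y \<in> h \<inter> m" using subspace_diff[OF sm that(1,2)] by simp
    then show ?thesis unfolding int by simp
  qed
  define \<mu> where "\<mu> = (\<lambda>A. if A \<in> quotient_space V h then SOME x. x \<in> m \<and> coset h x = A else 0)"
  have \<mu>1: "\<mu> (coset h \<xi>) \<in> m \<and> \<mu> (coset h \<xi>) - \<xi> \<in> h" if \<xi>: "\<xi> \<in> V" for \<xi>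
  proof -
    obtain \<eta> x where x: "\<eta> \<in> h" "x \<in> m" "\<xi> = \<eta> + x" using \<xi> dec by blast
    then have "x \<in> m \<and> coset h x = coset h \<xi>" using subspace_neg[OF h x(1)] by (simp add: coset_eq_iff[OF h])
    then show ?thesis
      using someI[of "\<lambda>x. x \<in> m \<and> coset h x = coset h \<xi>"] in_quotient_space[OF \<xi>, of h]
      by (simp add: \<mu>_def coset_eq_iff[OF h])
  qed
  have \<mu>eq: "\<mu> (coset h \<xi>) = x" if "\<xi> \<in> V" "x \<in> m" "x - \<xi> \<in> h" for \<xi> x
    using uniq[OF conjunct1[OF \<mu>1[OF that(1)]] that(2) conjunct2[OF \<mu>1[OF that(1)]] that(3)] .
  have "linear_on V (\<lambda>\<xi>. \<mu> (coset h \<xi>))"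
    unfolding linear_on_def
  proof (intro conjI ballI allI)
    fix v w assume vw: "v \<in> V" "w \<in> V"
    show "\<mu> (coset h (v + w)) = \<mu> (coset h v) + \<mu> (coset h w)"
    proof (rule \<mu>eq)
      show "v + w \<in> V" using vw subspace_add[OF V] by blast
      show "\<mu> (coset h v) + \<mu> (coset h w) \<in> m" using vw \<mu>1 subspace_add[OF sm] by blast
      have "(\<mu> (coset h v) - v) + (\<mu> (coset h w) - w) \<in> h" using vw \<mu>1 subspace_add[OF h] by blast
      then show "\<mu> (coset h v) + \<mu> (coset h w) - (v + w) \<in> h" by (simp add: algebra_simps)
    qed
  next
    fix r v assume v: "v \<in> V"
    show "\<mu> (coset h (r *\<^sub>R v)) = r *\<^sub>R \<mu> (coset h v)"
    proof (rule \<mu>eq)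
      show "r *\<^sub>R v \<in> V" using v subspace_scale[OF V] by blast
      show "r *\<^sub>R \<mu> (coset h v) \<in> m" using v \<mu>1 subspace_scale[OF sm] by blast
      have "r *\<^sub>R (\<mu> (coset h v) - v) \<in> h" using v \<mu>1 subspace_scale[OF h] by blast
      then show "r *\<^sub>R \<mu> (coset h v) - r *\<^sub>R v \<in> h" by (simp add: algebra_simps)
    qed
  qed
  then have sec: "\<mu> \<in> linear_sections V h"
    using \<mu>1 mV by (auto simp: linear_sections_iff quotient_linear_maps_iff) (simp add: \<mu>_def)
  have "\<mu> ` quotient_space V h = m"
  proof
    show "\<mu> ` quotient_space V h \<subseteq> m" using \<mu>1 by (auto simp: image_quotient)
    have "x = \<mu> (coset h x)" if "x \<in> m" for x using \<mu>eq[of x x] that mV subspace_0[OF h] by auto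
    then show "m \<subseteq> \<mu> ` quotient_space V h" using mV unfolding image_quotient by blast
  qed
  with sec show ?thesis by blast
qed

lemma section_of_image:
  assumes "\<mu> \<in> linear_sections V h" shows "section_of V h (\<mu> ` quotient_space V h) = \<mu>"
  unfolding section_of_def by (rule the_equality) (use assms linear_sections_eqI in blast)+

lemma section_of_complement:
  assumes "m \<in> complements V h"
  shows "section_of V h m \<in> linear_sections V h" "section_of V h m ` quotient_space V h = m"
proof -
  obtain \<mu> where \<mu>: "\<mu> \<in> linear_sections V h" "m = \<mu> ` quotient_space V h"
    using complement_section_exists[OF assms] by blast
  show "section_of V h m \<in> linear_sections V h" "section_of V h m ` quotient_space V h = m"
    unfolding \<mu>(2) section_of_image[OF \<mu>(1)] using \<mu>(1) by simp_all
qed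

end

section \<open>Equivariant sections and reductive structures\<close>

context lie_transitive_action
begin

text \<open>The isotropy algebra in its form as a kernel, to which
  \<open>subgroup_lie_algebra_eq\<close> gives access.\<close>

definition "hh = {\<xi> \<in> model X. A0 \<xi> = 0}"
definition "HH = stabilizer G act orig"

lemma subspace_hh: "subspace hh"
  unfolding hh_def subspace_def using subspace_X linear_A0
  by (simp add: subspace_0 subspace_add subspace_scale linear_0 linear_add linear_scale)

sublocale subspace_pair "model X" hh
  by standard (use subspace_X subspace_hh in \<open>auto simp: hh_def\<close>)

lemma HH_iff: "g \<in> HH \<longleftrightarrow> act g orig = orig"
  by (simp add: HH_def stabilizer_def)

lemma A0_Adj: "k \<in> HH \<Longrightarrow> \<xi> \<in> model X \<Longrightarrow> A0 (Adj k \<xi>) = tact k orig (A0 \<xi>)"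
  using infa_Adj[of \<xi> k orig] by (simp add: A0_def HH_iff)

lemma Adj_hh: "k \<in> HH \<Longrightarrow> \<xi> \<in> hh \<Longrightarrow> Adj k \<xi> \<in> hh"
  using A0_Adj Adj_in linear_0[OF linear_tact] by (simp add: hh_def)

abbreviation "eqmaps W \<equiv> equivariant_maps X G HH hh W"
abbreviation "eqsecs \<equiv> equivariant_sections X G HH hh"

lemma eqsecs_iff:
  "\<mu> \<in> eqsecs \<longleftrightarrow> \<mu> \<in> linear_sections (model X) hh \<and>
    (\<forall>k\<in>HH. \<forall>\<xi>\<in>model X. \<mu> (coset hh (Adj k \<xi>)) = Adj k (\<mu> (coset hh \<xi>)))"
  by (auto simp: equivariant_sections_def equivariant_maps_def linear_sections_def)

lemma eqmaps_combination:
  assumes "subspace W" "\<mu> \<in> eqmaps W" "\<nu> \<in> eqmaps W"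
  shows "u *\<^sub>R \<mu> + v *\<^sub>R \<nu> \<in> eqmaps W"
  using quotient_linear_maps_combination[OF assms(1), of \<mu> "model X" hh \<nu> u v] assms(2,3)
  by (simp add: equivariant_maps_def scaleR_fun_def linear_add[OF linear_Adj] linear_scale[OF linear_Adj])

lemma eqsecs_eqmaps: "\<mu> \<in> eqsecs \<longleftrightarrow> \<mu> \<in> eqmaps (model X) \<and> (\<forall>\<xi>\<in>model X. \<mu> (coset hh \<xi>) - \<xi> \<in> hh)"
  by (auto simp: eqsecs_iff linear_sections_iff equivariant_maps_def)

lemma eqsecs_combination:
  assumes \<mu>: "\<mu> \<in> eqsecs" and \<nu>: "\<nu> \<in> eqsecs" and uv: "u + v = 1"
  shows "u *\<^sub>R \<mu> + v *\<^sub>R \<nu> \<in> eqsecs"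
proof -
  have "(u *\<^sub>R \<mu> + v *\<^sub>R \<nu>) (coset hh \<xi>) - \<xi> \<in> hh" if \<xi>: "\<xi> \<in> model X" for \<xi>
  proof -
    have "u *\<^sub>R (\<mu> (coset hh \<xi>) - \<xi>) + v *\<^sub>R (\<nu> (coset hh \<xi>) - \<xi>) \<in> hh"
      using \<mu> \<nu> \<xi> by (intro subspace_add[OF subspace_hh] subspace_scale[OF subspace_hh]) (simp_all add: eqsecs_eqmaps)
    moreover have "u *\<^sub>R \<xi> + v *\<^sub>R \<xi> = \<xi>" using uv by (simp flip: scaleR_add_left)
    ultimately show ?thesis by (simp add: scaleR_fun_def algebra_simps)
  qed
  then show ?thesis using eqmaps_combination[OF subspace_X] \<mu> \<nu> by (simp add: eqsecs_eqmaps)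
qed

lemma affine_eqsecs: "affine eqsecs"
  unfolding affine_def using eqsecs_combination by blast

lemma zero_eqmaps: "subspace W \<Longrightarrow> 0 \<in> eqmaps W"
  by (simp add: equivariant_maps_def quotient_linear_maps_iff linear_on_def subspace_0 linear_0[OF linear_Adj])

lemma subspace_eqmaps: "subspace W \<Longrightarrow> subspace (eqmaps W)"
  unfolding subspace_def[of "eqmaps W"]
  using eqmaps_combination[of W _ _ 1 1] eqmaps_combination[of W _ 0 _ 0] zero_eqmaps by auto

lemma eqmaps_mono: "W \<subseteq> U \<Longrightarrow> eqmaps W \<subseteq> eqmaps U"
  by (auto simp: equivariant_maps_def quotient_linear_maps_iff)

text \<open>Two sections agree modulo \<open>hh\<close> with the same representative, so their
  difference takes values in \<open>hh\<close>; adding an equivariant map into \<open>hh\<close>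
  does not change cosets.\<close>

lemma eqsecs_translate:
  assumes \<mu>: "\<mu> \<in> eqsecs" shows "eqsecs = {\<mu> + \<nu> | \<nu>. \<nu> \<in> eqmaps hh}"
proof (intro equalityI subsetI)
  fix \<mu>' assume \<mu>': "\<mu>' \<in> eqsecs"
  have d: "\<mu>' - \<mu> \<in> eqmaps (model X)"
    using eqmaps_combination[OF subspace_X, of \<mu>' \<mu> 1 "-1"] \<mu> \<mu>' by (simp add: eqsecs_eqmaps)
  have "(\<mu>' - \<mu>) (coset hh \<xi>) \<in> hh" if "\<xi> \<in> model X" for \<xi>
  proof -
    have "(\<mu>' (coset hh \<xi>) - \<xi>) - (\<mu> (coset hh \<xi>) - \<xi>) \<in> hh"
      by (rule subspace_diff[OF subspace_hh]) (use \<mu> \<mu>' that in \<open>simp_all add: eqsecs_eqmaps\<close>)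
    then show ?thesis by simp
  qed
  then have "\<mu>' - \<mu> \<in> eqmaps hh" using d by (simp add: equivariant_maps_def quotient_linear_maps_iff)
  moreover have "\<mu>' = \<mu> + (\<mu>' - \<mu>)" by simp
  ultimately show "\<mu>' \<in> {\<mu> + \<nu> | \<nu>. \<nu> \<in> eqmaps hh}" by blast
next
  fix \<mu>' assume "\<mu>' \<in> {\<mu> + \<nu> | \<nu>. \<nu> \<in> eqmaps hh}"
  then obtain \<nu> where \<nu>: "\<nu> \<in> eqmaps hh" "\<mu>' = \<mu> + \<nu>" by blast
  have "\<nu> \<in> eqmaps (model X)" using \<nu>(1) eqmaps_mono[OF hV] by blast
  then have "\<mu>' \<in> eqmaps (model X)"
    using eqmaps_combination[OF subspace_X, of \<mu> \<nu> 1 1] \<mu> \<nu>(2) by (simp add: eqsecs_eqmaps)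
  moreover have "\<mu>' (coset hh \<xi>) - \<xi> \<in> hh" if "\<xi> \<in> model X" for \<xi>
  proof -
    have "(\<mu> (coset hh \<xi>) - \<xi>) + \<nu> (coset hh \<xi>) \<in> hh"
      using \<mu> \<nu>(1) that
      by (intro subspace_add[OF subspace_hh]) (simp_all add: eqsecs_eqmaps equivariant_maps_def quotient_linear_maps_iff)
    then show ?thesis by (simp add: \<nu>(2) algebra_simps)
  qed
  ultimately show "\<mu>' \<in> eqsecs" by (simp add: eqsecs_eqmaps)
qed

lemma eqsecs_image_reductive:
  assumes \<mu>: "\<mu> \<in> eqsecs" shows "\<mu> ` quotient_space (model X) hh \<in> reductive_structures X G HH hh"
proof -
  have "Adj k (\<mu> (coset hh \<xi>)) \<in> \<mu> ` quotient_space (model X) hh" if "k \<in> HH" "\<xi> \<in> model X" for k \<xi>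
    using \<mu> that Adj_in[OF that(2)] by (metis eqsecs_iff image_eqI in_quotient_space)
  then have "Adj k ` \<mu> ` quotient_space (model X) hh \<subseteq> \<mu> ` quotient_space (model X) hh" if "k \<in> HH" for k
    using that by (auto simp: quotient_space_def)
  then show ?thesis
    using \<mu> section_image_complement by (auto simp: reductive_structures_def eqsecs_iff)
qed

text \<open>For \<open>k\<close> in the isotropy group,
  \<open>\<mu> (coset hh (Adj k \<xi>))\<close> and \<open>Adj k (\<mu> (coset hh \<xi>))\<close>
  both lie in \<open>m\<close> by invariance of \<open>m\<close>, and both are congruent to
  \<open>Adj k \<xi>\<close> by invariance of \<open>hh\<close>. The complement property makes them
  equal.\<close>

lemma section_of_reductive:
  assumes m: "m \<in> reductive_structures X G HH hh"
  shows "section_of (model X) hh m \<in> eqsecs"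
proof -
  define \<mu> where "\<mu> = section_of (model X) hh m"
  have mc: "m \<in> complements (model X) hh" and inv: "\<And>k x. k \<in> HH \<Longrightarrow> x \<in> m \<Longrightarrow> Adj k x \<in> m"
    using m by (auto simp: reductive_structures_def)
  have \<mu>: "\<mu> \<in> linear_sections (model X) hh" "\<mu> ` quotient_space (model X) hh = m"
    using section_of_complement[OF mc] by (simp_all add: \<mu>_def)
  have sm: "subspace m" "hh \<inter> m = {0}" using mc by (simp_all add: complements_def)
  have "\<mu> (coset hh (Adj k \<xi>)) = Adj k (\<mu> (coset hh \<xi>))" if k: "k \<in> HH" and \<xi>: "\<xi> \<in> model X" for k \<xi>
  proof -
    have s: "\<mu> (coset hh v) - v \<in> hh" "\<mu> (coset hh v) \<in> m" if "v \<in> model X" for v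
      using \<mu> that by (auto simp: linear_sections_iff in_quotient_space)
    have "(\<mu> (coset hh (Adj k \<xi>)) - Adj k \<xi>) - Adj k (\<mu> (coset hh \<xi>) - \<xi>) \<in> hh"
      by (rule subspace_diff[OF subspace_hh s(1)[OF Adj_in[OF \<xi>]] Adj_hh[OF k s(1)[OF \<xi>]]])
    then have "\<mu> (coset hh (Adj k \<xi>)) - Adj k (\<mu> (coset hh \<xi>)) \<in> hh"
      by (simp add: linear_diff[OF linear_Adj])
    moreover have "\<mu> (coset hh (Adj k \<xi>)) - Adj k (\<mu> (coset hh \<xi>)) \<in> m"
      by (rule subspace_diff[OF sm(1) s(2)[OF Adj_in[OF \<xi>]] inv[OF k s(2)[OF \<xi>]]])
    ultimately have "\<mu> (coset hh (Adj k \<xi>)) - Adj k (\<mu> (coset hh \<xi>)) \<in> hh \<inter> m" by simp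
    then show ?thesis unfolding sm(2) by simp
  qed
  then show ?thesis using \<mu>(1) by (simp add: eqsecs_iff \<mu>_def)
qed

lemma eqsecs_affine_comb: "\<mu> \<in> eqsecs \<Longrightarrow> \<nu> \<in> eqsecs \<Longrightarrow> affine_comb t \<mu> \<nu> \<in> eqsecs"
  unfolding affine_comb_def by (rule eqsecs_combination) simp_all

text \<open>The affine structure on complements is transported along \<open>section_of\<close>, with
  taking images as inverse. What has to be verified is that affine combinations of equivariant
  sections are again equivariant sections.\<close>

lemma reductive_affine_bijection:
  "affine_bijection (complement_comb (model X) hh) (reductive_structures X G HH hh)
     affine_comb eqsecs (section_of (model X) hh)"
  unfolding affine_bijection_def
proof (intro conjI allI ballI)
  let ?Q = "quotient_space (model X) hh"
  have sec: "\<mu> \<in> linear_sections (model X) hh" if "\<mu> \<in> eqsecs" for \<mu> using that by (simp add: eqsecs_iff)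
  have im: "section_of (model X) hh m ` ?Q = m" if "m \<in> reductive_structures X G HH hh" for m
    using that section_of_complement(2) by (simp add: reductive_structures_def)
  show "bij_betw (section_of (model X) hh) (reductive_structures X G HH hh) eqsecs"
    by (rule bij_betw_byWitness[where f' = "\<lambda>\<mu>. \<mu> ` ?Q"])
      (use im sec section_of_image section_of_reductive eqsecs_image_reductive in auto)
  fix t m m' assume m: "m \<in> reductive_structures X G HH hh" "m' \<in> reductive_structures X G HH hh"
  have e: "affine_comb t (section_of (model X) hh m) (section_of (model X) hh m') \<in> eqsecs"
    by (intro eqsecs_affine_comb section_of_reductive m)
  show "complement_comb (model X) hh t m m' \<in> reductive_structures X G HH hh"
    unfolding complement_comb_def by (rule eqsecs_image_reductive[OF e])
  show "section_of (model X) hh (complement_comb (model X) hh t m m') =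
      affine_comb t (section_of (model X) hh m) (section_of (model X) hh m')"
    unfolding complement_comb_def by (rule section_of_image[OF sec[OF e]])
qed

section \<open>Connections and equivariant sections\<close>

lemma connections_iff:
  "\<omega> \<in> connections X G M act \<longleftrightarrow>
    (\<forall>x. linear_on (model M) (\<omega> x)) \<and> (\<forall>x. \<forall>f\<in>model M. \<omega> x f \<in> model X) \<and> (\<forall>x f. f \<notin> model M \<longrightarrow> \<omega> x f = 0) \<and>
    (\<forall>c\<in>atlas M. \<forall>w\<in>model M. smooth_on (model M) (chart_img c) (\<lambda>y. \<omega> (chart_inv c y) (coord_vector M c w y))) \<and>
    (\<forall>x. \<forall>f\<in>model M. infa (\<omega> x f) x = f) \<and>
    (\<forall>g x. \<forall>f\<in>model M. \<omega> (act g x) (tact g x f) = Adj g (\<omega> x f))"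
  by (auto simp: connections_def isotropy_forms_def one_forms_def image_subset_iff)

lemma connections_combination:
  assumes \<omega>: "\<omega> \<in> connections X G M act" and \<omega>': "\<omega>' \<in> connections X G M act" and uv: "u + v = 1"
  shows "u *\<^sub>R \<omega> + v *\<^sub>R \<omega>' \<in> connections X G M act"
  unfolding connections_iff
proof (intro conjI allI ballI impI)
  note 1 = \<omega>[unfolded connections_iff] and 2 = \<omega>'[unfolded connections_iff]
  have ap: "(u *\<^sub>R \<omega> + v *\<^sub>R \<omega>') x f = u *\<^sub>R \<omega> x f + v *\<^sub>R \<omega>' x f" for x f by (simp add: scaleR_fun_def)
  show "linear_on (model M) ((u *\<^sub>R \<omega> + v *\<^sub>R \<omega>') x)" for x
  proof -
    have "(u *\<^sub>R \<omega> + v *\<^sub>R \<omega>') x = (\<lambda>f. u *\<^sub>R \<omega> x f + v *\<^sub>R \<omega>' x f)" by (rule ext) (rule ap)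
    then show ?thesis using linear_on_combination[of "model M" "\<omega> x" "\<omega>' x" u v] 1 2 by simp
  qed
  show "(u *\<^sub>R \<omega> + v *\<^sub>R \<omega>') x f \<in> model X" if "f \<in> model M" for x f
    using 1 2 that by (simp add: scaleR_fun_def subspace_add[OF subspace_X] subspace_scale[OF subspace_X])
  show "(u *\<^sub>R \<omega> + v *\<^sub>R \<omega>') x f = 0" if "f \<notin> model M" for x f using 1 2 that by (simp add: scaleR_fun_def)
  \<comment> \<open>The isotropy condition is affine and not linear in the form: the left side
    becomes \<open>u *\<^sub>R f + v *\<^sub>R f\<close>, and \<open>u + v = 1\<close> is used
    here.\<close>
  show "infa ((u *\<^sub>R \<omega> + v *\<^sub>R \<omega>') x f) x = f" if "f \<in> model M" for x f
    using 1 2 that uv linear_add[OF linear_infa[of x]] linear_scale[OF linear_infa[of x]]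
    by (simp add: scaleR_fun_def flip: scaleR_add_left)
  show "(u *\<^sub>R \<omega> + v *\<^sub>R \<omega>') (act g x) (tact g x f) = Adj g ((u *\<^sub>R \<omega> + v *\<^sub>R \<omega>') x f)" if "f \<in> model M" for g x f
    using 1 2 that by (simp add: scaleR_fun_def linear_add[OF linear_Adj] linear_scale[OF linear_Adj])
  show "smooth_on (model M) (chart_img c) (\<lambda>y. (u *\<^sub>R \<omega> + v *\<^sub>R \<omega>') (chart_inv c y) (coord_vector M c w y))"
    if "c \<in> atlas M" "w \<in> model M" for c w
  proof -
    note ro = relopen_chart_img[OF subspace_M smooth_manifold_is_chart[OF M that(1)]]
    show ?thesis unfolding ap
      by (intro smooth_on_add[OF ro] smooth_on_scaleR[OF ro] smooth_on_const[OF ro]) (use 1 2 that in blast)+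
  qed
qed

lemma affine_connections: "affine (connections X G M act)"
  unfolding affine_def using connections_combination by blast

definition connection_section :: "('m \<Rightarrow> 'f \<Rightarrow> 'e) \<Rightarrow> 'e set \<Rightarrow> 'e"
  where "connection_section \<omega> A = (if A \<in> quotient_space (model X) hh
    then \<omega> orig (A0 (SOME \<xi>. \<xi> \<in> model X \<and> A = coset hh \<xi>)) else 0)"

text \<open>Independence of the representative: two of them differ by an element of the kernel of
  \<open>A0\<close>.\<close>

lemma connection_section_coset:
  assumes \<xi>: "\<xi> \<in> model X" shows "connection_section \<omega> (coset hh \<xi>) = \<omega> orig (A0 \<xi>)"
proof -
  define \<xi>' where "\<xi>' = (SOME \<xi>'. \<xi>' \<in> model X \<and> coset hh \<xi> = coset hh \<xi>')"
  have "\<xi>' \<in> model X \<and> coset hh \<xi> = coset hh \<xi>'"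
    unfolding \<xi>'_def by (rule someI[of _ \<xi>]) (simp add: \<xi>)
  then have "\<xi> - \<xi>' \<in> hh" by (simp add: coset_eq_iff[OF subspace_hh])
  then have "A0 (\<xi> - \<xi>') = 0" by (simp add: hh_def)
  then have "A0 \<xi>' = A0 \<xi>" by (simp add: linear_diff[OF linear_A0])
  then show ?thesis using in_quotient_space[OF \<xi>] by (simp add: connection_section_def \<xi>'_def)
qed

text \<open>The isotropy condition at \<open>orig\<close> says that
  \<open>\<omega> orig (A0 \<xi>)\<close> and \<open>\<xi>\<close> have the same image under
  \<open>A0\<close>, which is the section property. Equivariance of \<open>\<omega>\<close> under
  elements fixing \<open>orig\<close> becomes equivariance of the section.\<close>

lemma connection_section_eqsecs:
  assumes \<omega>: "\<omega> \<in> connections X G M act" shows "connection_section \<omega> \<in> eqsecs"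
proof -
  note 1 = \<omega>[unfolded connections_iff]
  have lin: "linear_on (model X) (\<lambda>\<xi>. \<omega> orig (A0 \<xi>))"
    by (rule linear_on_compose[OF linear_imp_linear_on[OF linear_A0], where W = "model M"]) (use A0_in 1 in auto)
  have "linear_on (model X) (\<lambda>\<xi>. connection_section \<omega> (coset hh \<xi>))"
    using lin subspace_add[OF subspace_X] subspace_scale[OF subspace_X]
    by (simp add: linear_on_def connection_section_coset)
  then have "connection_section \<omega> \<in> quotient_linear_maps (model X) hh (model X)"
    using 1 A0_in by (simp add: quotient_linear_maps_iff connection_section_coset) (simp add: connection_section_def)
  moreover have "connection_section \<omega> (coset hh \<xi>) - \<xi> \<in> hh" if \<xi>: "\<xi> \<in> model X" for \<xi>
  proof -
    have "A0 (\<omega> orig (A0 \<xi>)) = A0 \<xi>" using 1 A0_in[OF \<xi>] by (simp add: A0_def)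
    then show ?thesis
      unfolding connection_section_coset[OF \<xi>]
      using 1 A0_in[OF \<xi>] \<xi> by (simp add: hh_def linear_diff[OF linear_A0] subspace_diff[OF subspace_X])
  qed
  moreover have "connection_section \<omega> (coset hh (Adj k \<xi>)) = Adj k (connection_section \<omega> (coset hh \<xi>))"
    if k: "k \<in> HH" and \<xi>: "\<xi> \<in> model X" for k \<xi>
  proof -
    have "\<omega> (act k orig) (tact k orig (A0 \<xi>)) = Adj k (\<omega> orig (A0 \<xi>))" using 1 A0_in[OF \<xi>] by blast
    then show ?thesis using k by (simp add: connection_section_coset \<xi> Adj_in A0_Adj HH_iff)
  qed
  ultimately show ?thesis by (simp add: eqsecs_iff linear_sections_iff)
qed

text \<open>As \<open>A0\<close> is onto, the section determines the form at \<open>orig\<close>;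
  equivariance and transitivity then determine it at every point.\<close>

lemma connection_section_inj: "inj_on connection_section (connections X G M act)"
proof (rule inj_onI)
  fix \<omega> \<omega>' assume \<omega>: "\<omega> \<in> connections X G M act" and \<omega>': "\<omega>' \<in> connections X G M act"
    and eq: "connection_section \<omega> = connection_section \<omega>'"
  note 1 = \<omega>[unfolded connections_iff] and 2 = \<omega>'[unfolded connections_iff]
  have o: "\<omega> orig f = \<omega>' orig f" if f: "f \<in> model M" for f
  proof -
    obtain \<xi> where "\<xi> \<in> model X" "A0 \<xi> = f" using A0_surj[OF f] by blast
    then show ?thesis using connection_section_coset[of \<xi> \<omega>] connection_section_coset[of \<xi> \<omega>'] eq by simp
  qed
  have "\<omega> x f = \<omega>' x f" for x f
  proof (cases "f \<in> model M")
    case True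
    obtain g where g: "act g orig = x" using act_transitive by blast
    define f' where "f' = tact (inv\<^bsub>G\<^esub> g) x f"
    have f': "f' \<in> model M" using tact_in[OF True] by (simp add: f'_def)
    have "act (inv\<^bsub>G\<^esub> g) x = orig" using g by auto
    then have f: "f = tact g orig f'" using tact_inv'[OF True, of g x] by (simp add: f'_def)
    have "\<omega> (act g orig) (tact g orig f') = Adj g (\<omega> orig f')"
      "\<omega>' (act g orig) (tact g orig f') = Adj g (\<omega>' orig f')" using 1 2 f' by blast+
    then show ?thesis using o[OF f'] g f by simp
  next
    case False then show ?thesis using 1 2 by simp
  qed
  then show "\<omega> = \<omega>'" by (simp add: fun_eq_iff)
qed

lemma connection_section_surj:
  assumes \<mu>: "\<mu> \<in> eqsecs" shows "\<exists>\<omega>\<in>connections X G M act. connection_section \<omega> = \<mu>"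
proof -
  let ?V = "model X" and ?W = "model M"
  have ml: "linear_on ?V (\<lambda>\<xi>. \<mu> (coset hh \<xi>))" and mV: "\<And>\<xi>. \<xi> \<in> ?V \<Longrightarrow> \<mu> (coset hh \<xi>) \<in> ?V"
    and ms: "\<And>\<xi>. \<xi> \<in> ?V \<Longrightarrow> \<mu> (coset hh \<xi>) - \<xi> \<in> hh" and mq: "\<mu> \<in> quotient_linear_maps ?V hh ?V"
    and me: "\<And>k \<xi>. k \<in> HH \<Longrightarrow> \<xi> \<in> ?V \<Longrightarrow> \<mu> (coset hh (Adj k \<xi>)) = Adj k (\<mu> (coset hh \<xi>))"
    using \<mu> by (auto simp: eqsecs_iff linear_sections_iff quotient_linear_maps_iff)
  obtain L where L: "linear L" "range L \<subseteq> ?V" "\<And>w. w \<in> ?W \<Longrightarrow> A0 (L w) = w"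
    by (rule submersion_chart) (rule that)
  obtain P where P: "bounded_linear P" "range P \<subseteq> ?W" "\<And>w. w \<in> ?W \<Longrightarrow> P w = w"
    using subspace_projection_exists[OF subspace_M] by metis
  \<comment> \<open>\<open>L\<close> chooses a representative of the coset belonging to a tangent
    vector at \<open>orig\<close>. Precomposition with \<open>P\<close> makes
    \<open>\<theta>\<close> linear on the whole type, as smoothness of the transported form
    requires.\<close>
  define \<theta> where "\<theta> = (\<lambda>f. \<mu> (coset hh (L (P f))))"
  have LP: "L w \<in> ?V" for w using L(2) by blast
  have "linear \<theta>"
    unfolding \<theta>_def using ml LP
    by (intro linearI) (simp_all add: linear_on_def linear_add[OF L(1)] linear_scale[OF L(1)]
        linear_add[OF bounded_linear.linear[OF P(1)]] linear_scale[OF bounded_linear.linear[OF P(1)]])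
  then have b\<theta>: "bounded_linear \<theta>" by (simp add: linear_conv_bounded_linear)
  have \<theta>V: "\<theta> f \<in> ?V" for f using mV LP by (simp add: \<theta>_def)
  have \<theta>A: "\<theta> (A0 \<xi>) = \<mu> (coset hh \<xi>)" if \<xi>: "\<xi> \<in> ?V" for \<xi>
  proof -
    have "L (A0 \<xi>) - \<xi> \<in> hh"
      using LP \<xi> L(3)[OF A0_in[OF \<xi>]] by (simp add: hh_def linear_diff[OF linear_A0] subspace_diff[OF subspace_X])
    then have "coset hh (L (A0 \<xi>)) = coset hh \<xi>" by (simp add: coset_eq_iff[OF subspace_hh])
    then show ?thesis using P(3)[OF A0_in[OF \<xi>]] by (simp add: \<theta>_def)
  qed
  have A\<theta>: "A0 (\<theta> f) = f" if f: "f \<in> ?W" for f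
  proof -
    obtain \<xi> where \<xi>: "\<xi> \<in> ?V" "A0 \<xi> = f" using A0_surj[OF f] by blast
    have "A0 (\<mu> (coset hh \<xi>) - \<xi>) = 0" using ms[OF \<xi>(1)] by (simp add: hh_def)
    then show ?thesis using \<theta>A[OF \<xi>(1)] \<xi>(2) by (simp add: linear_diff[OF linear_A0])
  qed
  have \<theta>H: "\<theta> (tact k orig f) = Adj k (\<theta> f)" if k: "k \<in> HH" and f: "f \<in> ?W" for k f
  proof -
    obtain \<xi> where \<xi>: "\<xi> \<in> ?V" "A0 \<xi> = f" using A0_surj[OF f] by blast
    have "\<theta> (tact k orig f) = \<theta> (A0 (Adj k \<xi>))" using A0_Adj[OF k \<xi>(1)] \<xi>(2) by simp
    also have "\<dots> = Adj k (\<mu> (coset hh \<xi>))" using \<theta>A[OF Adj_in[OF \<xi>(1)]] me[OF k \<xi>(1)] by simp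
    finally show ?thesis using \<theta>A[OF \<xi>(1)] \<xi>(2) by simp
  qed
  define \<omega> where "\<omega> = (\<lambda>x f. if f \<in> ?W then
    Adj (SOME g. act g orig = x) (\<theta> (tact (inv\<^bsub>G\<^esub> (SOME g. act g orig = x)) x f)) else 0)"
  \<comment> \<open>Two elements carrying \<open>orig\<close> to \<open>x\<close> differ by some
    \<open>k\<close> in the isotropy group, which can be moved across \<open>\<theta>\<close> by
    \<open>\<theta>H\<close>. Hence a local smooth choice may replace the arbitrary one.\<close>
  have \<omega>g: "\<omega> x f = Adj g (\<theta> (tact (inv\<^bsub>G\<^esub> g) x f))" if g: "act g orig = x" and f: "f \<in> ?W" for g x f
  proof -
    define g' where "g' = (SOME g. act g orig = x)"
    have g': "act g' orig = x" unfolding g'_def by (rule someI[of _ g]) (rule g)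
    define k where "k = inv\<^bsub>G\<^esub> g \<otimes>\<^bsub>G\<^esub> g'"
    have gk: "g' = g \<otimes>\<^bsub>G\<^esub> k" by (simp add: k_def m_assoc[symmetric])
    have k: "k \<in> HH" using g g' act_inv(1)[of g orig] by (simp add: HH_iff k_def act_mult)
    have o: "act (inv\<^bsub>G\<^esub> g') x = orig" using g' by auto
    define f' where "f' = tact (inv\<^bsub>G\<^esub> g') x f"
    have f': "f' \<in> ?W" using tact_in[OF f] by (simp add: f'_def)
    have "inv\<^bsub>G\<^esub> g = k \<otimes>\<^bsub>G\<^esub> inv\<^bsub>G\<^esub> g'" by (simp add: k_def m_assoc)
    then have "tact (inv\<^bsub>G\<^esub> g) x f = tact k orig f'"
      using tact_mult[OF f, of k "inv\<^bsub>G\<^esub> g'" x] o by (simp add: f'_def)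
    then have "Adj g (\<theta> (tact (inv\<^bsub>G\<^esub> g) x f)) = Adj g (Adj k (\<theta> f'))" using \<theta>H[OF k f'] by simp
    also have "\<dots> = Adj g' (\<theta> f')" using Adj_mult[OF \<theta>V, of g k] gk by simp
    also have "\<dots> = \<omega> x f" using f by (simp add: \<omega>_def f'_def g'_def)
    finally show ?thesis by simp
  qed
  have \<omega>c: "\<omega> \<in> connections X G M act"
    unfolding connections_iff
  proof (intro conjI allI ballI impI)
    fix x
    obtain g where g: "act g orig = x" using act_transitive by blast
    have o: "act (inv\<^bsub>G\<^esub> g) x = orig" using g by auto
    have "linear (\<lambda>f. Adj g (\<theta> (tact (inv\<^bsub>G\<^esub> g) x f)))"
      using linear_compose[OF linear_compose[OF linear_tact \<open>linear \<theta>\<close>] linear_Adj] by (simp add: o_def)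
    from linear_imp_linear_on[OF this, of ?W]
    show "linear_on ?W (\<omega> x)"
      using \<omega>g[OF g] subspace_add[OF subspace_M] subspace_scale[OF subspace_M] by (simp add: linear_on_def)
    fix f
    show "\<omega> x f \<in> ?V" if "f \<in> ?W" using \<omega>g[OF g that] Adj_in[OF \<theta>V] by simp
    show "\<omega> x f = 0" if "f \<notin> ?W" using that by (simp add: \<omega>_def)
    show "infa (\<omega> x f) x = f" if f: "f \<in> ?W"
    proof -
      have "infa (\<omega> x f) x = tact g orig (A0 (\<theta> (tact (inv\<^bsub>G\<^esub> g) x f)))"
        using infa_Adj[OF \<theta>V, of g _ orig] \<omega>g[OF g f] g by (simp add: A0_def)
      also have "\<dots> = tact g orig (tact (inv\<^bsub>G\<^esub> g) x f)" using A\<theta>[OF tact_in[OF f]] by simp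
      also have "\<dots> = f" using tact_inv'[OF f, of g x] o by simp
      finally show ?thesis .
    qed
    fix k
    show "\<omega> (act k x) (tact k x f) = Adj k (\<omega> x f)" if f: "f \<in> ?W"
    proof -
      have kg: "act (k \<otimes>\<^bsub>G\<^esub> g) orig = act k x" by (simp add: act_mult g)
      have "\<omega> (act k x) (tact k x f) = Adj (k \<otimes>\<^bsub>G\<^esub> g) (\<theta> (tact (inv\<^bsub>G\<^esub> (k \<otimes>\<^bsub>G\<^esub> g)) (act k x) (tact k x f)))"
        by (rule \<omega>g[OF kg tact_in[OF f]])
      \<comment> \<open>The inverse of \<open>k g\<close> first undoes the action of
        \<open>k\<close>, so that both sides of the equivariance equation involve the same vector at
        \<open>orig\<close>.\<close>
      also have "tact (inv\<^bsub>G\<^esub> (k \<otimes>\<^bsub>G\<^esub> g)) (act k x) (tact k x f) = tact (inv\<^bsub>G\<^esub> g) x f"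
        using tact_mult[OF tact_in[OF f, of k x], of "inv\<^bsub>G\<^esub> g" "inv\<^bsub>G\<^esub> k" "act k x"] tact_inv[OF f]
        by (simp add: inv_mult_group)
      finally show ?thesis using Adj_mult[OF \<theta>V] \<omega>g[OF g f] by simp
    qed
  next
    fix c w assume "c \<in> atlas M" "w \<in> ?W"
    then show "smooth_on ?W (chart_img c) (\<lambda>y. \<omega> (chart_inv c y) (coord_vector M c w y))"
      by (intro transported_form_smooth[OF b\<theta> _ \<omega>g]) (use \<theta>V in auto)
  qed
  have "connection_section \<omega> = \<mu>"
  proof (rule quotient_linear_maps_eqI[OF _ mq])
    show "connection_section \<omega> \<in> quotient_linear_maps ?V hh ?V"
      using connection_section_eqsecs[OF \<omega>c] by (simp add: eqsecs_iff linear_sections_iff)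
    fix \<xi> assume \<xi>: "\<xi> \<in> ?V"
    have "\<omega> orig (A0 \<xi>) = Adj \<one>\<^bsub>G\<^esub> (\<theta> (tact (inv\<^bsub>G\<^esub> \<one>\<^bsub>G\<^esub>) orig (A0 \<xi>)))"
      by (rule \<omega>g[OF act_one A0_in[OF \<xi>]])
    also have "\<dots> = Adj \<one>\<^bsub>G\<^esub> (\<mu> (coset hh \<xi>))" using tact_one[OF A0_in[OF \<xi>]] \<theta>A[OF \<xi>] by simp
    also have "\<dots> = \<mu> (coset hh \<xi>)"
      using tangent_map_ident[OF X mV[OF \<xi>]] by (simp add: Ad_def)
    finally show "connection_section \<omega> (coset hh \<xi>) = \<mu> (coset hh \<xi>)" by (simp add: connection_section_coset[OF \<xi>])
  qed
  then show ?thesis using \<omega>c by blast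
qed

lemma connection_section_affine_bijection:
  "affine_bijection affine_comb (connections X G M act) affine_comb eqsecs connection_section"
  unfolding affine_bijection_def
proof (intro conjI allI ballI)
  show "bij_betw connection_section (connections X G M act) eqsecs"
    unfolding bij_betw_def
    using connection_section_inj connection_section_eqsecs connection_section_surj by blast
  fix t \<omega> \<omega>' assume "\<omega> \<in> connections X G M act" "\<omega>' \<in> connections X G M act"
  then show "affine_comb t \<omega> \<omega>' \<in> connections X G M act"
    unfolding affine_comb_def by (rule connections_combination) simp
  \<comment> \<open>The representative selected in \<open>connection_section\<close> depends on the
    coset and not on the form, so combinations are compared at one and the same vector.\<close>
  show "connection_section (affine_comb t \<omega> \<omega>') = affine_comb t (connection_section \<omega>) (connection_section \<omega>')"
    by (simp add: fun_eq_iff connection_section_def affine_comb_def scaleR_fun_def)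
qed

end

text \<open>The formula for \<open>\<Phi>\<close> tells which bijection is meant and not merely that
  one exists. The underlying linear space is described by translation from an arbitrary section,
  which also makes sense when there is none.\<close>

theorem proposition4p8:
  fixes X :: "('g::{t2_space, second_countable_topology}, 'e::euclidean_space) mfd"
    and G :: "'g monoid"
    and M :: "('m::{t2_space, second_countable_topology}, 'f::euclidean_space) mfd"
    and act :: "'g \<Rightarrow> 'm \<Rightarrow> 'm"
    and orig :: 'm
    and H :: "'g set"
    and \<gg> \<hh> :: "'e set"
  assumes "lie_group X G"
    and "homogeneous_space X G M act"
    and "H = stabilizer G act orig"
    and "\<gg> = lie_algebra X"
    and "\<hh> = subgroup_lie_algebra X G H"
  shows
    "affine (connections X G M act) \<and>
     affine (equivariant_sections X G H \<hh>) \<and>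
     subspace (equivariant_maps X G H \<hh> \<hh>) \<and>
     (\<forall>\<mu>\<in>equivariant_sections X G H \<hh>.
        equivariant_sections X G H \<hh> = {\<mu> + \<nu> | \<nu>. \<nu> \<in> equivariant_maps X G H \<hh> \<hh>}) \<and>
     (\<exists>\<Phi>. affine_bijection affine_comb (connections X G M act)
            affine_comb (equivariant_sections X G H \<hh>) \<Phi> \<and>
        (\<forall>\<omega>\<in>connections X G M act. \<forall>\<xi>\<in>\<gg>.
            \<Phi> \<omega> (coset \<hh> \<xi>) = \<omega> orig (inf_action X G M act \<xi> orig))) \<and>
     affine_bijection (complement_comb \<gg> \<hh>) (reductive_structures X G H \<hh>)
       affine_comb (equivariant_sections X G H \<hh>) (section_of \<gg> \<hh>)"
proof -
  interpret lie_transitive_action X G M act orig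
    by standard (fact assms(1,2))+
  have H: "H = HH" using assms(3) by (simp add: HH_def)
  have hh: "\<hh> = hh" using assms(3,5) subgroup_lie_algebra_eq by (simp add: hh_def)
  show ?thesis
    unfolding H hh assms(4)
  proof (intro conjI ballI exI[of _ connection_section])
    show "connection_section \<omega> (coset hh \<xi>) = \<omega> orig (inf_action X G M act \<xi> orig)"
      if "\<xi> \<in> lie_algebra X" for \<omega> \<xi>
      using connection_section_coset[OF that] by (simp add: A0_def)
  qed (use affine_connections affine_eqsecs subspace_eqmaps[OF subspace_hh] eqsecs_translate
      connection_section_affine_bijection reductive_affine_bijection in auto)
qed

end
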